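(* Let $M$ be a connected manifold whose fundamental group $\Gamma=\pi_1(M)$ is finitely generated. Then the number $N(n)$ of equivalence classes of $n$-fold unbranched connected coverings of $M$ is $$N(n)=\frac{1}{n}\sum_{\substack{\ell\mid n\\ \ell m=n}}\ \sum_{\mathrm{H}\in\mathfrak{H}_m}\ \sum_{d\mid\ell}\mu\!\left(\frac{\ell}{d}\right)|\mathrm{Hom}(\mathrm{H},\mathbb{Z}_d)|\cdot M'_{\mathrm{H},\Gamma}(m),$$ where $\mathfrak{H}_m$ is the set of (isomorphism classes of) groups arising as first integral homology groups of $m$-fold unbranched connected coverings of $M$, and $M'_{\mathrm{H},\Gamma}(m)$ is the number of subgroups $F$ of index $m$ in $\Gamma$ with $\mathrm{H}_1(F)$ isomorphic to $\mathrm{H}$.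
   Context: $\mathrm{H}_1(F)=F/[F,F]$ is the first homology (abelianization) of a group $F$, and $\mathrm{H}_1$ of a manifold is its first homology over $\mathbb{Z}$; $\mathbb{Z}_d$ is the cyclic group of order $d$; $\mathrm{Hom}(\mathrm{H},\mathbb{Z}_d)$ is the set of homomorphisms $\mathrm{H}\to\mathbb{Z}_d$; $\mu$ is the Möbius function. No restriction on dimension; $M$ may be closed, open or bordered, orientable or not. *)

theory Defs
  imports
    "HOL-Analysis.Analysis"
    "HOL-Homology.Homology"
    "HOL-Algebra.Generated_Groups"
    "HOL-Algebra.Elementary_Groups"
    "HOL-Computational_Algebra.Squarefree"
begin

section \<open>Manifolds\<close>

text \<open>For \<open>n = 0\<close> the half-space is a single point, because every coordinate with
  index at least \<open>n\<close> is zero in \<^const>\<open>Euclidean_space\<close>.\<close>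

definition Euclidean_half_space :: "nat \<Rightarrow> (nat \<Rightarrow> real) topology" where
  "Euclidean_half_space n = subtopology (Euclidean_space n) {x. 0 \<le> x 0}"

text \<open>Topological manifolds with possibly empty boundary: an open subset of the half-space need
  not meet the bounding hyperplane.\<close>

definition manifold :: "nat \<Rightarrow> 'a topology \<Rightarrow> bool" where
  "manifold n X \<longleftrightarrow> Hausdorff_space X \<and> second_countable X \<and>
     (\<forall>x \<in> topspace X. \<exists>U V. openin X U \<and> x \<in> U \<and> openin (Euclidean_half_space n) V \<and>
        subtopology X U homeomorphic_space subtopology (Euclidean_half_space n) V)"


section \<open>The fundamental group\<close>

definition loops :: "'a topology \<Rightarrow> 'a \<Rightarrow> (real \<Rightarrow> 'a) set" where
  "loops X x = {g. pathin X g \<and> g 0 = x \<and> g 1 = x}"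

definition loop_homotopy :: "'a topology \<Rightarrow> 'a \<Rightarrow> ((real \<Rightarrow> 'a) \<times> (real \<Rightarrow> 'a)) set" where
  "loop_homotopy X x = {(g, h). g \<in> loops X x \<and> h \<in> loops X x \<and>
     homotopic_with (\<lambda>k. k 0 = x \<and> k 1 = x) (top_of_set {0..1}) X g h}"

text \<open>The concatenation \<^const>\<open>joinpaths\<close> of the library is restricted to types in class
  \<^class>\<open>topological_space\<close>.\<close>

definition loop_concat :: "(real \<Rightarrow> 'a) \<Rightarrow> (real \<Rightarrow> 'a) \<Rightarrow> real \<Rightarrow> 'a" where
  "loop_concat g h = (\<lambda>t. if t \<le> 1/2 then g (2 * t) else h (2 * t - 1))"

definition fundamental_group :: "'a topology \<Rightarrow> 'a \<Rightarrow> (real \<Rightarrow> 'a) set monoid" where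
  "fundamental_group X x =
     \<lparr>carrier = loops X x // loop_homotopy X x,
      monoid.mult = (\<lambda>A B. \<Union>g\<in>A. \<Union>h\<in>B. loop_homotopy X x `` {loop_concat g h}),
      one = loop_homotopy X x `` {\<lambda>t. x}\<rparr>"


section \<open>Group theory\<close>

definition finitely_generated_group :: "('a, 'b) monoid_scheme \<Rightarrow> bool" where
  "finitely_generated_group G \<longleftrightarrow>
     (\<exists>S. finite S \<and> S \<subseteq> carrier G \<and> generate G S = carrier G)"

definition abelianization :: "('a, 'b) monoid_scheme \<Rightarrow> 'a set monoid" where
  "abelianization G = G Mod derived G (carrier G)"

text \<open>Elements of \<^const>\<open>hom\<close> are unconstrained outside the carrier of the source group, so
  only the extensional ones are counted.\<close>

definition num_hom :: "('a, 'b) monoid_scheme \<Rightarrow> ('c, 'd) monoid_scheme \<Rightarrow> nat" where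
  "num_hom G H = card (hom G H \<inter> extensional (carrier G))"

definition num_subgroups_with_H1 ::
    "('a, 'b) monoid_scheme \<Rightarrow> ('c, 'd) monoid_scheme \<Rightarrow> nat \<Rightarrow> nat" where
  "num_subgroups_with_H1 G H m =
     card {F. subgroup F G \<and> card (rcosets\<^bsub>G\<^esub> F) = m \<and>
              abelianization (G\<lparr>carrier := F\<rparr>) \<cong> H}"

text \<open>One representative of each isomorphism class of members of \<open>A\<close>.\<close>

definition iso_representatives :: "('a, 'b) monoid_scheme set \<Rightarrow> ('a, 'b) monoid_scheme set" where
  "iso_representatives A =
     (\<lambda>C. SOME G. G \<in> C) ` (A // {(G, H). G \<in> A \<and> H \<in> A \<and> G \<cong> H})"


section \<open>Coverings\<close>

text \<open>The analogue of \<^const>\<open>covering_space\<close> for abstract topologies; see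
  \<open>covering_map_top_of_set\<close> below.\<close>

definition covering_map :: "'b topology \<Rightarrow> 'a topology \<Rightarrow> ('b \<Rightarrow> 'a) \<Rightarrow> bool" where
  "covering_map X M p \<longleftrightarrow>
     continuous_map X M p \<and> p ` topspace X = topspace M \<and>
     (\<forall>y \<in> topspace M. \<exists>T. openin M T \<and> y \<in> T \<and>
        (\<exists>\<V>. \<Union>\<V> = {x \<in> topspace X. p x \<in> T} \<and> (\<forall>U \<in> \<V>. openin X U) \<and> pairwise disjnt \<V> \<and>
             (\<forall>U \<in> \<V>. homeomorphic_map (subtopology X U) (subtopology M T) p)))"

definition connected_covering :: "nat \<Rightarrow> 'a topology \<Rightarrow> 'b topology \<times> ('b \<Rightarrow> 'a) \<Rightarrow> bool" where
  "connected_covering n M = (\<lambda>(X, p). connected_space X \<and> covering_map X M p \<and>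
     (\<forall>y \<in> topspace M. finite {x \<in> topspace X. p x = y} \<and> card {x \<in> topspace X. p x = y} = n))"

definition equivalent_coverings ::
    "'b topology \<times> ('b \<Rightarrow> 'a) \<Rightarrow> 'c topology \<times> ('c \<Rightarrow> 'a) \<Rightarrow> bool" where
  "equivalent_coverings = (\<lambda>(X, p) (Y, q).
     \<exists>h. homeomorphic_map X Y h \<and> (\<forall>x \<in> topspace X. q (h x) = p x))"

text \<open>A total space with \<open>n\<close>-point fibres has the cardinality of \<open>topspace M \<times> {0..<n}\<close>, so up to
  equivalence every such covering has its total space in the type \<^typ>\<open>'a \<times> nat\<close>; see
  \<open>connected_covering_representable\<close> below.\<close>

definition connected_coverings ::
    "nat \<Rightarrow> 'a topology \<Rightarrow> (('a \<times> nat) topology \<times> ('a \<times> nat \<Rightarrow> 'a)) set" where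
  "connected_coverings n M = {c. connected_covering n M c}"

definition num_connected_coverings :: "nat \<Rightarrow> 'a topology \<Rightarrow> nat" where
  "num_connected_coverings n M =
     card (connected_coverings n M //
       {(c, c'). c \<in> connected_coverings n M \<and> c' \<in> connected_coverings n M \<and>
                 equivalent_coverings c c'})"

definition covering_homology_groups ::
    "nat \<Rightarrow> 'a topology \<Rightarrow> ('a \<times> nat) chain set monoid set" where
  "covering_homology_groups m M =
     iso_representatives ((\<lambda>(X, p). homology_group 1 X) ` connected_coverings m M)"

lemma covering_map_top_of_set:
  fixes C :: "'b::topological_space set" and S :: "'a::topological_space set"
  shows "covering_map (top_of_set C) (top_of_set S) p \<longleftrightarrow> covering_space C p S"
proof -
  have vim: "{x \<in> C. p x \<in> T} = C \<inter> p -` T" for T by auto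
  have hom: "homeomorphic_map (subtopology (top_of_set C) U) (subtopology (top_of_set S) T) p
      \<longleftrightarrow> (\<exists>q. homeomorphism U T p q)"
    if "U \<subseteq> C" "T \<subseteq> S" for U T
  proof -
    have "C \<inter> U = U" "S \<inter> T = T" using that by auto
    then show ?thesis
      by (simp add: subtopology_subtopology homeomorphic_map_maps homeomorphic_maps_iff_homeomorphism)
  qed
  have ev: "(\<forall>U\<in>\<V>. homeomorphic_map (subtopology (top_of_set C) U) (subtopology (top_of_set S) T) p)
      \<longleftrightarrow> (\<forall>U\<in>\<V>. \<exists>q. homeomorphism U T p q)"
    if "openin (top_of_set S) T" "\<forall>U\<in>\<V>. openin (top_of_set C) U" for \<V> T
    using that hom by (meson openin_imp_subset)
  have logic: "(\<exists>T. P T \<and> Q T \<and> A T) \<longleftrightarrow> (\<exists>T. Q T \<and> P T \<and> B T)"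
    if "\<And>T. P T \<Longrightarrow> A T \<longleftrightarrow> B T" for P Q A B :: "'a set \<Rightarrow> bool"
    using that by blast
  have nbhd: "(\<exists>\<V>. \<Union>\<V> = {x \<in> topspace (top_of_set C). p x \<in> T} \<and>
        (\<forall>U\<in>\<V>. openin (top_of_set C) U) \<and> pairwise disjnt \<V> \<and>
        (\<forall>U\<in>\<V>. homeomorphic_map (subtopology (top_of_set C) U) (subtopology (top_of_set S) T) p))
      \<longleftrightarrow> (\<exists>\<V>. \<Union>\<V> = C \<inter> p -` T \<and> (\<forall>U\<in>\<V>. openin (top_of_set C) U) \<and> pairwise disjnt \<V> \<and>
        (\<forall>U\<in>\<V>. \<exists>q. homeomorphism U T p q))"
    if "openin (top_of_set S) T" for T
  proof (rule iff_exI)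
    fix \<V>
    show "(\<Union>\<V> = {x \<in> topspace (top_of_set C). p x \<in> T} \<and>
        (\<forall>U\<in>\<V>. openin (top_of_set C) U) \<and> pairwise disjnt \<V> \<and>
        (\<forall>U\<in>\<V>. homeomorphic_map (subtopology (top_of_set C) U) (subtopology (top_of_set S) T) p))
      \<longleftrightarrow> (\<Union>\<V> = C \<inter> p -` T \<and> (\<forall>U\<in>\<V>. openin (top_of_set C) U) \<and> pairwise disjnt \<V> \<and>
        (\<forall>U\<in>\<V>. \<exists>q. homeomorphism U T p q))"
      unfolding topspace_euclidean_subtopology vim using ev[OF that] by (intro conj_cong refl)
  qed
  have cts: "continuous_map (top_of_set C) (top_of_set S) p \<and> p ` C = S \<longleftrightarrow> continuous_on C p \<and> p ` C = S"
    by auto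
  have loc: "(\<exists>T. openin (top_of_set S) T \<and> y \<in> T \<and>
        (\<exists>\<V>. \<Union>\<V> = {x \<in> topspace (top_of_set C). p x \<in> T} \<and>
        (\<forall>U\<in>\<V>. openin (top_of_set C) U) \<and> pairwise disjnt \<V> \<and>
        (\<forall>U\<in>\<V>. homeomorphic_map (subtopology (top_of_set C) U) (subtopology (top_of_set S) T) p)))
      \<longleftrightarrow> (\<exists>T. y \<in> T \<and> openin (top_of_set S) T \<and>
        (\<exists>\<V>. \<Union>\<V> = C \<inter> p -` T \<and> (\<forall>U\<in>\<V>. openin (top_of_set C) U) \<and> pairwise disjnt \<V> \<and>
        (\<forall>U\<in>\<V>. \<exists>q. homeomorphism U T p q)))" for y
    by (rule logic) (rule nbhd)
  show ?thesis
    unfolding covering_map_def covering_space_def loc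
    unfolding topspace_euclidean_subtopology conj_assoc[symmetric] cts by (rule refl)
qed

lemma covering_map_homeomorphic:
  assumes cov: "covering_map X M p" and h: "homeomorphic_maps X Y h k"
  shows "covering_map Y M (p \<circ> k)"
  unfolding covering_map_def
proof (intro conjI ballI)
  have ch: "continuous_map X Y h" and ck: "continuous_map Y X k"
    and kh: "\<And>x. x \<in> topspace X \<Longrightarrow> k (h x) = x" and hk: "\<And>y. y \<in> topspace Y \<Longrightarrow> h (k y) = y"
    using h by (auto simp: homeomorphic_maps_def)
  have hX: "h x \<in> topspace Y" if "x \<in> topspace X" for x
    using ch that by (auto simp: continuous_map_def)
  have kY: "k y \<in> topspace X" if "y \<in> topspace Y" for y
    using ck that by (auto simp: continuous_map_def)
  have kim: "k ` topspace Y = topspace X"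
    using hX kY kh by force
  have hm: "homeomorphic_map X Y h" 
    using h homeomorphic_maps_map by blast
  show "continuous_map Y M (p \<circ> k)"
    using ck cov continuous_map_compose covering_map_def by blast
  show "(p \<circ> k) ` topspace Y = topspace M"
    using cov kim by (metis covering_map_def image_comp)
  fix y assume "y \<in> topspace M"
  then obtain T \<V> where T: "openin M T" "y \<in> T"
    and V: "\<Union>\<V> = {x \<in> topspace X. p x \<in> T}" "\<forall>U \<in> \<V>. openin X U" "pairwise disjnt \<V>"
      "\<forall>U \<in> \<V>. homeomorphic_map (subtopology X U) (subtopology M T) p"
    using cov unfolding covering_map_def by meson
  have sub: "U \<subseteq> topspace X" if "U \<in> \<V>" for U
    using V(2) that openin_subset by blast
  have Vp: "\<Union>((`) h ` \<V>) = {x \<in> topspace Y. (p \<circ> k) x \<in> T}"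
  proof -
    have "\<Union>((`) h ` \<V>) = h ` \<Union>\<V>" by auto
    also have "\<dots> = {x \<in> topspace Y. (p \<circ> k) x \<in> T}"
      unfolding V(1) using hX kY kh hk by force
    finally show ?thesis .
  qed
  have Vo: "\<forall>U \<in> (`) h ` \<V>. openin Y U"
  proof
    fix A assume "A \<in> (`) h ` \<V>"
    then obtain U where "U \<in> \<V>" "A = h ` U" by auto
    then show "openin Y A"
      using V(2) sub homeomorphic_map_openness[OF hm, of U] by simp
  qed
  have Vd: "pairwise disjnt ((`) h ` \<V>)"
    unfolding pairwise_def
  proof (intro ballI impI)
    fix A B assume "A \<in> (`) h ` \<V>" "B \<in> (`) h ` \<V>" "A \<noteq> B"
    then obtain U W where UW: "U \<in> \<V>" "W \<in> \<V>" "U \<noteq> W" "A = h ` U" "B = h ` W" by auto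
    then have "disjnt U W" using V(3) by (auto simp: pairwise_def)
    moreover have "inj_on h (topspace X)" using kh by (metis inj_onI)
    ultimately show "disjnt A B"
      using UW sub[of U] sub[of W] unfolding disjnt_def inj_on_def by blast
  qed
  have Vh: "\<forall>U \<in> (`) h ` \<V>. homeomorphic_map (subtopology Y U) (subtopology M T) (p \<circ> k)"
  proof
    fix A assume "A \<in> (`) h ` \<V>"
    then obtain U where U: "U \<in> \<V>" "A = h ` U" by auto
    have "homeomorphic_map Y X k"
      using h homeomorphic_maps_map by blast
    moreover have "k ` (topspace Y \<inter> A) = topspace X \<inter> U"
    proof -
      have "topspace Y \<inter> A = h ` U" using U sub[OF U(1)] hX by auto
      moreover have "k ` h ` U = U" using sub[OF U(1)] kh by (simp add: image_image subset_iff)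
      ultimately show ?thesis using sub[OF U(1)] by auto
    qed
    ultimately have "homeomorphic_map (subtopology Y A) (subtopology X U) k"
      by (rule homeomorphic_map_subtopologies)
    then show "homeomorphic_map (subtopology Y A) (subtopology M T) (p \<circ> k)"
      using V(4) U(1) homeomorphic_map_compose by blast
  qed
  show "\<exists>T. openin M T \<and> y \<in> T \<and>
        (\<exists>\<V>. \<Union>\<V> = {x \<in> topspace Y. (p \<circ> k) x \<in> T} \<and> (\<forall>U \<in> \<V>. openin Y U) \<and> pairwise disjnt \<V> \<and>
             (\<forall>U \<in> \<V>. homeomorphic_map (subtopology Y U) (subtopology M T) (p \<circ> k)))"
    using T Vp Vo Vd Vh by blast
qed

lemma connected_covering_representable:
  fixes c :: "'b topology \<times> ('b \<Rightarrow> 'a)"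
  assumes c: "connected_covering n M c"
  shows "\<exists>c' \<in> connected_coverings n M. equivalent_coverings c c'"
proof -
  obtain X p where Xp: "c = (X, p)" by (cases c)
  have con: "connected_space X" and cov: "covering_map X M p"
    and fib: "\<And>y. y \<in> topspace M \<Longrightarrow>
       finite {x \<in> topspace X. p x = y} \<and> card {x \<in> topspace X. p x = y} = n"
    using c by (auto simp: connected_covering_def Xp)
  have pX: "p x \<in> topspace M" if "x \<in> topspace X" for x
    using cov that by (auto simp: covering_map_def)
  have "\<forall>y\<in>topspace M. \<exists>e::'b \<Rightarrow> nat. inj_on e {x \<in> topspace X. p x = y}"
    using fib by (meson finite_imp_inj_to_nat_seg)
  then obtain e :: "'a \<Rightarrow> 'b \<Rightarrow> nat"
    where e: "\<And>y. y \<in> topspace M \<Longrightarrow> inj_on (e y) {x \<in> topspace X. p x = y}"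
    by metis
  define h where "h = (\<lambda>x. (p x, e (p x) x))"
  define k where "k = inv_into (topspace X) h"
  have inj: "inj_on h (topspace X)"
  proof (rule inj_onI)
    fix x x' assume xx': "x \<in> topspace X" "x' \<in> topspace X" "h x = h x'"
    then have "p x' = p x" "e (p x) x = e (p x) x'" by (auto simp: h_def)
    with e[OF pX[OF xx'(1)]] xx' show "x = x'" by (auto dest: inj_onD)
  qed
  define Y where "Y = pullback_topology (h ` topspace X) k X"
  have kh: "k (h x) = x" if "x \<in> topspace X" for x
    using that inj by (simp add: k_def)
  have tY: "topspace Y = h ` topspace X"
    using kh by (auto simp: Y_def topspace_pullback_topology)
  have oY: "openin Y S \<longleftrightarrow> (\<exists>U. openin X U \<and> S = k -` U \<inter> h ` topspace X)" for S
    by (simp add: Y_def openin_pullback_topology)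
  have hm: "homeomorphic_maps X Y h k"
    unfolding homeomorphic_maps_def
  proof (intro conjI ballI)
    show "continuous_map X Y h"
      unfolding continuous_map_def
    proof (intro conjI allI impI)
      show "h \<in> topspace X \<rightarrow> topspace Y" using tY by auto
      fix S assume "openin Y S"
      then obtain U where U: "openin X U" "S = k -` U \<inter> h ` topspace X" using oY by auto
      have "{x \<in> topspace X. h x \<in> S} = U"
        using openin_subset[OF U(1)] kh unfolding U(2)
        by (smt (verit) Collect_cong Collect_mem_eq IntE IntI imageI subsetD vimage_eq)
      then show "openin X {x \<in> topspace X. h x \<in> S}" using U by simp
    qed
    show "continuous_map Y X k"
      unfolding continuous_map_def
    proof (intro conjI allI impI)
      show "k \<in> topspace Y \<rightarrow> topspace X" using tY kh by auto
      fix U assume "openin X U"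
      moreover have "{y \<in> topspace Y. k y \<in> U} = k -` U \<inter> h ` topspace X" using tY by auto
      ultimately show "openin Y {y \<in> topspace Y. k y \<in> U}" using oY by auto
    qed
  qed (use kh tY in auto)
  have "connected_space Y"
    using con hm homeomorphic_connected_space homeomorphic_space_def by blast
  moreover have "covering_map Y M (p \<circ> k)"
    using covering_map_homeomorphic[OF cov hm] .
  moreover have "finite {x \<in> topspace Y. (p \<circ> k) x = y} \<and> card {x \<in> topspace Y. (p \<circ> k) x = y} = n"
    if "y \<in> topspace M" for y
  proof -
    have "{x \<in> topspace Y. (p \<circ> k) x = y} = h ` {x \<in> topspace X. p x = y}"
      using tY kh by auto
    moreover have "inj_on h {x \<in> topspace X. p x = y}"
      using inj by (rule inj_on_subset) auto
    ultimately show ?thesis using fib[OF that] by (simp add: card_image)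
  qed
  ultimately have "(Y, p \<circ> k) \<in> connected_coverings n M"
    by (simp add: connected_coverings_def connected_covering_def)
  moreover have "equivalent_coverings c (Y, p \<circ> k)"
  proof -
    have "homeomorphic_map X Y h" using hm homeomorphic_maps_map by blast
    then show ?thesis by (auto simp: equivalent_coverings_def Xp kh intro!: exI[of _ h])
  qed
  ultimately show ?thesis by blast
qed


section \<open>The Moebius function\<close>

definition moebius_function :: "nat \<Rightarrow> int" where
  "moebius_function n = (if squarefree n then (-1) ^ card (prime_factors n) else 0)"

end

(* Monodromy identifies the equivalence classes of connected n-fold coverings of M with the
   conjugacy classes of subgroups of index n in the fundamental group G: a covering is determined
   by the stabilizer of a point under lifting of loops, and every subgroup F is such a stabilizer
   for the covering with total space M x (cosets of F), whose sheets are the traces of short paths. The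
   covering belonging to F has fundamental group F, hence first homology the abelianization of F
   (Hurewicz).

   The conjugacy class of K has n / [N(K) : K] elements, where N(K) is the normalizer of K, so n
   times the number of classes is the number of pairs (K, C) of a subgroup K of index n and a coset
   C of K in N(K). Sending an epimorphism f from a subgroup F of index m onto the cyclic group of
   order l to the pair (ker f, f^-1(1)) is a bijection onto these pairs, over all l and m with
   l * m = n. Epimorphisms are counted by homomorphisms through Moebius inversion, and
   homomorphisms to cyclic groups factor through the abelianization. *)
theory Submission
  imports Defs
begin

section \<open>Homotopy of paths\<close>

text \<open>Lifting a concatenation means lifting the second path from the end of the lift of the
  first, so the loops act on a fibre from the right; hence right actions and right cosets
  throughout. A frame of paths from the base point to all points assigns an element of the
  fundamental group to every path, closed or not. It serves twice: these elements move the sheets of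
  the covering belonging to F, and in the Hurewicz theorem they turn every 1-simplex into an element
  of the abelianized group, so that a homomorphism on chains arises which kills boundaries.

  Manifolds enter through one local property: a base of path-connected open sets in which paths with
  common ends are homotopic. Convex pieces of charts, also at the boundary, provide it.

  The pair (ker f, f^-1(1)) determines f because F is generated by the kernel and any element of
  f^-1(1), and l is the order of that element modulo the kernel; for a given pair this order is
  finite since K has finite index. Finite generation makes the subgroups of each index finite in
  number, and through the bijection also the epimorphisms.\<close>

definition rev_path :: "(real \<Rightarrow> 'a) \<Rightarrow> real \<Rightarrow> 'a" where
  "rev_path g = (\<lambda>t. g (1 - t))"

notation loop_concat (infixr "\<bowtie>" 70)

definition path_homotopic :: "'a topology \<Rightarrow> (real \<Rightarrow> 'a) \<Rightarrow> (real \<Rightarrow> 'a) \<Rightarrow> bool" where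
  "path_homotopic X g h \<longleftrightarrow>
     homotopic_with (\<lambda>k. k 0 = g 0 \<and> k 1 = g 1) (top_of_set {0..1}) X g h"

lemma path_homotopic_iff:
  "path_homotopic X g h \<longleftrightarrow>
     (\<exists>H. continuous_map (top_of_set ({0..1} \<times> {0..1} :: (real \<times> real) set)) X H \<and>
          (\<forall>t\<in>{0..1}. H (0, t) = g t) \<and> (\<forall>t\<in>{0..1}. H (1, t) = h t) \<and>
          (\<forall>s\<in>{0..1}. H (s, 0) = g 0) \<and> (\<forall>s\<in>{0..1}. H (s, 1) = g 1))"
  unfolding path_homotopic_def
  by (subst homotopic_with) (auto simp: Ball_def)

lemma path_homotopicI:
  assumes "continuous_map (top_of_set ({0..1} \<times> {0..1} :: (real \<times> real) set)) X H"
    and "\<And>t. t \<in> {0..1} \<Longrightarrow> H (0, t) = g t" and "\<And>t. t \<in> {0..1} \<Longrightarrow> H (1, t) = h t"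
    and "\<And>s. s \<in> {0..1} \<Longrightarrow> H (s, 0) = g 0" and "\<And>s. s \<in> {0..1} \<Longrightarrow> H (s, 1) = g 1"
  shows "path_homotopic X g h"
  unfolding path_homotopic_iff using assms by (intro exI[of _ H]) auto

lemma path_homotopic_ends:
  assumes "path_homotopic X g h" shows "h 0 = g 0" "h 1 = g 1"
  using homotopic_with_imp_property[OF assms[unfolded path_homotopic_def]] by auto

lemma path_homotopic_pathin:
  assumes "path_homotopic X g h" shows "pathin X g" "pathin X h"
  using homotopic_with_imp_continuous_maps[OF assms[unfolded path_homotopic_def]]
  by (auto simp: pathin_def)

lemma path_homotopic_refl: "pathin X g \<Longrightarrow> path_homotopic X g g"
  by (simp add: path_homotopic_def pathin_def)

lemma path_homotopic_sym: "path_homotopic X g h \<Longrightarrow> path_homotopic X h g"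
  using path_homotopic_ends[of X g h] unfolding path_homotopic_def
  by (auto dest: homotopic_with_symD)

lemma path_homotopic_trans [trans]:
  "path_homotopic X g h \<Longrightarrow> path_homotopic X h k \<Longrightarrow> path_homotopic X g k"
  using path_homotopic_ends[of X g h] unfolding path_homotopic_def
  by (auto intro: homotopic_with_trans)

lemma path_homotopic_cong:
  assumes "pathin X g" and "\<And>t. t \<in> {0..1} \<Longrightarrow> g t = h t"
  shows "path_homotopic X g h"
  unfolding path_homotopic_def
  by (rule homotopic_with_equal) (use assms in \<open>auto simp: pathin_def\<close>)

lemma path_homotopic_image:
  assumes "path_homotopic X g h" and "continuous_map X Y f"
  shows "path_homotopic Y (f \<circ> g) (f \<circ> h)"
  using assms unfolding path_homotopic_def
  by (auto intro: homotopic_with_compose_continuous_map_left)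

lemma image_loop_concat: "f \<circ> (g \<bowtie> h) = (f \<circ> g) \<bowtie> (f \<circ> h)"
  by (auto simp: loop_concat_def)

lemma loop_concat_ends [simp]: "(g \<bowtie> h) 0 = g 0" "(g \<bowtie> h) 1 = h 1"
  by (auto simp: loop_concat_def)

lemma rev_path_ends [simp]: "rev_path g 0 = g 1" "rev_path g 1 = g 0"
  by (auto simp: rev_path_def)

lemma rev_path_rev_path [simp]: "rev_path (rev_path g) = g"
  by (auto simp: rev_path_def)

lemma path_homotopic_concat:
  assumes g: "path_homotopic X g g'" and h: "path_homotopic X h h'" and gh: "g 1 = h 0"
  shows "path_homotopic X (g \<bowtie> h) (g' \<bowtie> h')"
proof -
  obtain G where G: "continuous_map (top_of_set ({0..1} \<times> {0..1} :: (real \<times> real) set)) X G"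
    "\<forall>t\<in>{0..1}. G (0, t) = g t" "\<forall>t\<in>{0..1}. G (1, t) = g' t"
    "\<forall>t\<in>{0..1}. G (t, 0) = g 0" "\<forall>t\<in>{0..1}. G (t, 1) = g 1"
    using g unfolding path_homotopic_iff by blast
  obtain H where H: "continuous_map (top_of_set ({0..1} \<times> {0..1} :: (real \<times> real) set)) X H"
    "\<forall>t\<in>{0..1}. H (0, t) = h t" "\<forall>t\<in>{0..1}. H (1, t) = h' t"
    "\<forall>t\<in>{0..1}. H (t, 0) = h 0" "\<forall>t\<in>{0..1}. H (t, 1) = h 1"
    using h unfolding path_homotopic_iff by blast
  let ?Q = "{0..1} \<times> {0..1} :: (real \<times> real) set"
  \<comment> \<open>The first coordinate of the square is the homotopy parameter, the second the
    path parameter. The homotopies are pasted along the line \<open>snd z = 1/2\<close>, where both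
    are constant because they fix the end \<open>g 1 = h 0\<close>.\<close>
  define K where "K = (\<lambda>z. if snd z \<le> (1/2::real) then (G \<circ> (\<lambda>z. (fst z, 2 * snd z))) z
                          else (H \<circ> (\<lambda>z. (fst z, 2 * snd z - 1))) z)"
  have "continuous_map (top_of_set ?Q) X K"
    unfolding K_def
  proof (rule continuous_map_cases_le)
    show "continuous_map (subtopology (top_of_set ?Q) {z \<in> topspace (top_of_set ?Q). snd z \<le> 1/2}) X
            (G \<circ> (\<lambda>z. (fst z, 2 * snd z)))"
      by (rule continuous_map_compose[OF _ G(1)])
        (auto simp: subtopology_subtopology intro!: continuous_intros)
    show "continuous_map (subtopology (top_of_set ?Q) {z \<in> topspace (top_of_set ?Q). 1/2 \<le> snd z}) X
            (H \<circ> (\<lambda>z. (fst z, 2 * snd z - 1)))"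
      by (rule continuous_map_compose[OF _ H(1)])
        (auto simp: subtopology_subtopology intro!: continuous_intros)
    show "(G \<circ> (\<lambda>z. (fst z, 2 * snd z))) z = (H \<circ> (\<lambda>z. (fst z, 2 * snd z - 1))) z"
      if "z \<in> topspace (top_of_set ?Q)" "snd z = 1/2" for z
    proof -
      have "z = (fst z, 1/2)" using that(2) by (simp add: prod_eq_iff)
      moreover have "fst z \<in> {0..1}" using that(1) by auto
      ultimately obtain a where "z = (a, 1/2)" "a \<in> {0..1}" by blast
      then show ?thesis using G(5) H(4) gh by simp
    qed
  qed (auto intro!: continuous_intros)
  then show ?thesis
  proof (rule path_homotopicI)
  qed (use G H gh in \<open>auto simp: K_def loop_concat_def\<close>)
qed

lemma pathin_loop_concat:
  "pathin X g \<Longrightarrow> pathin X h \<Longrightarrow> g 1 = h 0 \<Longrightarrow> pathin X (g \<bowtie> h)"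
  using path_homotopic_concat path_homotopic_refl path_homotopic_pathin by metis

lemma pathin_reparametrize:
  assumes "pathin X G" "continuous_on {0..1} \<alpha>" "\<alpha> ` {0..1} \<subseteq> {0..1}"
  shows "pathin X (G \<circ> \<alpha>)"
  using assms unfolding pathin_def
  by (intro continuous_map_compose[where X'="top_of_set {0..1}"]) auto

lemma pathin_rev_path:
  assumes "pathin X g" shows "pathin X (rev_path g)"
proof -
  have "pathin X (g \<circ> (\<lambda>t. 1 - t))"
    by (intro pathin_reparametrize assms continuous_intros) auto
  then show ?thesis by (simp add: rev_path_def comp_def)
qed

text \<open>Unlike the usual notion of simple connectedness this includes neither path connectedness
  nor nonemptiness.\<close>

definition paths_homotopic :: "'a topology \<Rightarrow> bool" where
  "paths_homotopic T \<longleftrightarrow>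
     (\<forall>g h. pathin T g \<and> pathin T h \<and> g 0 = h 0 \<and> g 1 = h 1 \<longrightarrow> path_homotopic T g h)"

text \<open>The source of the explicit homotopies: two paths are compared in a simple parameter
  space \<open>T\<close>, such as the unit interval or a simplex, and the comparison is pushed
  forward by \<open>G\<close>.\<close>

lemma paths_homotopic_image:
  assumes "paths_homotopic T" "continuous_map T X G" "pathin T \<alpha>" "pathin T \<beta>"
    "\<alpha> 0 = \<beta> 0" "\<alpha> 1 = \<beta> 1"
  shows "path_homotopic X (G \<circ> \<alpha>) (G \<circ> \<beta>)"
  using assms path_homotopic_image paths_homotopic_def by metis

lemma paths_homotopic_homeomorphic:
  assumes "paths_homotopic T" "homeomorphic_maps X T f g"
  shows "paths_homotopic X"
  unfolding paths_homotopic_def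
proof clarify
  fix a b assume ab: "pathin X a" "pathin X b" "a 0 = b 0" "a 1 = b 1"
  have c: "continuous_map X T f" "continuous_map T X g" "\<And>x. x \<in> topspace X \<Longrightarrow> g (f x) = x"
    using assms(2) by (auto simp: homeomorphic_maps_def)
  have "path_homotopic X (g \<circ> (f \<circ> a)) (g \<circ> (f \<circ> b))"
    by (rule paths_homotopic_image[OF assms(1) c(2)])
      (use ab c(1) in \<open>auto intro: pathin_compose\<close>)
  moreover have "path_homotopic X c' (g \<circ> (f \<circ> c'))" if "pathin X c'" for c'
    using path_image_subset_topspace[OF that] c(3)
    by (intro path_homotopic_cong[OF that]) (auto simp: Pi_iff)
  ultimately show "path_homotopic X a b"
    using ab(1,2) path_homotopic_trans path_homotopic_sym by metis
qed

lemma paths_homotopic_convex: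
  fixes S :: "'b::real_normed_vector set"
  assumes "convex S" shows "paths_homotopic (top_of_set S)"
  unfolding paths_homotopic_def
proof clarify
  fix g h assume gh: "pathin (top_of_set S) g" "pathin (top_of_set S) h" "g 0 = h 0" "g 1 = h 1"
  let ?H = "\<lambda>z. (1 - fst z) *\<^sub>R g (snd z) + fst z *\<^sub>R h (snd z)"
  have c: "continuous_on {0..1} g" "continuous_on {0..1} h" "g ` {0..1} \<subseteq> S" "h ` {0..1} \<subseteq> S"
    using gh by (auto simp: pathin_def)
  have "continuous_on ({0..1} \<times> {0..1}) ?H"
    by (intro continuous_intros continuous_on_compose2[OF c(1)] continuous_on_compose2[OF c(2)]) auto
  moreover have "?H ` ({0..1} \<times> {0..1}) \<subseteq> S"
    using assms c(3,4) by (auto intro!: convexD)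
  ultimately show "path_homotopic (top_of_set S) g h"
    by (intro path_homotopicI[where H="?H"]) (use gh(3,4) in \<open>auto simp flip: scaleR_add_left\<close>)
qed

lemma continuous_map_powertop_real_affine:
  assumes "continuous_map X (powertop_real UNIV) f" "continuous_map X (powertop_real UNIV) g"
    "continuous_map X euclideanreal r"
  shows "continuous_map X (powertop_real UNIV) (\<lambda>x i. (1 - r x) * f x i + r x * g x i)"
  using assms unfolding continuous_map_componentwise_UNIV
  by (intro allI continuous_map_add continuous_map_real_mult continuous_map_diff) auto

text \<open>The straight-line homotopy again. The product topology on real sequences does not come
  from a norm, so convexity and continuity are expressed coordinatewise; this version covers charts
  of manifolds and standard simplices.\<close>

lemma paths_homotopic_convex_powertop:
  assumes conv: "\<And>x y u. x \<in> S \<Longrightarrow> y \<in> S \<Longrightarrow> 0 \<le> u \<Longrightarrow> u \<le> 1 \<Longrightarrow>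
      (\<lambda>i. (1 - u) * x i + u * y i) \<in> S"
  shows "paths_homotopic (subtopology (powertop_real UNIV) S)"
  unfolding paths_homotopic_def
proof clarify
  let ?T = "subtopology (powertop_real UNIV) S"
  fix g h assume gh: "pathin ?T g" "pathin ?T h" "g 0 = h 0" "g 1 = h 1"
  let ?H = "\<lambda>z i. (1 - fst z) * g (snd z) i + fst z * h (snd z) i"
  let ?Q = "{0..1} \<times> {0..1} :: (real \<times> real) set"
  have c: "continuous_map (top_of_set {0..1}) (powertop_real UNIV) g"
    "continuous_map (top_of_set {0..1}) (powertop_real UNIV) h" "g ` {0..1} \<subseteq> S" "h ` {0..1} \<subseteq> S"
    using gh by (auto simp: pathin_def continuous_map_in_subtopology)
  have snd: "continuous_map (top_of_set ?Q) (top_of_set {0..1}) snd"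
    by (auto intro!: continuous_intros)
  have "continuous_map (top_of_set ?Q) (powertop_real UNIV) ?H"
    by (rule continuous_map_powertop_real_affine)
      (use continuous_map_compose[OF snd c(1)] continuous_map_compose[OF snd c(2)] in
        \<open>auto simp: comp_def intro!: continuous_intros\<close>)
  moreover have "?H ` ?Q \<subseteq> S"
    using c(3,4) by (auto intro!: conv)
  ultimately have "continuous_map (top_of_set ?Q) ?T ?H"
    by (auto simp: continuous_map_in_subtopology)
  then show "path_homotopic ?T g h"
    by (rule path_homotopicI) (use gh(3,4) in \<open>auto simp flip: distrib_right\<close>)
qed

text \<open>The reparametrizations \<open>\<alpha>\<close> and \<open>\<beta>\<close> are paths in
  the unit interval with common ends, hence homotopic there. The basic laws for concatenation come
  down to writing both sides as reparametrizations of one path.\<close>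

lemma path_homotopic_reparametrize:
  assumes "pathin X G" "continuous_on {0..1} \<alpha>" "\<alpha> ` {0..1} \<subseteq> {0..1}"
    "continuous_on {0..1} \<beta>" "\<beta> ` {0..1} \<subseteq> {0..1}" "\<alpha> 0 = \<beta> 0" "\<alpha> 1 = \<beta> 1"
  shows "path_homotopic X (G \<circ> \<alpha>) (G \<circ> \<beta>)"
  by (rule paths_homotopic_image[where T="top_of_set {0..1}"])
    (use assms in \<open>auto simp: pathin_def intro: paths_homotopic_convex\<close>)

section \<open>Associativity, units and inverses up to homotopy\<close>

lemma path_homotopic_concat_assoc:
  assumes "pathin X g" "pathin X h" "pathin X k" "g 1 = h 0" "h 1 = k 0"
  shows "path_homotopic X ((g \<bowtie> h) \<bowtie> k) (g \<bowtie> (h \<bowtie> k))"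
proof -
  let ?G = "g \<bowtie> (h \<bowtie> k)"
  \<comment> \<open>Piecewise linear with slopes 2, 1 and 1/2, sending the breakpoints 1/4 and 1/2
    of the left-bracketed concatenation to the breakpoints 1/2 and 3/4 of the right-bracketed one.
    The slopes decrease, so it is the minimum of the three lines.\<close>
  define \<alpha> where "\<alpha> t = min (2 * t) (min (t + 1/4) (t/2 + 1/2))" for t :: real
  have "path_homotopic X (?G \<circ> \<alpha>) (?G \<circ> (\<lambda>t. t))"
    by (rule path_homotopic_reparametrize)
      (use assms in \<open>auto simp: \<alpha>_def intro!: pathin_loop_concat continuous_intros\<close>)
  moreover have "?G \<circ> \<alpha> = (g \<bowtie> h) \<bowtie> k"
  proof
    fix t :: real
    consider "t \<le> 1/4" | "1/4 < t" "t \<le> 1/2" | "1/2 < t" by linarith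
    then show "(?G \<circ> \<alpha>) t = ((g \<bowtie> h) \<bowtie> k) t"
      by cases (auto simp: \<alpha>_def loop_concat_def min_def algebra_simps)
  qed
  ultimately show ?thesis by (simp add: comp_def)
qed

lemma path_homotopic_concat_const_left:
  assumes "pathin X g" "g 0 = x"
  shows "path_homotopic X ((\<lambda>t. x) \<bowtie> g) g"
proof -
  have "path_homotopic X (g \<circ> (\<lambda>t. max 0 (2 * t - 1))) (g \<circ> (\<lambda>t. t))"
    by (rule path_homotopic_reparametrize) (use assms in \<open>auto intro!: continuous_intros\<close>)
  moreover have "g \<circ> (\<lambda>t. max 0 (2 * t - 1)) = (\<lambda>t. x) \<bowtie> g"
  proof
    fix t :: real
    show "(g \<circ> (\<lambda>t. max 0 (2 * t - 1))) t = ((\<lambda>t. x) \<bowtie> g) t"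
    proof (cases "t \<le> 1/2")
      case True
      then have "max 0 (2 * t - 1) = 0" by simp
      then show ?thesis using True assms by (simp add: loop_concat_def)
    qed (auto simp: loop_concat_def)
  qed
  ultimately show ?thesis by (simp add: comp_def)
qed

lemma path_homotopic_concat_const_right:
  assumes "pathin X g" "g 1 = x"
  shows "path_homotopic X (g \<bowtie> (\<lambda>t. x)) g"
proof -
  have "path_homotopic X (g \<circ> (\<lambda>t. min (2 * t) 1)) (g \<circ> (\<lambda>t. t))"
    by (rule path_homotopic_reparametrize) (use assms in \<open>auto intro!: continuous_intros\<close>)
  moreover have "g \<circ> (\<lambda>t. min (2 * t) 1) = g \<bowtie> (\<lambda>t. x)"
    using assms by (auto simp: loop_concat_def min_def fun_eq_iff)
  ultimately show ?thesis by (simp add: comp_def)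
qed

lemma path_homotopic_concat_rev:
  assumes "pathin X g" "g 0 = x"
  shows "path_homotopic X (g \<bowtie> rev_path g) (\<lambda>t. x)"
proof -
  \<comment> \<open>The tent map runs through the interval and back; with both ends at 0 it is
    homotopic to the constant 0 inside the interval.\<close>
  have "path_homotopic X (g \<circ> (\<lambda>t. min (2 * t) (2 - 2 * t))) (g \<circ> (\<lambda>t. 0))"
    by (rule path_homotopic_reparametrize) (use assms in \<open>auto intro!: continuous_intros\<close>)
  moreover have "g \<circ> (\<lambda>t. min (2 * t) (2 - 2 * t)) = g \<bowtie> rev_path g"
    using assms by (auto simp: loop_concat_def min_def fun_eq_iff rev_path_def algebra_simps)
  ultimately show ?thesis using assms by (simp add: comp_def)
qed

lemma path_homotopic_rev_concat:
  assumes "pathin X g" "g 1 = x"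
  shows "path_homotopic X (rev_path g \<bowtie> g) (\<lambda>t. x)"
  using path_homotopic_concat_rev[of X "rev_path g" x] assms pathin_rev_path by auto

lemma path_homotopic_cancel_rev:
  assumes "pathin X g" "pathin X k" "g 1 = k 0"
  shows "path_homotopic X (rev_path g \<bowtie> (g \<bowtie> k)) k"
proof -
  have "path_homotopic X (rev_path g \<bowtie> (g \<bowtie> k)) ((rev_path g \<bowtie> g) \<bowtie> k)"
    using assms by (intro path_homotopic_sym[OF path_homotopic_concat_assoc] pathin_rev_path) auto
  also have "path_homotopic X \<dots> ((\<lambda>t. k 0) \<bowtie> k)"
    using assms by (intro path_homotopic_concat path_homotopic_rev_concat path_homotopic_refl) auto
  also have "path_homotopic X \<dots> k"
    using assms by (intro path_homotopic_concat_const_left) auto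
  finally show ?thesis .
qed

section \<open>The fundamental group\<close>

abbreviation loop_class :: "'a topology \<Rightarrow> 'a \<Rightarrow> (real \<Rightarrow> 'a) \<Rightarrow> (real \<Rightarrow> 'a) set" where
  "loop_class X x g \<equiv> loop_homotopy X x `` {g}"

lemma loop_homotopy_iff: "(g, h) \<in> loop_homotopy X x \<longleftrightarrow> g \<in> loops X x \<and> path_homotopic X g h"
  using path_homotopic_ends[of X g h] path_homotopic_pathin[of X g h]
  by (auto simp: loop_homotopy_def loops_def path_homotopic_def)

lemma equiv_loop_homotopy: "equiv (loops X x) (loop_homotopy X x)"
proof (rule equivI)
  show "loop_homotopy X x \<subseteq> loops X x \<times> loops X x"
    by (auto simp: loop_homotopy_def)
  show "refl_on (loops X x) (loop_homotopy X x)"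
    by (auto simp: refl_on_def loop_homotopy_iff loops_def intro: path_homotopic_refl)
  show "sym (loop_homotopy X x)"
    by (auto simp: sym_def loop_homotopy_iff loops_def path_homotopic_sym path_homotopic_pathin
        dest: path_homotopic_ends)
  show "trans (loop_homotopy X x)"
    using path_homotopic_trans[of X]
    by (auto simp: trans_def loop_homotopy_iff)
qed

lemma loops_concat: "g \<in> loops X x \<Longrightarrow> h \<in> loops X x \<Longrightarrow> g \<bowtie> h \<in> loops X x"
  by (auto simp: loops_def intro: pathin_loop_concat)

lemma loops_rev: "g \<in> loops X x \<Longrightarrow> rev_path g \<in> loops X x"
  by (auto simp: loops_def intro: pathin_rev_path)

lemma loops_const: "x \<in> topspace X \<Longrightarrow> (\<lambda>t. x) \<in> loops X x"
  by (auto simp: loops_def)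

lemma loop_class_eq_iff:
  "g \<in> loops X x \<Longrightarrow> h \<in> loops X x \<Longrightarrow> loop_class X x g = loop_class X x h \<longleftrightarrow> path_homotopic X g h"
  using eq_equiv_class_iff[OF equiv_loop_homotopy, of g X x h] by (auto simp: loop_homotopy_iff)

lemma in_loop_class_iff:
  "g \<in> loops X x \<Longrightarrow> h \<in> loop_class X x g \<longleftrightarrow> path_homotopic X g h"
  by (auto simp: loop_homotopy_iff)

lemma carrier_fundamental_group:
  "carrier (fundamental_group X x) = loop_class X x ` loops X x"
  by (auto simp: fundamental_group_def quotient_def)

lemma loop_class_in_carrier [simp]:
  "g \<in> loops X x \<Longrightarrow> loop_class X x g \<in> carrier (fundamental_group X x)"
  by (auto simp: carrier_fundamental_group)

lemma mult_loop_class: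
  assumes "g \<in> loops X x" "h \<in> loops X x"
  shows "loop_class X x g \<otimes>\<^bsub>fundamental_group X x\<^esub> loop_class X x h = loop_class X x (g \<bowtie> h)"
proof -
  have "loop_class X x (g' \<bowtie> h') = loop_class X x (g \<bowtie> h)"
    if "g' \<in> loop_class X x g" "h' \<in> loop_class X x h" for g' h'
  proof -
    have *: "path_homotopic X g g'" "path_homotopic X h h'" "g' \<in> loops X x" "h' \<in> loops X x"
      using that assms by (auto simp: loop_homotopy_def path_homotopic_def loops_def)
    then have "path_homotopic X (g \<bowtie> h) (g' \<bowtie> h')"
      using assms by (intro path_homotopic_concat) (auto simp: loops_def)
    then show ?thesis
      using * assms by (metis loop_class_eq_iff loops_concat)
  qed
  moreover have "g \<in> loop_class X x g" "h \<in> loop_class X x h"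
    using assms by (auto simp: loop_homotopy_iff loops_def intro: path_homotopic_refl)
  ultimately have "(\<Union>g'\<in>loop_class X x g. \<Union>h'\<in>loop_class X x h. loop_class X x (g' \<bowtie> h')) =
      loop_class X x (g \<bowtie> h)"
    by blast
  then show ?thesis by (simp add: fundamental_group_def)
qed

lemma one_fundamental_group: "\<one>\<^bsub>fundamental_group X x\<^esub> = loop_class X x (\<lambda>t. x)"
  by (simp add: fundamental_group_def)

lemma group_fundamental_group:
  assumes "x \<in> topspace X" shows "group (fundamental_group X x)"
proof (rule groupI)
  let ?G = "fundamental_group X x"
  note c = carrier_fundamental_group
  show "\<one>\<^bsub>?G\<^esub> \<in> carrier ?G"
    unfolding one_fundamental_group using assms by (intro loop_class_in_carrier loops_const)
  fix A assume "A \<in> carrier ?G"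
  then obtain a where a: "a \<in> loops X x" "A = loop_class X x a" by (auto simp: c)
  show "\<one>\<^bsub>?G\<^esub> \<otimes>\<^bsub>?G\<^esub> A = A"
    using a assms by (simp add: one_fundamental_group mult_loop_class loops_const loop_class_eq_iff loops_concat)
      (auto intro!: path_homotopic_concat_const_left simp: loops_def)
  show "\<exists>B\<in>carrier ?G. B \<otimes>\<^bsub>?G\<^esub> A = \<one>\<^bsub>?G\<^esub>"
  proof (rule bexI)
    show "loop_class X x (rev_path a) \<otimes>\<^bsub>?G\<^esub> A = \<one>\<^bsub>?G\<^esub>"
      using a assms by (simp add: one_fundamental_group mult_loop_class loops_const loop_class_eq_iff loops_concat loops_rev)
        (auto intro!: path_homotopic_rev_concat simp: loops_def)
  qed (intro loop_class_in_carrier loops_rev a(1))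
  fix B assume "B \<in> carrier ?G"
  then obtain b where b: "b \<in> loops X x" "B = loop_class X x b" by (auto simp: c)
  show "A \<otimes>\<^bsub>?G\<^esub> B \<in> carrier ?G"
    using a b by (simp add: mult_loop_class loops_concat)
  fix C assume "C \<in> carrier ?G"
  then obtain d where d: "d \<in> loops X x" "C = loop_class X x d" by (auto simp: c)
  show "A \<otimes>\<^bsub>?G\<^esub> B \<otimes>\<^bsub>?G\<^esub> C = A \<otimes>\<^bsub>?G\<^esub> (B \<otimes>\<^bsub>?G\<^esub> C)"
    using a b d by (simp add: mult_loop_class loops_concat loop_class_eq_iff)
      (auto intro!: path_homotopic_concat_assoc simp: loops_def)
qed

text \<open>A choice \<open>\<gamma>\<close> of paths from the base point to all points turns the fundamental groupoid into
  a functor \<open>tr\<close> to the fundamental group.\<close>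

locale path_frame =
  fixes X :: "'a topology" and x0 :: 'a and \<gamma> :: "'a \<Rightarrow> real \<Rightarrow> 'a"
  assumes base: "x0 \<in> topspace X"
    and frame: "\<And>y. y \<in> topspace X \<Longrightarrow> pathin X (\<gamma> y) \<and> \<gamma> y 0 = x0 \<and> \<gamma> y 1 = y"
    and frame_base: "\<gamma> x0 = (\<lambda>t. x0)"
begin

abbreviation "\<Gamma> \<equiv> fundamental_group X x0"

sublocale G: group \<Gamma>
  by (rule group_fundamental_group[OF base])

definition frame_loop :: "(real \<Rightarrow> 'a) \<Rightarrow> real \<Rightarrow> 'a" where
  "frame_loop d = \<gamma> (d 0) \<bowtie> (d \<bowtie> rev_path (\<gamma> (d 1)))"

definition tr :: "(real \<Rightarrow> 'a) \<Rightarrow> (real \<Rightarrow> 'a) set" where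
  "tr d = loop_class X x0 (frame_loop d)"

lemma frame_loop_in_loops: "pathin X d \<Longrightarrow> frame_loop d \<in> loops X x0"
  using frame[of "d 0"] frame[of "d 1"] path_start_in_topspace[of X d] path_finish_in_topspace[of X d]
  by (auto simp: frame_loop_def loops_def intro!: pathin_loop_concat pathin_rev_path)

lemma tr_in_carrier: "pathin X d \<Longrightarrow> tr d \<in> carrier \<Gamma>"
  by (simp add: tr_def frame_loop_in_loops)

lemma tr_cong:
  assumes "path_homotopic X d e" shows "tr d = tr e"
proof -
  note p = path_homotopic_pathin[OF assms] and s = path_homotopic_ends[OF assms]
  have f: "pathin X (\<gamma> (d 0))" "pathin X (\<gamma> (d 1))" "\<gamma> (d 0) 1 = d 0" "\<gamma> (d 1) 1 = d 1"
    using frame path_start_in_topspace[OF p(1)] path_finish_in_topspace[OF p(1)] by auto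
  have "path_homotopic X (frame_loop d) (frame_loop e)"
    unfolding frame_loop_def s using f assms
    by (intro path_homotopic_concat path_homotopic_refl pathin_rev_path) auto
  then show ?thesis
    unfolding tr_def using p frame_loop_in_loops by (simp add: loop_class_eq_iff)
qed

text \<open>In the product of the two frame loops, the return along the frame path of the common
  point and the same path outward cancel.\<close>

lemma tr_concat:
  assumes d: "pathin X d" and e: "pathin X e" and de: "d 1 = e 0"
  shows "tr (d \<bowtie> e) = tr d \<otimes>\<^bsub>\<Gamma>\<^esub> tr e"
proof -
  let ?x = "\<gamma> (d 0)" and ?y = "\<gamma> (e 0)" and ?z = "\<gamma> (e 1)"
  have f [simp]: "pathin X ?x" "pathin X ?y" "pathin X ?z" "?x 1 = d 0" "?y 1 = e 0" "?z 1 = e 1"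
    "?x 0 = x0" "?y 0 = x0" "?z 0 = x0" "pathin X d" "pathin X e" "d 1 = e 0"
    "pathin X (rev_path ?x)" "pathin X (rev_path ?y)" "pathin X (rev_path ?z)"
    using frame path_start_in_topspace[OF d] path_start_in_topspace[OF e] path_finish_in_topspace[OF e]
     d e de by (auto intro: pathin_rev_path)
  have "path_homotopic X ((?x \<bowtie> (d \<bowtie> rev_path ?y)) \<bowtie> (?y \<bowtie> (e \<bowtie> rev_path ?z)))
          (?x \<bowtie> ((d \<bowtie> rev_path ?y) \<bowtie> (?y \<bowtie> (e \<bowtie> rev_path ?z))))"
    by (intro path_homotopic_concat_assoc pathin_loop_concat) auto
  also have "path_homotopic X \<dots> (?x \<bowtie> (d \<bowtie> (rev_path ?y \<bowtie> (?y \<bowtie> (e \<bowtie> rev_path ?z)))))"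
    by (intro path_homotopic_concat path_homotopic_refl path_homotopic_concat_assoc pathin_loop_concat) auto
  also have "path_homotopic X \<dots> (?x \<bowtie> (d \<bowtie> (e \<bowtie> rev_path ?z)))"
    by (intro path_homotopic_concat path_homotopic_refl path_homotopic_cancel_rev pathin_loop_concat) auto
  also have "path_homotopic X \<dots> (?x \<bowtie> ((d \<bowtie> e) \<bowtie> rev_path ?z))"
    by (intro path_homotopic_concat path_homotopic_refl path_homotopic_sym[OF path_homotopic_concat_assoc]) auto
  finally have "path_homotopic X (frame_loop d \<bowtie> frame_loop e) (frame_loop (d \<bowtie> e))"
    by (simp add: frame_loop_def)
  then show ?thesis
    unfolding tr_def using d e de
    by (simp add: mult_loop_class frame_loop_in_loops loop_class_eq_iff loops_concat pathin_loop_concat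
        path_homotopic_sym)
qed

text \<open>The normalization \<open>frame_base\<close> makes both connecting paths constant, so a
  loop at \<open>x0\<close> is not even conjugated.\<close>

lemma tr_loop:
  assumes "g \<in> loops X x0" shows "tr g = loop_class X x0 g"
proof -
  have g: "pathin X g" "g 0 = x0" "g 1 = x0" using assms by (auto simp: loops_def)
  have "path_homotopic X (frame_loop g) (g \<bowtie> (\<lambda>t. x0))"
    unfolding frame_loop_def using g
    by (simp add: frame_base rev_path_def path_homotopic_concat_const_left pathin_loop_concat base)
  also have "path_homotopic X \<dots> g"
    using g by (intro path_homotopic_concat_const_right) auto
  finally show ?thesis
    unfolding tr_def using g assms by (simp add: loop_class_eq_iff frame_loop_in_loops)
qed

lemma tr_frame:
  assumes "y \<in> topspace X" shows "tr (\<gamma> y) = \<one>\<^bsub>\<Gamma>\<^esub>"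
proof -
  have g: "pathin X (\<gamma> y)" "\<gamma> y 0 = x0" "\<gamma> y 1 = y" using frame[OF assms] by auto
  have "path_homotopic X (frame_loop (\<gamma> y)) (\<gamma> y \<bowtie> rev_path (\<gamma> y))"
    unfolding frame_loop_def using g
    by (auto simp: frame_base intro!: path_homotopic_concat_const_left pathin_loop_concat pathin_rev_path)
  also have "path_homotopic X \<dots> (\<lambda>t. x0)"
    using g by (intro path_homotopic_concat_rev)
  finally show ?thesis
    unfolding tr_def using g base
    by (simp add: loop_class_eq_iff frame_loop_in_loops one_fundamental_group loops_const)
qed

lemma tr_const:
  assumes "y \<in> topspace X" shows "tr (\<lambda>t. y) = \<one>\<^bsub>\<Gamma>\<^esub>"
proof -
  have "tr (\<gamma> y) \<otimes>\<^bsub>\<Gamma>\<^esub> tr (\<lambda>t. y) = tr (\<gamma> y \<bowtie> (\<lambda>t. y))"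
    using frame[OF assms] assms by (subst tr_concat) auto
  also have "\<dots> = tr (\<gamma> y)"
    by (rule tr_cong) (use frame[OF assms] in \<open>auto intro: path_homotopic_concat_const_right\<close>)
  finally have "\<one>\<^bsub>\<Gamma>\<^esub> \<otimes>\<^bsub>\<Gamma>\<^esub> tr (\<lambda>t. y) = \<one>\<^bsub>\<Gamma>\<^esub>" by (simp add: tr_frame assms)
  moreover have "tr (\<lambda>t. y) \<in> carrier \<Gamma>" using assms by (simp add: tr_in_carrier)
  ultimately show ?thesis by simp
qed

end

lemma path_frame_exists:
  assumes "path_connected_space X" "x0 \<in> topspace X"
  obtains \<gamma> where "path_frame X x0 \<gamma>"
proof -
  have "\<forall>y\<in>topspace X. \<exists>g. pathin X g \<and> g 0 = x0 \<and> g 1 = y"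
    using assms unfolding path_connected_space_def by blast
  then obtain \<gamma> where "\<forall>y\<in>topspace X. pathin X (\<gamma> y) \<and> \<gamma> y 0 = x0 \<and> \<gamma> y 1 = y"
    by metis
  then have "path_frame X x0 (\<gamma>(x0 := (\<lambda>t. x0)))"
    using assms(2) by unfold_locales auto
  then show ?thesis by (rule that)
qed


section \<open>Lifting paths and homotopies\<close>

text \<open>An evenly covered neighbourhood in the form needed for constructing lifts: the sheet
  through a given point, with the inverse \<open>q\<close> of \<open>p\<close> on it. Disjointness
  of the sheets is dropped here; it matters for uniqueness of lifts.\<close>

lemma covering_sheet:
  assumes "covering_map X M p" "y \<in> topspace M"
  obtains T where "openin M T" "y \<in> T"
    "\<And>x. x \<in> topspace X \<Longrightarrow> p x \<in> T \<Longrightarrow>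
      \<exists>U q. openin X U \<and> x \<in> U \<and> homeomorphic_maps (subtopology X U) (subtopology M T) p q"
proof -
  obtain T \<V> where T: "openin M T" "y \<in> T"
    and V: "\<Union>\<V> = {x \<in> topspace X. p x \<in> T}" "\<forall>U \<in> \<V>. openin X U"
      "\<forall>U \<in> \<V>. homeomorphic_map (subtopology X U) (subtopology M T) p"
    using assms unfolding covering_map_def by meson
  have "\<exists>U q. openin X U \<and> x \<in> U \<and> homeomorphic_maps (subtopology X U) (subtopology M T) p q"
    if x: "x \<in> topspace X" "p x \<in> T" for x
  proof -
    obtain U where "U \<in> \<V>" "x \<in> U" using V(1) x by auto
    then show ?thesis using V(2,3) by (auto simp: homeomorphic_map_maps)
  qed
  then show thesis using that T by blast
qed

lemma covering_map_continuous: "covering_map X M p \<Longrightarrow> continuous_map X M p"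
  by (simp add: covering_map_def)

lemma covering_map_in_topspace: "covering_map X M p \<Longrightarrow> x \<in> topspace X \<Longrightarrow> p x \<in> topspace M"
  by (auto simp: covering_map_def)

text \<open>The set where the lifts agree is open and closed. Near a point the two lifts lie either
  in the same sheet, on which \<open>p\<close> is injective, or in two disjoint sheets, so in a
  neighbourhood they agree everywhere or nowhere.\<close>

lemma covering_lift_unique:
  assumes cov: "covering_map X M p" and Z: "connected_space Z"
    and f: "continuous_map Z X f" and g: "continuous_map Z X g"
    and fg: "\<And>z. z \<in> topspace Z \<Longrightarrow> p (f z) = p (g z)"
    and z0: "z0 \<in> topspace Z" "f z0 = g z0" and z: "z \<in> topspace Z"
  shows "f z = g z"
proof -
  let ?A = "{z \<in> topspace Z. f z = g z}"
  have fZ: "f z \<in> topspace X" and gZ: "g z \<in> topspace X" if "z \<in> topspace Z" for z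
    using that f g by (auto simp: continuous_map_def)
  have pre: "openin Z {z \<in> topspace Z. f z \<in> U \<and> g z \<in> U'}" if "openin X U" "openin X U'" for U U'
  proof -
    have "openin Z {z \<in> topspace Z. f z \<in> U}" "openin Z {z \<in> topspace Z. g z \<in> U'}"
      using f g that by (auto simp: continuous_map_def)
    then have "openin Z ({z \<in> topspace Z. f z \<in> U} \<inter> {z \<in> topspace Z. g z \<in> U'})"
      by (rule openin_Int)
    then show ?thesis by (rule back_subst[of "openin Z"]) auto
  qed
  have nbhd: "\<exists>S. openin Z S \<and> z \<in> S \<and> (S \<subseteq> ?A \<or> S \<inter> ?A = {})" if zZ: "z \<in> topspace Z" for z
  proof -
    obtain T \<V> where T: "openin M T" "p (f z) \<in> T"
      and V: "\<Union>\<V> = {x \<in> topspace X. p x \<in> T}" "\<forall>U \<in> \<V>. openin X U" "pairwise disjnt \<V>"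
        "\<forall>U \<in> \<V>. homeomorphic_map (subtopology X U) (subtopology M T) p"
      using cov covering_map_in_topspace[OF cov fZ[OF zZ]] unfolding covering_map_def by meson
    have inj: "inj_on p U" if "U \<in> \<V>" for U
      using V(2,4) that homeomorphic_imp_injective_map[of "subtopology X U" "subtopology M T" p]
        openin_subset[of X U] by (auto simp: Int_absorb1)
    obtain U U' where U: "U \<in> \<V>" "f z \<in> U" "U' \<in> \<V>" "g z \<in> U'"
      using V(1) T fZ[OF zZ] gZ[OF zZ] fg[OF zZ] by (metis (mono_tags, lifting) UnionE mem_Collect_eq)
    have "U = U'" if "f z = g z"
      using that U V(3) by (auto simp: pairwise_def disjnt_iff)
    let ?S = "{z \<in> topspace Z. f z \<in> U \<and> g z \<in> U'}"
    have "?S \<subseteq> ?A \<or> ?S \<inter> ?A = {}"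
    proof (cases "U = U'")
      case True
      then have "?S \<subseteq> ?A" using inj[OF U(1)] fg by (auto simp: inj_on_def)
      then show ?thesis ..
    next
      case False
      then have "disjnt U U'" using U V(3) by (auto simp: pairwise_def)
      then show ?thesis by (auto simp: disjnt_iff)
    qed
    moreover have "openin Z ?S" using pre U V(2) by blast
    ultimately show ?thesis using U zZ by (intro exI[of _ ?S]) auto
  qed
  have "openin Z ?A"
    using nbhd by (subst openin_subopen) (metis (no_types, lifting) IntI empty_iff mem_Collect_eq)
  moreover have "openin Z (topspace Z - ?A)"
  proof (subst openin_subopen, intro ballI)
    fix z assume z: "z \<in> topspace Z - ?A"
    then obtain S where "openin Z S" "z \<in> S" "S \<subseteq> ?A \<or> S \<inter> ?A = {}" using nbhd by blast
    then show "\<exists>T. openin Z T \<and> z \<in> T \<and> T \<subseteq> topspace Z - ?A"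
      using z openin_subset by blast
  qed
  ultimately have "?A = {} \<or> ?A = topspace Z"
    using Z unfolding connected_space_clopen_in closedin_def by blast
  then show ?thesis using z z0 by blast
qed

text \<open>A lift is demanded with any prescribed value at any point \<open>z\<close> of
  \<open>K\<close>, not only at a corner. This makes the property stable under unions: a lift can be
  continued from whichever piece it starts in.\<close>

definition lifts_over ::
    "'b topology \<Rightarrow> ('b \<Rightarrow> 'a) \<Rightarrow> ('c::topological_space \<Rightarrow> 'a) \<Rightarrow> 'c set \<Rightarrow> bool" where
  "lifts_over X p H K \<longleftrightarrow>
     (\<forall>z\<in>K. \<forall>x\<in>topspace X. p x = H z \<longrightarrow>
        (\<exists>h. continuous_map (top_of_set K) X h \<and> (\<forall>w\<in>K. p (h w) = H w) \<and> h z = x))"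

lemma lifts_over_local:
  assumes "covering_map X M p" "continuous_map euclidean M H"
  obtains S where "open S" "z \<in> S" "\<And>K. K \<subseteq> S \<Longrightarrow> lifts_over X p H K"
proof -
  have "H z \<in> topspace M" using assms(2) by (auto simp: continuous_map_def)
  from covering_sheet[OF assms(1) this] obtain T where T: "openin M T" "H z \<in> T"
    and sh: "\<And>x. x \<in> topspace X \<Longrightarrow> p x \<in> T \<Longrightarrow>
      \<exists>U q. openin X U \<and> x \<in> U \<and> homeomorphic_maps (subtopology X U) (subtopology M T) p q"
    by blast
  let ?S = "{w. H w \<in> T}"
  have "open ?S" using assms(2) T(1) by (auto simp: continuous_map_def)
  moreover have "lifts_over X p H K" if K: "K \<subseteq> ?S" for K
    unfolding lifts_over_def
  proof (intro ballI impI)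
    fix w x assume w: "w \<in> K" "x \<in> topspace X" "p x = H w"
    then obtain U q where U: "openin X U" "x \<in> U"
      and pq: "homeomorphic_maps (subtopology X U) (subtopology M T) p q"
      using sh K by (metis (mono_tags, lifting) mem_Collect_eq subsetD)
    have q: "continuous_map (subtopology M T) (subtopology X U) q"
      "\<And>y. y \<in> topspace M \<Longrightarrow> y \<in> T \<Longrightarrow> p (q y) = y" "q (p x) = x"
      using pq U(2) w(2) by (auto simp: homeomorphic_maps_def)
    have H: "continuous_map (top_of_set K) (subtopology M T) H"
      using continuous_map_from_subtopology[OF assms(2), of K] K by (auto simp: continuous_map_in_subtopology)
    show "\<exists>h. continuous_map (top_of_set K) X h \<and> (\<forall>w\<in>K. p (h w) = H w) \<and> h w = x"
    proof (intro exI conjI ballI)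
      show "continuous_map (top_of_set K) X (q \<circ> H)"
        using continuous_map_compose[OF H q(1)] by (simp add: continuous_map_in_subtopology)
      show "p ((q \<circ> H) v) = H v" if "v \<in> K" for v
        using that K q(2)[of "H v"] assms(2) by (auto simp: continuous_map_def)
      show "(q \<circ> H) w = x" using w(3) q(3) by (metis comp_apply)
    qed
  qed
  ultimately show thesis using that[of ?S] T(2) by blast
qed

text \<open>A lift on one set prescribes the value of a lift on the other at a common point. By
  uniqueness the two agree on the whole connected intersection and can be pasted, both sets being
  closed.\<close>

lemma lifts_over_Un:
  assumes cov: "covering_map X M p"
    and K: "closed K" "lifts_over X p H K" and L: "closed L" "lifts_over X p H L"
    and KL: "connected (K \<inter> L)" "K \<inter> L \<noteq> {}"
  shows "lifts_over X p H (K \<union> L)"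
proof -
  \<comment> \<open>Here the starting point lies in the first set; the other case follows by
    exchanging \<open>K\<close> and \<open>L\<close>.\<close>
  have one: "\<exists>h. continuous_map (top_of_set (K \<union> L)) X h \<and> (\<forall>w\<in>K \<union> L. p (h w) = H w) \<and> h z = x"
    if K: "closed K" "lifts_over X p H K" and L: "closed L" "lifts_over X p H L"
    and KL: "connected (K \<inter> L)" "K \<inter> L \<noteq> {}" and z: "z \<in> K" "x \<in> topspace X" "p x = H z"
    for K L z x
  proof -
    obtain h where h: "continuous_map (top_of_set K) X h" "\<forall>w\<in>K. p (h w) = H w" "h z = x"
      using K(2) z unfolding lifts_over_def by blast
    obtain c where c: "c \<in> K" "c \<in> L" using KL(2) by blast
    then have "h c \<in> topspace X" using h(1) by (auto simp: continuous_map_def)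
    then obtain k where k: "continuous_map (top_of_set L) X k" "\<forall>w\<in>L. p (k w) = H w" "k c = h c"
      using L(2) c h(2) unfolding lifts_over_def by metis
    have agree: "h w = k w" if "w \<in> K \<inter> L" for w
    proof (rule covering_lift_unique[OF cov, of "top_of_set (K \<inter> L)" _ _ c])
      show "connected_space (top_of_set (K \<inter> L))" using KL(1) by (simp add: connectedin_def flip: connectedin_iff_connected)
      show "continuous_map (top_of_set (K \<inter> L)) X h" "continuous_map (top_of_set (K \<inter> L)) X k"
        using h(1) k(1) continuous_map_from_subtopology_mono by blast+
    qed (use h k c that in auto)
    let ?f = "\<lambda>w. if w \<in> K then h w else k w"
    have cl: "closedin (top_of_set (K \<union> L)) K" "closedin (top_of_set (K \<union> L)) L"
      using K(1) L(1) by (auto intro: closed_subset)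
    have "continuous_map (top_of_set (K \<union> L)) X ?f"
    proof (rule pasting_lemma_closed[where I="{True,False}" and T="\<lambda>b. if b then K else L"
          and f="\<lambda>b. if b then h else k"])
      show "continuous_map (subtopology (top_of_set (K \<union> L)) (if i then K else L)) X (if i then h else k)"
        for i
        using h(1) k(1) by (auto simp: subtopology_subtopology Int_absorb1)
    qed (use cl agree in \<open>auto\<close>)
    moreover have "\<forall>w\<in>K \<union> L. p (?f w) = H w" using h k by auto
    ultimately show ?thesis using h(3) z(1) by (intro exI[of _ ?f]) auto
  qed
  show ?thesis
    unfolding lifts_over_def
  proof (intro ballI impI)
    fix z x assume z: "z \<in> K \<union> L" "x \<in> topspace X" "p x = H z"
    then consider "z \<in> K" | "z \<in> L" by blast
    then show "\<exists>h. continuous_map (top_of_set (K \<union> L)) X h \<and> (\<forall>w\<in>K \<union> L. p (h w) = H w) \<and> h z = x"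
    proof cases
      case 1
      then show ?thesis using one[OF K L KL] z by blast
    next
      case 2
      then show ?thesis using one[OF L K] KL z by (simp add: Int_commute Un_commute)
    qed
  qed
qed

text \<open>Bolzano's interval induction is applied in both coordinates: first strips over short
  intervals are lifted, then these are merged.\<close>

lemma lifts_over_square:
  fixes H :: "real \<times> real \<Rightarrow> 'a"
  assumes cov: "covering_map X M p" and H: "continuous_map euclidean M H"
  shows "lifts_over X p H ({0..1} \<times> {0..1})"
proof -
  \<comment> \<open>The width \<open>e\<close> of the strip may depend on the interval
    \<open>{c..d}\<close>, and joining two intervals takes the smaller width. This yields one width
    for the whole interval \<open>{0..1}\<close>.\<close>
  have strip: "\<exists>e>0. \<forall>a b. x - e < a \<and> a \<le> x \<and> x \<le> b \<and> b < x + e \<longrightarrow>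
      lifts_over X p H ({a..b} \<times> {0..1})" for x
  proof (rule Bolzano[where a="0::real" and b=1 and P="\<lambda>c d. \<exists>e>0. \<forall>a b. x - e < a \<and> a \<le> x \<and> x \<le> b \<and> b < x + e \<longrightarrow>
      lifts_over X p H ({a..b} \<times> {c..d})"])
    fix c d f :: real
    assume 1: "\<exists>e>0. \<forall>a b. x - e < a \<and> a \<le> x \<and> x \<le> b \<and> b < x + e \<longrightarrow> lifts_over X p H ({a..b} \<times> {c..d})"
      and 2: "\<exists>e>0. \<forall>a b. x - e < a \<and> a \<le> x \<and> x \<le> b \<and> b < x + e \<longrightarrow> lifts_over X p H ({a..b} \<times> {d..f})"
      and cdf: "c \<le> d" "d \<le> f"
    obtain e1 where e1: "e1 > 0" "\<forall>a b. x - e1 < a \<and> a \<le> x \<and> x \<le> b \<and> b < x + e1 \<longrightarrow> lifts_over X p H ({a..b} \<times> {c..d})"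
      using 1 by blast
    obtain e2 where e2: "e2 > 0" "\<forall>a b. x - e2 < a \<and> a \<le> x \<and> x \<le> b \<and> b < x + e2 \<longrightarrow> lifts_over X p H ({a..b} \<times> {d..f})"
      using 2 by blast
    have "lifts_over X p H ({a..b} \<times> {c..f})"
      if ab: "x - min e1 e2 < a" "a \<le> x" "x \<le> b" "b < x + min e1 e2" for a b
    proof -
      have eq: "{a..b} \<times> {c..f} = {a..b} \<times> {c..d} \<union> {a..b} \<times> {d..f}" using cdf by auto
      have int: "({a..b} \<times> {c..d}) \<inter> ({a..b} \<times> {d..f}) = {a..b} \<times> {d}" using cdf by auto
      show ?thesis unfolding eq
      proof (rule lifts_over_Un[OF cov])
        show "connected (({a..b} \<times> {c..d}) \<inter> ({a..b} \<times> {d..f}))"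
          unfolding int by (intro convex_connected convex_Times) auto
        show "lifts_over X p H ({a..b} \<times> {c..d})"
          by (rule e1(2)[rule_format]) (use ab in auto)
        show "lifts_over X p H ({a..b} \<times> {d..f})"
          by (rule e2(2)[rule_format]) (use ab in auto)
      qed (use ab in \<open>auto simp: int intro: closed_Times\<close>)
    qed
    then show "\<exists>e>0. \<forall>a b. x - e < a \<and> a \<le> x \<and> x \<le> b \<and> b < x + e \<longrightarrow> lifts_over X p H ({a..b} \<times> {c..f})"
      using e1(1) e2(1) by (intro exI[of _ "min e1 e2"]) auto
  next
    fix y :: real
    obtain S where S: "open S" "(x, y) \<in> S" "\<And>K. K \<subseteq> S \<Longrightarrow> lifts_over X p H K"
      using lifts_over_local[OF cov H, of "(x, y)"] by blast
    obtain A B where AB: "open A" "open B" "x \<in> A" "y \<in> B" "A \<times> B \<subseteq> S"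
      using S(1,2) by (rule open_prod_elim) auto
    obtain e where e: "e > 0" "\<And>u. \<bar>u - x\<bar> < e \<Longrightarrow> u \<in> A"
      using AB(1,3) by (auto simp: open_dist dist_real_def)
    obtain d where d: "d > 0" "\<And>u. \<bar>u - y\<bar> < d \<Longrightarrow> u \<in> B"
      using AB(2,4) by (auto simp: open_dist dist_real_def)
    show "\<exists>d>0. \<forall>c f. c \<le> y \<and> y \<le> f \<and> f - c < d \<longrightarrow>
        (\<exists>e>0. \<forall>a b. x - e < a \<and> a \<le> x \<and> x \<le> b \<and> b < x + e \<longrightarrow> lifts_over X p H ({a..b} \<times> {c..f}))"
    proof (rule exI[of _ d], intro conjI allI impI d(1))
      fix c f assume cf: "c \<le> y \<and> y \<le> f \<and> f - c < d"
      show "\<exists>e>0. \<forall>a b. x - e < a \<and> a \<le> x \<and> x \<le> b \<and> b < x + e \<longrightarrow> lifts_over X p H ({a..b} \<times> {c..f})"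
      proof (rule exI[of _ e], intro conjI allI impI e(1))
        fix a b assume "x - e < a \<and> a \<le> x \<and> x \<le> b \<and> b < x + e"
        with cf have "{a..b} \<times> {c..f} \<subseteq> A \<times> B" by (intro Sigma_mono subsetI e(2) d(2)) auto
        then show "lifts_over X p H ({a..b} \<times> {c..f})" using AB(5) S(3) by blast
      qed
    qed
  qed simp
  show ?thesis
  proof (rule Bolzano[where a="0::real" and b=1 and P="\<lambda>a b. lifts_over X p H ({a..b} \<times> {0..1})"])
    fix a b c :: real
    assume *: "lifts_over X p H ({a..b} \<times> {0..1})" "lifts_over X p H ({b..c} \<times> {0..1})" "a \<le> b" "b \<le> c"
    have eq: "{a..c} \<times> {0..1::real} = {a..b} \<times> {0..1} \<union> {b..c} \<times> {0..1}" using * by auto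
    have int: "({a..b} \<times> {0..1::real}) \<inter> ({b..c} \<times> {0..1}) = {b} \<times> {0..1}" using * by auto
    show "lifts_over X p H ({a..c} \<times> {0..1})"
      unfolding eq
    proof (rule lifts_over_Un[OF cov])
      show "connected (({a..b} \<times> {0..1::real}) \<inter> ({b..c} \<times> {0..1}))"
        unfolding int by (intro convex_connected convex_Times) auto
    qed (use * in \<open>auto simp: int intro: closed_Times\<close>)
  next
    fix x :: real
    obtain e where e: "e>0" "\<And>a b. x - e < a \<and> a \<le> x \<and> x \<le> b \<and> b < x + e \<Longrightarrow> lifts_over X p H ({a..b} \<times> {0..1})"
      using strip[of x] by blast
    show "\<exists>d>0. \<forall>a b. a \<le> x \<and> x \<le> b \<and> b - a < d \<longrightarrow> lifts_over X p H ({a..b} \<times> {0..1})"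
      by (intro exI[of _ e] conjI allI impI e) auto
  qed simp
qed

lemma covering_lift_square:
  fixes H :: "real \<times> real \<Rightarrow> 'a"
  assumes cov: "covering_map X M p" and H: "continuous_map (top_of_set ({0..1} \<times> {0..1})) M H"
    and x: "x \<in> topspace X" "p x = H (0, 0)"
  obtains h where "continuous_map (top_of_set ({0..1} \<times> {0..1})) X h"
    "\<And>z. z \<in> {0..1} \<times> {0..1} \<Longrightarrow> p (h z) = H z" "h (0, 0) = x"
proof -
  let ?Q = "{0..1} \<times> {0..1} :: (real \<times> real) set"
  \<comment> \<open>Clamping both coordinates retracts the plane onto the square and extends
    \<open>H\<close> to the plane, so that local lifting can work with neighbourhoods open in the
    plane.\<close>
  define r :: "real \<times> real \<Rightarrow> real \<times> real" where
    "r z = (max 0 (min 1 (fst z)), max 0 (min 1 (snd z)))" for z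
  have r: "r z \<in> ?Q" "z \<in> ?Q \<Longrightarrow> r z = z" for z
    by (cases z, auto simp: r_def)+
  have "continuous_map euclidean (top_of_set ?Q) r"
    using r(1) unfolding r_def by (auto simp: continuous_map_in_subtopology intro!: continuous_intros)
  then have "continuous_map euclidean M (H \<circ> r)"
    using H by (rule continuous_map_compose)
  from lifts_over_square[OF cov this]
  have "\<exists>h. continuous_map (top_of_set ?Q) X h \<and> (\<forall>z\<in>?Q. p (h z) = (H \<circ> r) z) \<and> h (0, 0) = x"
    unfolding lifts_over_def
    by (elim ballE[where x="(0, 0)"] ballE[where x=x] impE) (use x r(2)[of "(0, 0)"] in auto)
  then obtain h where "continuous_map (top_of_set ?Q) X h"
    "\<forall>z\<in>?Q. p (h z) = (H \<circ> r) z" "h (0, 0) = x" by blast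
  then show thesis using r(2) by (intro that[of h]) auto
qed

section \<open>Lifts of paths and their endpoints\<close>

definition is_lift :: "'b topology \<Rightarrow> ('b \<Rightarrow> 'a) \<Rightarrow> (real \<Rightarrow> 'a) \<Rightarrow> 'b \<Rightarrow> (real \<Rightarrow> 'b) \<Rightarrow> bool" where
  "is_lift X p g x k \<longleftrightarrow> pathin X k \<and> k 0 = x \<and> (\<forall>t\<in>{0..1}. p (k t) = g t)"

text \<open>A path is lifted as a map of the square that is constant in the first
  coordinate.\<close>

lemma is_lift_exists:
  assumes cov: "covering_map X M p" and g: "pathin M g" and x: "x \<in> topspace X" "p x = g 0"
  shows "\<exists>k. is_lift X p g x k"
proof -
  have "continuous_map (top_of_set ({0..1} \<times> {0..1} :: (real \<times> real) set)) (top_of_set {0..1}) snd"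
    by (auto intro!: continuous_intros)
  then have "continuous_map (top_of_set ({0..1} \<times> {0..1} :: (real \<times> real) set)) M (g \<circ> snd)"
    using g unfolding pathin_def by (rule continuous_map_compose)
  from covering_lift_square[OF cov this x(1)] obtain h where h:
    "continuous_map (top_of_set ({0..1} \<times> {0..1} :: (real \<times> real) set)) X h"
    "\<And>z. z \<in> {0..1} \<times> {0..1} \<Longrightarrow> p (h z) = (g \<circ> snd) z" "h (0, 0) = x"
    using x by auto
  have "continuous_map (top_of_set {0..1}) (top_of_set ({0..1} \<times> {0..1})) (\<lambda>t::real. (0::real, t))"
    by (auto intro!: continuous_intros)
  then have "pathin X (h \<circ> (\<lambda>t. (0, t)))"
    using h(1) unfolding pathin_def by (rule continuous_map_compose)
  then have "is_lift X p g x (h \<circ> (\<lambda>t. (0, t)))"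
    using h unfolding is_lift_def by auto
  then show ?thesis by blast
qed

lemma connected_space_unit_interval: "connected_space (top_of_set {0..1::real})"
  by (metis connected_Icc connectedin_def connectedin_iff_connected)

lemma is_lift_unique:
  assumes cov: "covering_map X M p" and "is_lift X p g x k" "is_lift X p g x k'" "t \<in> {0..1}"
  shows "k t = k' t"
  by (rule covering_lift_unique[OF cov connected_space_unit_interval, of _ _ 0])
    (use assms in \<open>auto simp: is_lift_def pathin_def\<close>)

text \<open>The homotopy is lifted from the corner above the starting point. Its restrictions to the
  sides lift \<open>g\<close>, \<open>h\<close> and two constant paths, so uniqueness identifies
  them with \<open>k\<close>, \<open>l\<close> and constants. In particular \<open>k\<close> and
  \<open>l\<close> end at the same point.\<close>

lemma is_lift_homotopic:
  assumes cov: "covering_map X M p" and gh: "path_homotopic M g h"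
    and k: "is_lift X p g x k" and l: "is_lift X p h x l"
  shows "path_homotopic X k l"
proof -
  let ?Q = "{0..1} \<times> {0..1} :: (real \<times> real) set"
  obtain H where H: "continuous_map (top_of_set ?Q) M H"
    "\<forall>t\<in>{0..1}. H (0, t) = g t" "\<forall>t\<in>{0..1}. H (1, t) = h t"
    "\<forall>t\<in>{0..1}. H (t, 0) = g 0" "\<forall>t\<in>{0..1}. H (t, 1) = g 1"
    using gh unfolding path_homotopic_iff by blast
  have x: "x \<in> topspace X" "p x = H (0, 0)"
    using k H(2) path_start_in_topspace[of X k] by (auto simp: is_lift_def)
  obtain K where K: "continuous_map (top_of_set ?Q) X K" "\<And>z. z \<in> ?Q \<Longrightarrow> p (K z) = H z" "K (0, 0) = x"
    using covering_lift_square[OF cov H(1) x] by blast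
  have path: "pathin X (K \<circ> f)" if "continuous_map (top_of_set {0..1}) (top_of_set ?Q) f" for f
    using that K(1) unfolding pathin_def by (rule continuous_map_compose)
  have lift: "is_lift X p (\<lambda>t. H (f t)) (K (f 0)) (K \<circ> f)"
    if f: "continuous_map (top_of_set {0..1}) (top_of_set ?Q) f" for f
    unfolding is_lift_def using path[OF f] K(2) f by (auto simp: continuous_map_def Pi_iff)
  have const: "is_lift X p (\<lambda>t. p z) z (\<lambda>t. z)" if "z \<in> topspace X" for z
    using that by (simp add: is_lift_def)
  have eq: "K (f t) = m t"
    if f: "continuous_map (top_of_set {0..1}) (top_of_set ?Q) f" "is_lift X p m' (K (f 0)) m"
      "\<And>t. t \<in> {0..1} \<Longrightarrow> m' t = H (f t)" "t \<in> {0..1}" for f m m' t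
  proof -
    have "is_lift X p (\<lambda>t. H (f t)) (K (f 0)) m" using f(2,3) by (auto simp: is_lift_def)
    from is_lift_unique[OF cov lift[OF f(1)] this f(4)] show ?thesis by simp
  qed
  have c: "continuous_map (top_of_set {0..1}) (top_of_set ?Q) (\<lambda>t. (0, t))"
    "continuous_map (top_of_set {0..1}) (top_of_set ?Q) (\<lambda>t. (1, t))"
    "continuous_map (top_of_set {0..1}) (top_of_set ?Q) (\<lambda>t. (t, 0))"
    "continuous_map (top_of_set {0..1}) (top_of_set ?Q) (\<lambda>t. (t, 1))"
    by (auto intro!: continuous_intros)
  have K0: "K (0, t) = k t" if "t \<in> {0..1}" for t
    by (rule eq[OF c(1), where m'=g]) (use that k K(3) H in auto)
  have KT: "K (s, 0) = x" if "s \<in> {0..1}" for s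
    by (rule eq[OF c(3) const[of x, folded K(3)], unfolded K(3)]) (use that x H in auto)
  have K1: "K (1, t) = l t" if "t \<in> {0..1}" for t
    by (rule eq[OF c(2), where m'=h]) (use that l KT[of 1] H in auto)
  have "K (0, 1) \<in> topspace X" using K(1) by (auto simp: continuous_map_def Pi_iff)
  then have KB: "K (s, 1) = K (0, 1)" if "s \<in> {0..1}" for s
    by (rule eq[OF c(4) const]) (use that H K(2)[of "(0, 1)"] in auto)
  show ?thesis
    by (rule path_homotopicI[OF K(1)]) (use K0 K1 KT KB k in \<open>auto simp: is_lift_def\<close>)
qed

text \<open>The choice is immaterial as soon as a lift exists, because lifts from a given point are
  unique on the unit interval; without a lift the value is unspecified.\<close>

definition lift_end :: "'b topology \<Rightarrow> ('b \<Rightarrow> 'a) \<Rightarrow> 'b \<Rightarrow> (real \<Rightarrow> 'a) \<Rightarrow> 'b" where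
  "lift_end X p x g = (SOME k. is_lift X p g x k) 1"

lemma lift_end_eq:
  assumes "covering_map X M p" "is_lift X p g x k" shows "lift_end X p x g = k 1"
proof -
  have "is_lift X p g x (SOME k. is_lift X p g x k)" using assms(2) by (rule someI[of "is_lift X p g x"])
  then show ?thesis unfolding lift_end_def using is_lift_unique assms by fastforce
qed

lemma lift_end_obtain:
  assumes "covering_map X M p" "pathin M g" "x \<in> topspace X" "p x = g 0"
  obtains k where "is_lift X p g x k" "lift_end X p x g = k 1"
  using is_lift_exists[OF assms] lift_end_eq[OF assms(1)] by metis

lemma lift_end_in_topspace:
  assumes "covering_map X M p" "pathin M g" "x \<in> topspace X" "p x = g 0"
  shows "lift_end X p x g \<in> topspace X" "p (lift_end X p x g) = g 1"
proof -
  obtain k where k: "is_lift X p g x k" "lift_end X p x g = k 1"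
    using lift_end_obtain[OF assms] by blast
  then show "lift_end X p x g \<in> topspace X" "p (lift_end X p x g) = g 1"
    using path_finish_in_topspace[of X k] by (auto simp: is_lift_def)
qed

lemma lift_end_homotopic:
  assumes cov: "covering_map X M p" and gh: "path_homotopic M g h" and x: "x \<in> topspace X" "p x = g 0"
  shows "lift_end X p x g = lift_end X p x h"
proof -
  have "pathin M g" "pathin M h" "p x = h 0"
    using path_homotopic_pathin[OF gh] path_homotopic_ends[OF gh] x by auto
  then obtain k l where k: "is_lift X p g x k" "lift_end X p x g = k 1"
    and l: "is_lift X p h x l" "lift_end X p x h = l 1"
    using x lift_end_obtain[OF cov] by metis
  then show ?thesis using path_homotopic_ends[OF is_lift_homotopic[OF cov gh k(1) l(1)]] by simp
qed

lemma is_lift_concat: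
  assumes "is_lift X p g x k" "is_lift X p h (k 1) l"
  shows "is_lift X p (g \<bowtie> h) x (k \<bowtie> l)"
proof -
  have "pathin X (k \<bowtie> l)" using assms by (auto simp: is_lift_def intro: pathin_loop_concat)
  then show ?thesis using assms by (auto simp: is_lift_def loop_concat_def)
qed

lemma is_lift_rev:
  assumes "is_lift X p g x k"
  shows "is_lift X p (rev_path g) (k 1) (rev_path k)"
proof -
  have "pathin X (rev_path k)" using assms by (auto simp: is_lift_def intro: pathin_rev_path)
  then show ?thesis using assms by (auto simp: is_lift_def rev_path_def)
qed

lemma lift_end_concat:
  assumes cov: "covering_map X M p" and "pathin M g" "pathin M h" "g 1 = h 0"
    and x: "x \<in> topspace X" "p x = g 0"
  shows "lift_end X p x (g \<bowtie> h) = lift_end X p (lift_end X p x g) h"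
proof -
  obtain k where k: "is_lift X p g x k" "lift_end X p x g = k 1"
    using lift_end_obtain[OF cov assms(2) x] by blast
  then obtain l where l: "is_lift X p h (k 1) l" "lift_end X p (k 1) h = l 1"
    using lift_end_obtain[OF cov] assms lift_end_in_topspace[OF cov assms(2) x] by metis
  then show ?thesis
    using lift_end_eq[OF cov is_lift_concat[OF k(1) l(1)]] k by simp
qed

lemma lift_end_const:
  assumes "covering_map X M p" "x \<in> topspace X"
  shows "lift_end X p x (\<lambda>t. p x) = x"
  by (rule lift_end_eq[OF assms(1), of _ _ "\<lambda>t. x", simplified]) (use assms in \<open>auto simp: is_lift_def\<close>)

lemma is_lift_image: "pathin X k \<Longrightarrow> is_lift X p (p \<circ> k) (k 0) k"
  by (simp add: is_lift_def)

lemma lift_end_image: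
  assumes "covering_map X M p" "pathin X k"
  shows "lift_end X p (k 0) (p \<circ> k) = k 1"
  using lift_end_eq[OF assms(1) is_lift_image[OF assms(2)]] .

lemma lift_end_rev:
  assumes cov: "covering_map X M p" and "pathin M g" and x: "x \<in> topspace X" "p x = g 0"
  shows "lift_end X p (lift_end X p x g) (rev_path g) = x"
proof -
  obtain k where k: "is_lift X p g x k" "lift_end X p x g = k 1"
    using lift_end_obtain[OF cov assms(2) x] by blast
  then show ?thesis using lift_end_eq[OF cov is_lift_rev[OF k(1)]] by (simp add: is_lift_def)
qed


section \<open>Transitive right actions\<close>

text \<open>The inverse stands on the left, so that conjugation is a right action and sends the
  stabilizer of a point to the stabilizer of its translate.\<close>

definition conjugate :: "('a, 'b) monoid_scheme \<Rightarrow> 'a set \<Rightarrow> 'a \<Rightarrow> 'a set" where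
  "conjugate G F a = (\<lambda>f. inv\<^bsub>G\<^esub> a \<otimes>\<^bsub>G\<^esub> f \<otimes>\<^bsub>G\<^esub> a) ` F"

text \<open>Three instances occur: a fibre of a covering under lifting of loops, the right cosets of
  a subgroup under right multiplication, and the subgroups of given index under conjugation.\<close>

locale right_action = group G for G (structure) +
  fixes S :: "'x set" and act :: "'x \<Rightarrow> 'a \<Rightarrow> 'x"
  assumes act_closed: "x \<in> S \<Longrightarrow> a \<in> carrier G \<Longrightarrow> act x a \<in> S"
    and act_one: "x \<in> S \<Longrightarrow> act x \<one> = x"
    and act_mult: "x \<in> S \<Longrightarrow> a \<in> carrier G \<Longrightarrow> b \<in> carrier G \<Longrightarrow> act x (a \<otimes> b) = act (act x a) b"
begin

definition stabilizer :: "'x \<Rightarrow> 'a set" where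
  "stabilizer x = {a \<in> carrier G. act x a = x}"

lemma act_inv: "x \<in> S \<Longrightarrow> a \<in> carrier G \<Longrightarrow> act (act x a) (inv a) = x"
  using act_mult[of x a "inv a"] act_one by simp

lemma subgroup_stabilizer:
  assumes "x \<in> S" shows "subgroup (stabilizer x) G"
proof (rule subgroupI)
  show "inv a \<in> stabilizer x" if "a \<in> stabilizer x" for a
    using that assms act_inv[of x a] by (auto simp: stabilizer_def)
qed (use assms act_one act_mult in \<open>auto simp: stabilizer_def\<close>)

lemma stabilizer_act:
  assumes x: "x \<in> S" and a: "a \<in> carrier G"
  shows "stabilizer (act x a) = conjugate G (stabilizer x) a"
proof (intro equalityI subsetI)
  fix b assume b: "b \<in> stabilizer (act x a)"
  then have bc: "b \<in> carrier G" "act (act x a) b = act x a" by (auto simp: stabilizer_def)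
  then have "a \<otimes> b \<otimes> inv a \<in> stabilizer x"
    using x a by (simp add: stabilizer_def act_mult act_closed act_inv)
  moreover have "b = inv a \<otimes> (a \<otimes> b \<otimes> inv a) \<otimes> a"
    using a bc(1) by (simp add: m_assoc) (simp flip: m_assoc)
  ultimately show "b \<in> conjugate G (stabilizer x) a"
    unfolding conjugate_def by (rule image_eqI[rotated])
next
  fix b assume "b \<in> conjugate G (stabilizer x) a"
  then obtain f where f: "f \<in> carrier G" "act x f = x" "b = inv a \<otimes> f \<otimes> a"
    by (auto simp: conjugate_def stabilizer_def)
  then show "b \<in> stabilizer (act x a)"
    using x a by (simp add: stabilizer_def act_mult act_closed act_inv)
qed

text \<open>The orbit-stabilizer bijection sends \<open>y\<close> to the set of elements carrying
  \<open>x\<close> to \<open>y\<close>, which is a right coset of the stabilizer. It also covers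
  infinite orbits, where both cardinalities are 0.\<close>

lemma index_stabilizer:
  assumes x: "x \<in> S" and trans: "\<And>y. y \<in> S \<Longrightarrow> \<exists>a\<in>carrier G. y = act x a"
  shows "card (rcosets (stabilizer x)) = card S"
proof -
  have coset: "{b \<in> carrier G. act x b = act x a} = stabilizer x #> a" if a: "a \<in> carrier G" for a
  proof (intro equalityI subsetI)
    fix b assume b: "b \<in> {b \<in> carrier G. act x b = act x a}"
    then have "b \<otimes> inv a \<in> stabilizer x"
      using x a by (simp add: stabilizer_def act_mult act_closed act_inv)
    moreover have "b = b \<otimes> inv a \<otimes> a" using a b by (simp add: m_assoc)
    ultimately show "b \<in> stabilizer x #> a" unfolding r_coset_def by blast
  next
    fix b assume "b \<in> stabilizer x #> a"
    then show "b \<in> {b \<in> carrier G. act x b = act x a}"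
      using x a by (auto simp: r_coset_def stabilizer_def act_mult)
  qed
  have "bij_betw (\<lambda>y. {b \<in> carrier G. act x b = y}) S (rcosets (stabilizer x))"
  proof (rule bij_betw_imageI)
    show "inj_on (\<lambda>y. {b \<in> carrier G. act x b = y}) S"
    proof (rule inj_onI)
      fix y z assume y: "y \<in> S" and eq: "{b \<in> carrier G. act x b = y} = {b \<in> carrier G. act x b = z}"
      obtain a where "a \<in> carrier G" "y = act x a" using trans[OF y] by blast
      then have "a \<in> {b \<in> carrier G. act x b = z}" unfolding eq[symmetric] by simp
      then show "y = z" using \<open>y = act x a\<close> by simp
    qed
    show "(\<lambda>y. {b \<in> carrier G. act x b = y}) ` S = rcosets (stabilizer x)"
    proof -
      have "S = act x ` carrier G" using trans act_closed[OF x] by auto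
      then have "(\<lambda>y. {b \<in> carrier G. act x b = y}) ` S =
          (\<lambda>a. {b \<in> carrier G. act x b = act x a}) ` carrier G"
        by (simp add: image_image)
      also have "\<dots> = (\<lambda>a. stabilizer x #> a) ` carrier G"
        using coset by (intro image_cong) auto
      finally show ?thesis by (auto simp: RCOSETS_def)
    qed
  qed
  then show ?thesis by (simp add: bij_betw_same_card)
qed

end


section \<open>The classification of connected coverings\<close>

text \<open>Inside the sheet over an evenly covered \<open>T\<close>, the part in \<open>V\<close>
  projects to an open set; a path-connected neighbourhood \<open>W\<close> of \<open>p x\<close> in
  that set is lifted back by \<open>q\<close>. Local path connectedness of \<open>X\<close> and
  continuity of maps between coverings rest on this.\<close>

lemma covering_small_sheet:
  assumes cov: "covering_map X M p" and lpc: "locally_path_connected_space M"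
    and V: "openin X V" "x \<in> V"
  obtains U q where "openin X U" "x \<in> U" "U \<subseteq> V" "path_connectedin X U" "openin M (p ` U)"
    "homeomorphic_maps (subtopology X U) (subtopology M (p ` U)) p q"
proof -
  have x: "x \<in> topspace X" using V openin_subset by blast
  obtain T where T: "openin M T" "p x \<in> T" and sh: "\<And>x. x \<in> topspace X \<Longrightarrow> p x \<in> T \<Longrightarrow>
      \<exists>U q. openin X U \<and> x \<in> U \<and> homeomorphic_maps (subtopology X U) (subtopology M T) p q"
    using covering_sheet[OF cov covering_map_in_topspace[OF cov x]] by blast
  obtain U0 q where U0: "openin X U0" "x \<in> U0"
    and hm: "homeomorphic_maps (subtopology X U0) (subtopology M T) p q"
    using sh[OF x T(2)] by blast
  have hp: "homeomorphic_map (subtopology X U0) (subtopology M T) p"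
    using hm homeomorphic_maps_map by blast
  have sub: "U0 \<subseteq> topspace X" "T \<subseteq> topspace M" using U0 T openin_subset by auto
  have pU: "p ` U0 = T"
    using homeomorphic_imp_surjective_map[OF hp] sub by (simp add: Int_absorb1)
  have qp: "q (p u) = u" if "u \<in> U0" for u
    using hm that sub by (auto simp: homeomorphic_maps_def)
  have pq: "p (q t) = t" "q t \<in> U0" if "t \<in> T" for t
    using that pU qp by auto
  have "openin (subtopology X U0) (V \<inter> U0)"
    using V U0 by (simp add: openin_open_subtopology openin_Int)
  then have "openin (subtopology M T) (p ` (V \<inter> U0))"
    using homeomorphic_map_openness[OF hp, of "V \<inter> U0"] sub by auto
  then have "openin M (p ` (V \<inter> U0))"
    using T(1) openin_open_subtopology by blast
  then obtain W where W: "openin M W" "path_connectedin M W" "p x \<in> W" "W \<subseteq> p ` (V \<inter> U0)"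
    using lpc V(2) U0(2) unfolding locally_path_connected_space by (metis IntI image_eqI)
  define U where "U = q ` W"
  have WT: "W \<subseteq> T" using W(4) pU by blast
  have UU0: "U \<subseteq> U0" unfolding U_def using WT pq(2) by blast
  have UV: "U \<subseteq> V" unfolding U_def using W(4) qp by auto
  have pUW: "p ` U = W" unfolding U_def using WT pq(1) by (force simp: image_image)
  have hq: "homeomorphic_map (subtopology M T) (subtopology X U0) q"
    using hm homeomorphic_maps_map by blast
  have "openin (subtopology M T) W" using T W WT by (simp add: openin_open_subtopology)
  then have "openin (subtopology X U0) U"
    unfolding U_def using homeomorphic_map_openness[OF hq, of W] sub WT by auto
  then have "openin X U" using U0(1) openin_open_subtopology by blast
  moreover have "path_connectedin X U"
  proof -
    have "path_connectedin (subtopology M T) W" using W WT by (simp add: path_connectedin_subtopology)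
    then have "path_connectedin (subtopology X U0) U"
      unfolding U_def using path_connectedin_continuous_map_image[OF homeomorphic_imp_continuous_map[OF hq]] by blast
    then show ?thesis by (simp add: path_connectedin_subtopology)
  qed
  moreover have "homeomorphic_maps (subtopology X U) (subtopology M W) p q"
  proof -
    have "homeomorphic_maps (subtopology (subtopology X U0) U) (subtopology (subtopology M T) W) p q"
      by (rule homeomorphic_maps_subtopologies[OF hm])
        (use UU0 WT sub pUW in \<open>auto simp: Int_absorb1\<close>)
    then show ?thesis using UU0 WT by (simp add: subtopology_subtopology Int_absorb1)
  qed
  moreover have "x \<in> U" unfolding U_def using W(3) qp[OF U0(2)] by force
  ultimately show thesis using that UV pUW W(1) by blast
qed

lemma covering_locally_path_connected:
  assumes "covering_map X M p" "locally_path_connected_space M"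
  shows "locally_path_connected_space X"
  unfolding locally_path_connected_space using covering_small_sheet[OF assms] by metis

lemma lift_end_in_sheet:
  assumes cov: "covering_map X M p" and hm: "homeomorphic_maps (subtopology X U) (subtopology M W) p q"
    and x: "x \<in> topspace X" "x \<in> U" and g: "pathin (subtopology M W) g" "g 0 = p x"
  shows "lift_end X p x g \<in> U"
proof -
  have c: "continuous_map (subtopology M W) (subtopology X U) q"
    using hm by (simp add: homeomorphic_maps_def)
  have k: "pathin (subtopology X U) (q \<circ> g)" using g(1) c by (rule pathin_compose)
  have "is_lift X p g x (q \<circ> g)"
    unfolding is_lift_def
  proof (intro conjI ballI)
    show "pathin X (q \<circ> g)" using k by (simp add: pathin_subtopology)
    show "(q \<circ> g) 0 = x" using g(2) hm x by (auto simp: homeomorphic_maps_def)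
    show "p ((q \<circ> g) t) = g t" if "t \<in> {0..1}" for t
      using hm path_image_subset_topspace[OF g(1)] that by (auto simp: homeomorphic_maps_def Pi_iff)
  qed
  then have "lift_end X p x g = (q \<circ> g) 1" by (rule lift_end_eq[OF cov])
  then show ?thesis using path_finish_in_topspace[OF k] by simp
qed

section \<open>The monodromy action and its stabilizers\<close>

definition lift_act :: "'b topology \<Rightarrow> ('b \<Rightarrow> 'a) \<Rightarrow> 'b \<Rightarrow> (real \<Rightarrow> 'a) set \<Rightarrow> 'b" where
  "lift_act X p x A = lift_end X p x (SOME g. g \<in> A)"

text \<open>This is the image of the fundamental group of \<open>X\<close> at \<open>x\<close> under
  \<open>p\<close>, as the proof of \<open>fundamental_group_covering_iso\<close> shows. The ambient
  group is based at \<open>p x\<close> and so varies with \<open>x\<close>.\<close>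

definition stab :: "'b topology \<Rightarrow> ('b \<Rightarrow> 'a) \<Rightarrow> 'a topology \<Rightarrow> 'b \<Rightarrow> (real \<Rightarrow> 'a) set set" where
  "stab X p M x = {A \<in> carrier (fundamental_group M (p x)). lift_act X p x A = x}"

lemma lift_act_loop_class:
  assumes cov: "covering_map X M p" and x: "x \<in> topspace X" and g: "g \<in> loops M (p x)"
  shows "lift_act X p x (loop_class M (p x) g) = lift_end X p x g"
proof -
  have "g \<in> loop_class M (p x) g"
    using g by (auto simp: loop_homotopy_iff loops_def intro: path_homotopic_refl)
  then have "(SOME k. k \<in> loop_class M (p x) g) \<in> loop_class M (p x) g"
    by (rule someI[of "\<lambda>k. k \<in> loop_class M (p x) g"])
  then have "path_homotopic M g (SOME k. k \<in> loop_class M (p x) g)"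
    using in_loop_class_iff[OF g] by blast
  from lift_end_homotopic[OF cov this x] show ?thesis
    using g by (simp add: lift_act_def loops_def)
qed

lemma loop_class_in_stab_iff:
  assumes "covering_map X M p" "x \<in> topspace X" "g \<in> loops M (p x)"
  shows "loop_class M (p x) g \<in> stab X p M x \<longleftrightarrow> lift_end X p x g = x"
  using lift_act_loop_class[OF assms] loop_class_in_carrier[OF assms(3)] by (simp add: stab_def del: Image_singleton_iff)

lemma right_action_covering:
  assumes cov: "covering_map X M p" and x0: "x0 \<in> topspace M"
  shows "right_action (fundamental_group M x0) {x \<in> topspace X. p x = x0} (lift_act X p)"
proof -
  interpret group "fundamental_group M x0" by (rule group_fundamental_group[OF x0])
  have act: "lift_act X p x (loop_class M x0 g) = lift_end X p x g"
    if "x \<in> topspace X" "p x = x0" "g \<in> loops M x0" for x g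
    using lift_act_loop_class[OF cov that(1)] that by simp
  show ?thesis
  proof unfold_locales
    fix x assume x: "x \<in> {x \<in> topspace X. p x = x0}"
    show "lift_act X p x \<one>\<^bsub>fundamental_group M x0\<^esub> = x"
      unfolding one_fundamental_group
      using x x0 lift_end_const[OF cov] by (subst act) (auto intro: loops_const)
    fix A assume "A \<in> carrier (fundamental_group M x0)"
    then obtain g where g: "g \<in> loops M x0" "A = loop_class M x0 g"
      by (auto simp: carrier_fundamental_group)
    have gl: "pathin M g" "g 0 = x0" "g 1 = x0" using g by (auto simp: loops_def)
    show xg: "lift_act X p x A \<in> {x \<in> topspace X. p x = x0}"
      unfolding g(2) using lift_end_in_topspace[OF cov gl(1)] x g gl by (subst act) auto
    fix B assume "B \<in> carrier (fundamental_group M x0)"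
    then obtain h where h: "h \<in> loops M x0" "B = loop_class M x0 h"
      by (auto simp: carrier_fundamental_group)
    have hl: "pathin M h" "h 0 = x0" "h 1 = x0" using h by (auto simp: loops_def)
    have "lift_act X p x (A \<otimes>\<^bsub>fundamental_group M x0\<^esub> B) = lift_end X p x (g \<bowtie> h)"
      unfolding g(2) h(2) mult_loop_class[OF g(1) h(1)] using x g(1) h(1)
      by (intro act loops_concat) auto
    also have "\<dots> = lift_end X p (lift_end X p x g) h"
      using x gl hl by (intro lift_end_concat[OF cov]) auto
    also have "\<dots> = lift_act X p (lift_act X p x A) B"
    proof -
      have "lift_act X p x A = lift_end X p x g"
        unfolding g(2) using x g(1) by (intro act) auto
      moreover have "lift_act X p (lift_act X p x A) B = lift_end X p (lift_act X p x A) h"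
        using xg unfolding h(2) by (intro act h(1)) auto
      ultimately show ?thesis by simp
    qed
    finally show "lift_act X p x (A \<otimes>\<^bsub>fundamental_group M x0\<^esub> B) = lift_act X p (lift_act X p x A) B" .
  qed
qed

lemma stab_eq_stabilizer:
  assumes "covering_map X M p" "x \<in> topspace X"
  shows "stab X p M x = right_action.stabilizer (fundamental_group M (p x)) (lift_act X p) x"
  using right_action.stabilizer_def[OF right_action_covering[OF assms(1) covering_map_in_topspace[OF assms]]]
  by (auto simp: stab_def)

text \<open>A path in \<open>X\<close> from \<open>x\<close> to \<open>y\<close> projects to a loop,
  and the lift of that loop is the path itself.\<close>

lemma covering_transitive:
  assumes cov: "covering_map X M p" and pc: "path_connected_space X"
    and x: "x \<in> topspace X" "y \<in> topspace X" "p y = p x"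
  shows "\<exists>A\<in>carrier (fundamental_group M (p x)). y = lift_act X p x A"
proof -
  obtain k where k: "pathin X k" "k 0 = x" "k 1 = y"
    using pc x unfolding path_connected_space_def by blast
  have g: "p \<circ> k \<in> loops M (p x)"
    using k x pathin_compose[OF k(1) covering_map_continuous[OF cov]] by (auto simp: loops_def)
  have "lift_act X p x (loop_class M (p x) (p \<circ> k)) = y"
    using trans[OF lift_act_loop_class[OF cov x(1) g] lift_end_image[OF cov k(1), unfolded k]] .
  then show ?thesis using loop_class_in_carrier[OF g] by blast
qed

text \<open>The endpoint of a path from \<open>x\<close> is sent to the endpoint of the lift of its projection; this is
  independent of the path if the stabilizer of \<open>x\<close> is contained in that of \<open>y\<close>.\<close>

definition cover_transport ::
    "'b topology \<Rightarrow> ('b \<Rightarrow> 'a) \<Rightarrow> 'b \<Rightarrow> 'c topology \<Rightarrow> ('c \<Rightarrow> 'a) \<Rightarrow> 'c \<Rightarrow> 'b \<Rightarrow> 'c" where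
  "cover_transport X p x Y q y u =
     lift_end Y q y (p \<circ> (SOME d. pathin X d \<and> d 0 = x \<and> d 1 = u))"

text \<open>Two paths from \<open>x\<close> to \<open>u\<close> differ by a loop in the base that
  lifts to a closed path at \<open>x\<close>. Its class lies in the stabilizer of \<open>x\<close>,
  hence in that of \<open>y\<close>; so the loop also lifts to a closed path at \<open>y\<close>,
  and the two projected paths have lifts with a common end.\<close>

lemma cover_transport_eq:
  assumes X: "covering_map X M p" and Y: "covering_map Y M q"
    and x: "x \<in> topspace X" and y: "y \<in> topspace Y" "p x = q y"
    and st: "stab X p M x \<subseteq> stab Y q M y" and d: "pathin X d" "d 0 = x" "d 1 = u"
  shows "cover_transport X p x Y q y u = lift_end Y q y (p \<circ> d)"
proof -
  define e where "e = (SOME d. pathin X d \<and> d 0 = x \<and> d 1 = u)"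
  have e: "pathin X e \<and> e 0 = x \<and> e 1 = u"
    unfolding e_def by (rule someI[of _ d]) (use d in simp)
  let ?d = "p \<circ> d" and ?e = "p \<circ> e"
  have pd: "pathin M ?d" "?d 0 = q y" "?d 1 = p u" and pe: "pathin M ?e" "?e 0 = q y" "?e 1 = p u"
    using d e pathin_compose[OF _ covering_map_continuous[OF X]] y(2) by auto
  let ?L = "?e \<bowtie> rev_path ?d"
  have L: "?L \<in> loops M (p x)"
    using pd pe y(2) by (auto simp: loops_def intro!: pathin_loop_concat pathin_rev_path)
  have "lift_end X p x ?L = lift_end X p (lift_end X p x ?e) (rev_path ?d)"
    using pd pe x y(2) by (intro lift_end_concat[OF X] pathin_rev_path) auto
  also have "lift_end X p x ?e = u" using lift_end_image[OF X, of e] e by simp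
  also have "u = lift_end X p x ?d" using lift_end_image[OF X d(1)] d by simp
  also have "lift_end X p (lift_end X p x ?d) (rev_path ?d) = x"
    using pd x y(2) by (intro lift_end_rev[OF X]) auto
  finally have "loop_class M (p x) ?L \<in> stab X p M x" using loop_class_in_stab_iff[OF X x L] by blast
  then have "loop_class M (q y) ?L \<in> stab Y q M y" using st y(2) by auto
  then have "lift_end Y q y ?L = y" using loop_class_in_stab_iff[OF Y y(1)] L y(2) by simp
  then have *: "lift_end Y q (lift_end Y q y ?e) (rev_path ?d) = y"
    using lift_end_concat[OF Y pe(1) pathin_rev_path[OF pd(1)]] pd pe y by simp
  have "lift_end Y q (lift_end Y q (lift_end Y q y ?e) (rev_path ?d)) (rev_path (rev_path ?d)) = lift_end Y q y ?e"
    using lift_end_in_topspace[OF Y pe(1)] y pd pe by (intro lift_end_rev[OF Y] pathin_rev_path) auto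
  then have "lift_end Y q y ?d = lift_end Y q y ?e" unfolding * by simp
  then show ?thesis by (simp add: cover_transport_def e_def)
qed

text \<open>For continuity at \<open>u\<close>, a neighbourhood \<open>Z\<close> of \<open>u\<close>
  is chosen path connected and lying over the projection of a small sheet around the image of
  \<open>u\<close>. A path to \<open>u\<close> is prolonged inside \<open>Z\<close>; the projected
  prolongation stays under the sheet, so its lift does not leave it.\<close>

lemma cover_transport_properties:
  assumes X: "covering_map X M p" and Y: "covering_map Y M q"
    and lpc: "locally_path_connected_space M" and pc: "path_connected_space X"
    and x: "x \<in> topspace X" and y: "y \<in> topspace Y" "p x = q y"
    and st: "stab X p M x \<subseteq> stab Y q M y"
  shows "continuous_map X Y (cover_transport X p x Y q y)"
    and "\<And>u. u \<in> topspace X \<Longrightarrow> q (cover_transport X p x Y q y u) = p u"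
proof -
  let ?h = "cover_transport X p x Y q y"
  note heq = cover_transport_eq[OF X Y x y st]
  have path: "\<exists>d. pathin X d \<and> d 0 = x \<and> d 1 = u" if "u \<in> topspace X" for u
    using pc that x unfolding path_connected_space_def by blast
  have im: "pathin M (p \<circ> d)" if "pathin X d" for d
    using that covering_map_continuous[OF X] by (rule pathin_compose)
  have h: "?h u \<in> topspace Y" "q (?h u) = p u" if u: "u \<in> topspace X" for u
  proof -
    obtain d where d: "pathin X d" "d 0 = x" "d 1 = u" using path[OF u] by blast
    show "?h u \<in> topspace Y" "q (?h u) = p u"
      using lift_end_in_topspace[OF Y im[OF d(1)] y(1)] heq[OF d] d y by auto
  qed
  then show "\<And>u. u \<in> topspace X \<Longrightarrow> q (?h u) = p u" by blast
  show "continuous_map X Y ?h"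
    unfolding continuous_map_eq_topcontinuous_at topcontinuous_at_def
  proof (intro ballI conjI allI impI)
    fix u V assume u: "u \<in> topspace X" and V: "openin Y V \<and> ?h u \<in> V"
    obtain U r where U: "openin Y U" "?h u \<in> U" "U \<subseteq> V" "path_connectedin Y U" "openin M (q ` U)"
      and hm: "homeomorphic_maps (subtopology Y U) (subtopology M (q ` U)) q r"
      using covering_small_sheet[OF Y lpc] V by metis
    have "openin X {v \<in> topspace X. p v \<in> q ` U}"
      using covering_map_continuous[OF X] U(5) by (auto simp: continuous_map_def)
    moreover have "u \<in> {v \<in> topspace X. p v \<in> q ` U}" using u h(2)[OF u] U(2) by force
    ultimately obtain Z where Z: "openin X Z" "path_connectedin X Z" "u \<in> Z" "Z \<subseteq> {v \<in> topspace X. p v \<in> q ` U}"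
      using covering_locally_path_connected[OF X lpc] unfolding locally_path_connected_space by blast
    have "?h v \<in> V" if v: "v \<in> Z" for v
    proof -
      obtain e where e: "pathin X e" "e \<in> {0..1} \<rightarrow> Z" "e 0 = u" "e 1 = v"
        using Z(2,3) v unfolding path_connectedin by blast
      obtain d where d: "pathin X d" "d 0 = x" "d 1 = u" using path[OF u] by blast
      have "?h v = lift_end Y q y (p \<circ> (d \<bowtie> e))"
        using d e by (intro heq pathin_loop_concat) auto
      also have "\<dots> = lift_end Y q (lift_end Y q y (p \<circ> d)) (p \<circ> e)"
        unfolding image_loop_concat using d e y im by (intro lift_end_concat[OF Y]) auto
      also have "\<dots> = lift_end Y q (?h u) (p \<circ> e)" using heq[OF d] by simp
      also have "\<dots> \<in> U"
      proof (rule lift_end_in_sheet[OF Y hm h(1)[OF u] U(2)])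
        show "pathin (subtopology M (q ` U)) (p \<circ> e)"
          using im[OF e(1)] e(2) Z(4) by (auto simp: pathin_subtopology)
        show "(p \<circ> e) 0 = q (?h u)" using e h(2)[OF u] by simp
      qed
      finally show ?thesis using U(3) by blast
    qed
    then show "\<exists>U. openin X U \<and> u \<in> U \<and> (\<forall>v\<in>U. ?h v \<in> V)" using Z by blast
  qed (use h in auto)
qed

text \<open>The lift \<open>k\<close> to \<open>Y\<close> of the projection of a path
  \<open>d\<close> can serve as the path for the way back. It has the same projection as
  \<open>d\<close>, and the lift of that projection at \<open>x\<close> is \<open>d\<close>
  itself.\<close>

lemma cover_transport_inverse:
  assumes X: "covering_map X M p" and Y: "covering_map Y M q" and pc: "path_connected_space X"
    and x: "x \<in> topspace X" and y: "y \<in> topspace Y" "p x = q y"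
    and st: "stab X p M x = stab Y q M y" and u: "u \<in> topspace X"
  shows "cover_transport Y q y X p x (cover_transport X p x Y q y u) = u"
proof -
  obtain d where d: "pathin X d" "d 0 = x" "d 1 = u"
    using pc u x unfolding path_connected_space_def by blast
  have pd: "pathin M (p \<circ> d)"
    using d(1) covering_map_continuous[OF X] by (rule pathin_compose)
  obtain k where k: "is_lift Y q (p \<circ> d) y k" "lift_end Y q y (p \<circ> d) = k 1"
    using lift_end_obtain[OF Y pd y(1)] d y by auto
  have "cover_transport X p x Y q y u = k 1"
    using cover_transport_eq[OF X Y x y _ d] st k by simp
  moreover have "cover_transport Y q y X p x (k 1) = lift_end X p x (q \<circ> k)"
    using cover_transport_eq[OF Y X y(1) x y(2)[symmetric]] st k by (auto simp: is_lift_def)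
  moreover have "is_lift X p (q \<circ> k) x d"
    using k d by (auto simp: is_lift_def)
  ultimately show ?thesis using lift_end_eq[OF X] d by metis
qed

lemma coverings_equivalent_if_stab_eq:
  assumes X: "covering_map X M p" and Y: "covering_map Y M q"
    and lpc: "locally_path_connected_space M" and pc: "path_connected_space X" "path_connected_space Y"
    and x: "x \<in> topspace X" and y: "y \<in> topspace Y" "p x = q y"
    and st: "stab X p M x = stab Y q M y"
  shows "equivalent_coverings (X, p) (Y, q)"
proof -
  let ?h = "cover_transport X p x Y q y" and ?k = "cover_transport Y q y X p x"
  have "homeomorphic_maps X Y ?h ?k"
    unfolding homeomorphic_maps_def
    using cover_transport_properties(1)[OF X Y lpc pc(1) x y]
      cover_transport_properties(1)[OF Y X lpc pc(2) y(1) x y(2)[symmetric]]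
      cover_transport_inverse[OF X Y pc(1) x y st]
      cover_transport_inverse[OF Y X pc(2) y(1) x y(2)[symmetric] st[symmetric]] st
    by simp
  then show ?thesis
    unfolding equivalent_coverings_def homeomorphic_map_maps
    using cover_transport_properties(2)[OF X Y lpc pc(1) x y] st by auto
qed

text \<open>A homeomorphism over the base carries lifts to lifts, so a loop lifts to a closed path
  at \<open>x\<close> if and only if it does so at \<open>h x\<close>.\<close>

lemma stab_homeomorphic:
  assumes X: "covering_map X M p" and Y: "covering_map Y M q"
    and h: "homeomorphic_map X Y h" "\<And>u. u \<in> topspace X \<Longrightarrow> q (h u) = p u"
    and x: "x \<in> topspace X"
  shows "stab Y q M (h x) = stab X p M x"
proof -
  have hx: "h x \<in> topspace Y" using homeomorphic_imp_surjective_map[OF h(1)] x by blast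
  have ends: "lift_end Y q (h x) g = h (lift_end X p x g)" if g: "g \<in> loops M (p x)" for g
  proof -
    obtain k where k: "is_lift X p g x k" "lift_end X p x g = k 1"
      using lift_end_obtain[OF X _ x, of g] g by (auto simp: loops_def)
    then have "is_lift Y q g (h x) (h \<circ> k)"
      using pathin_compose[OF _ homeomorphic_imp_continuous_map[OF h(1)]] path_image_subset_topspace[of X k] h(2)
      by (auto simp: is_lift_def Pi_iff)
    from lift_end_eq[OF Y this] show ?thesis using k by simp
  qed
  have "h (lift_end X p x g) = h x \<longleftrightarrow> lift_end X p x g = x" if "g \<in> loops M (p x)" for g
  proof -
    have "lift_end X p x g \<in> topspace X"
      by (rule lift_end_in_topspace(1)[OF X _ x]) (use that in \<open>auto simp: loops_def\<close>)
    then show ?thesis using homeomorphic_imp_injective_map[OF h(1)] x by (auto simp: inj_on_eq_iff)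
  qed
  then have "loop_class M (p x) g \<in> stab Y q M (h x) \<longleftrightarrow> loop_class M (p x) g \<in> stab X p M x"
    if "g \<in> loops M (p x)" for g
    using loop_class_in_stab_iff[OF X x that] loop_class_in_stab_iff[OF Y hx] h(2)[OF x] that ends[OF that] by simp
  moreover have "stab Y q M (h x) \<subseteq> carrier (fundamental_group M (p x))"
    "stab X p M x \<subseteq> carrier (fundamental_group M (p x))"
    using h(2)[OF x] by (auto simp: stab_def)
  ultimately show ?thesis unfolding carrier_fundamental_group by blast
qed

text \<open>The isomorphism is induced by \<open>p\<close>. It is injective because homotopies lift,
  and it maps onto the stabilizer because a loop whose class lies there lifts to a loop.\<close>

lemma fundamental_group_covering_iso:
  assumes X: "covering_map X M p" and x: "x \<in> topspace X"
  shows "fundamental_group X x \<cong> (fundamental_group M (p x))\<lparr>carrier := stab X p M x\<rparr>"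
proof -
  let ?G = "fundamental_group X x" and ?\<Gamma> = "fundamental_group M (p x)"
  define \<phi> where "\<phi> A = loop_class M (p x) (p \<circ> (SOME k. k \<in> A))" for A
  have pl: "p \<circ> k \<in> loops M (p x)" if "k \<in> loops X x" for k
    using that pathin_compose[OF _ covering_map_continuous[OF X]] by (auto simp: loops_def)
  have \<phi>: "\<phi> (loop_class X x k) = loop_class M (p x) (p \<circ> k)" if k: "k \<in> loops X x" for k
  proof -
    let ?l = "SOME l. l \<in> loop_class X x k"
    have "k \<in> loop_class X x k"
      using k by (auto simp: loop_homotopy_iff loops_def intro: path_homotopic_refl)
    then have "?l \<in> loop_class X x k"
      by (rule someI[of "\<lambda>l. l \<in> loop_class X x k"])
    then have kl: "path_homotopic X k ?l" using in_loop_class_iff[OF k] by blast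
    then have "?l \<in> loops X x"
      using k path_homotopic_pathin[OF kl] path_homotopic_ends[OF kl] by (auto simp: loops_def)
    then show ?thesis
      unfolding \<phi>_def using path_homotopic_image[OF kl covering_map_continuous[OF X]] pl k
      by (metis loop_class_eq_iff)
  qed
  have hom: "\<phi> \<in> hom ?G (?\<Gamma>\<lparr>carrier := stab X p M x\<rparr>)"
  proof (rule homI)
    fix A assume "A \<in> carrier ?G"
    then obtain k where k: "k \<in> loops X x" "A = loop_class X x k" by (auto simp: carrier_fundamental_group)
    have "lift_end X p x (p \<circ> k) = x" using lift_end_image[OF X, of k] k by (simp add: loops_def)
    then have "\<phi> A \<in> stab X p M x"
      unfolding k(2) \<phi>[OF k(1)] by (rule iffD2[OF loop_class_in_stab_iff[OF X x pl[OF k(1)]]])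
    then show "\<phi> A \<in> carrier (?\<Gamma>\<lparr>carrier := stab X p M x\<rparr>)" by simp
    fix B assume "B \<in> carrier ?G"
    then obtain l where l: "l \<in> loops X x" "B = loop_class X x l" by (auto simp: carrier_fundamental_group)
    show "\<phi> (A \<otimes>\<^bsub>?G\<^esub> B) = \<phi> A \<otimes>\<^bsub>?\<Gamma>\<lparr>carrier := stab X p M x\<rparr>\<^esub> \<phi> B"
      using k l by (simp add: mult_loop_class \<phi> loops_concat pl image_loop_concat)
  qed
  have "bij_betw \<phi> (carrier ?G) (stab X p M x)"
  proof (rule bij_betw_imageI)
    show "inj_on \<phi> (carrier ?G)"
    proof (rule inj_onI)
      fix A B assume "A \<in> carrier ?G" "B \<in> carrier ?G" and AB: "\<phi> A = \<phi> B"
      then obtain k l where k: "k \<in> loops X x" "A = loop_class X x k" and l: "l \<in> loops X x" "B = loop_class X x l"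
        by (auto simp: carrier_fundamental_group)
      have "path_homotopic M (p \<circ> k) (p \<circ> l)"
        using AB k l \<phi> pl loop_class_eq_iff by metis
      then have "path_homotopic X k l"
        by (rule is_lift_homotopic[OF X]) (use k l in \<open>auto simp: is_lift_def loops_def\<close>)
      then show "A = B" using k l loop_class_eq_iff by metis
    qed
    show "\<phi> ` carrier ?G = stab X p M x"
    proof
      show "\<phi> ` carrier ?G \<subseteq> stab X p M x" using hom by (auto simp: hom_def)
      show "stab X p M x \<subseteq> \<phi> ` carrier ?G"
      proof
        fix A assume A: "A \<in> stab X p M x"
        then obtain g where g: "g \<in> loops M (p x)" "A = loop_class M (p x) g"
          by (auto simp: stab_def carrier_fundamental_group)
        then have end_x: "lift_end X p x g = x" using A loop_class_in_stab_iff[OF X x g(1)] by simp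
        obtain k where k: "is_lift X p g x k" "lift_end X p x g = k 1"
          using lift_end_obtain[OF X _ x, of g] g by (auto simp: loops_def)
        then have kl: "k \<in> loops X x" using end_x by (auto simp: loops_def is_lift_def)
        have "path_homotopic M (p \<circ> k) g"
          by (rule path_homotopic_cong) (use k pl[OF kl] in \<open>auto simp: is_lift_def loops_def\<close>)
        then have "\<phi> (loop_class X x k) = A"
          using \<phi>[OF kl] g pl[OF kl] loop_class_eq_iff by metis
        then show "A \<in> \<phi> ` carrier ?G" using loop_class_in_carrier[OF kl] by blast
      qed
    qed
  qed
  then have "\<phi> \<in> iso ?G (?\<Gamma>\<lparr>carrier := stab X p M x\<rparr>)" using hom by (simp add: iso_def)
  then show ?thesis by (auto simp: is_iso_def)
qed

text \<open>The stabilizers along the whole fibre form a conjugacy class by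
  \<open>stabs_conjugacy_class\<close>. Unlike a single stabilizer, this set requires no choice of a
  point in the fibre.\<close>

definition stabs :: "'b topology \<Rightarrow> ('b \<Rightarrow> 'a) \<Rightarrow> 'a topology \<Rightarrow> 'a \<Rightarrow> (real \<Rightarrow> 'a) set set set" where
  "stabs X p M x0 = stab X p M ` {x \<in> topspace X. p x = x0}"

lemma stabs_conjugacy_class:
  assumes X: "covering_map X M p" and pc: "path_connected_space X" and x: "x \<in> topspace X"
  shows "stabs X p M (p x) = conjugate (fundamental_group M (p x)) (stab X p M x) ` carrier (fundamental_group M (p x))"
proof -
  let ?\<Gamma> = "fundamental_group M (p x)" and ?S = "{y \<in> topspace X. p y = p x}"
  interpret right_action ?\<Gamma> ?S "lift_act X p"
    by (rule right_action_covering[OF X covering_map_in_topspace[OF X x]])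
  have st: "stab X p M y = stabilizer y" if "y \<in> ?S" for y
    using stab_eq_stabilizer[OF X, of y] that by simp
  have S: "?S = lift_act X p x ` carrier ?\<Gamma>"
    using covering_transitive[OF X pc x] act_closed[of x] x by blast
  have "stabs X p M (p x) = stabilizer ` ?S"
    unfolding stabs_def using st by (intro image_cong) auto
  also have "\<dots> = (\<lambda>A. stabilizer (lift_act X p x A)) ` carrier ?\<Gamma>" unfolding S by auto
  also have "\<dots> = conjugate ?\<Gamma> (stab X p M x) ` carrier ?\<Gamma>"
    using stabilizer_act[of x] st[of x] x by (intro image_cong) auto
  finally show ?thesis .
qed

lemma stab_subgroup_index:
  assumes X: "covering_map X M p" and pc: "path_connected_space X" and x: "x \<in> topspace X"
  shows "subgroup (stab X p M x) (fundamental_group M (p x))"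
    and "card (rcosets\<^bsub>fundamental_group M (p x)\<^esub> (stab X p M x)) = card {y \<in> topspace X. p y = p x}"
proof -
  let ?\<Gamma> = "fundamental_group M (p x)" and ?S = "{y \<in> topspace X. p y = p x}"
  interpret right_action ?\<Gamma> ?S "lift_act X p"
    by (rule right_action_covering[OF X covering_map_in_topspace[OF X x]])
  show "subgroup (stab X p M x) ?\<Gamma>"
    unfolding stab_eq_stabilizer[OF X x] using x by (intro subgroup_stabilizer) auto
  show "card (rcosets\<^bsub>?\<Gamma>\<^esub> (stab X p M x)) = card ?S"
    unfolding stab_eq_stabilizer[OF X x]
    by (rule index_stabilizer) (use x covering_transitive[OF X pc x] in auto)
qed

text \<open>If the two sets of stabilizers coincide, the stabilizer of a point \<open>x\<close> of
  \<open>X\<close> is also that of some point \<open>y\<close> of \<open>Y\<close>, and the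
  transport maps based at \<open>x\<close> and \<open>y\<close> are inverse to each other.\<close>

lemma equivalent_coverings_iff_stabs:
  assumes lpc: "locally_path_connected_space M" and x0: "x0 \<in> topspace M"
    and X: "covering_map X M p" "connected_space X" and Y: "covering_map Y M q" "connected_space Y"
  shows "equivalent_coverings (X, p) (Y, q) \<longleftrightarrow> stabs X p M x0 = stabs Y q M x0"
proof
  assume "equivalent_coverings (X, p) (Y, q)"
  then obtain h where h: "homeomorphic_map X Y h" "\<And>u. u \<in> topspace X \<Longrightarrow> q (h u) = p u"
    by (auto simp: equivalent_coverings_def)
  have "{y \<in> topspace Y. q y = x0} = h ` {x \<in> topspace X. p x = x0}"
    using homeomorphic_imp_surjective_map[OF h(1)] h(2) by force
  then have "stabs Y q M x0 = (\<lambda>x. stab Y q M (h x)) ` {x \<in> topspace X. p x = x0}"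
    by (auto simp: stabs_def)
  also have "\<dots> = stabs X p M x0"
    unfolding stabs_def using stab_homeomorphic[OF X(1) Y(1) h] by (intro image_cong) auto
  finally show "stabs X p M x0 = stabs Y q M x0" ..
next
  assume eq: "stabs X p M x0 = stabs Y q M x0"
  have "x0 \<in> p ` topspace X" using X(1) x0 by (simp add: covering_map_def)
  then obtain x where x: "x \<in> topspace X" "p x = x0" by auto
  then have "stab X p M x \<in> stabs Y q M x0" using eq by (auto simp: stabs_def)
  then obtain y where y: "y \<in> topspace Y" "q y = x0" "stab X p M x = stab Y q M y"
    by (auto simp: stabs_def)
  have pc: "path_connected_space X" "path_connected_space Y"
    using X Y covering_locally_path_connected[OF _ lpc] path_connected_eq_connected_space by blast+
  show "equivalent_coverings (X, p) (Y, q)"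
    using coverings_equivalent_if_stab_eq[OF X(1) Y(1) lpc pc x(1) y(1)] x y by simp
qed


section \<open>The covering belonging to a subgroup\<close>

text \<open>The homotopies take place inside \<open>U\<close>. Path connectedness will make a patch
  over \<open>U\<close> map onto \<open>U\<close>, and homotopy of paths will make it map
  injectively.\<close>

definition locally_simple :: "'a topology \<Rightarrow> bool" where
  "locally_simple M \<longleftrightarrow> (\<forall>V x. openin M V \<and> x \<in> V \<longrightarrow>
     (\<exists>U. openin M U \<and> x \<in> U \<and> U \<subseteq> V \<and> path_connectedin M U \<and> paths_homotopic (subtopology M U)))"

lemma locally_simple_imp_locally_path_connected:
  "locally_simple M \<Longrightarrow> locally_path_connected_space M"
  unfolding locally_simple_def locally_path_connected_space by blast

text \<open>The case \<open>b < a\<close> is included and gives the path run backwards. It occurs in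
  the continuity of lifts, where points on both sides of a given time are considered.\<close>

definition subpath :: "(real \<Rightarrow> 'a) \<Rightarrow> real \<Rightarrow> real \<Rightarrow> real \<Rightarrow> 'a" where
  "subpath d a b = (\<lambda>u. d (a + u * (b - a)))"

lemma affine_in_interval:
  fixes a b u l r :: real
  assumes "a \<in> {l..r}" "b \<in> {l..r}" "u \<in> {0..1}"
  shows "a + u * (b - a) \<in> {l..r}"
proof -
  have "(1 - u) *\<^sub>R a + u *\<^sub>R b \<in> {l..r}"
    using assms by (intro convexD[OF convex_real_interval(5)]) auto
  then show ?thesis by (simp add: algebra_simps)
qed

lemma pathin_subpath:
  assumes "pathin X d" "a \<in> {0..1}" "b \<in> {0..1}"
  shows "pathin X (subpath d a b)"
proof -
  have "pathin X (d \<circ> (\<lambda>u. a + u * (b - a)))"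
    by (rule pathin_reparametrize[OF assms(1)])
      (use affine_in_interval[OF assms(2,3)] in \<open>auto intro!: continuous_intros simp del: atLeastAtMost_iff\<close>)
  then show ?thesis by (simp add: subpath_def comp_def)
qed

lemma path_homotopic_subpath:
  assumes d: "pathin X d" and a: "a \<in> {0..1}" and b: "b \<in> {0..1}" and c: "c \<in> {0..1}"
  shows "path_homotopic X (subpath d a b \<bowtie> subpath d b c) (subpath d a c)"
proof -
  let ?f = "\<lambda>a b u. a + u * (b - a :: real)"
  have f: "pathin (top_of_set {0..1}) (?f a b)" if "a \<in> {0..1}" "b \<in> {0..1}" for a b
    using affine_in_interval[OF that] by (auto simp: pathin_def intro!: continuous_intros simp del: atLeastAtMost_iff)
  have "path_homotopic X (d \<circ> (?f a b \<bowtie> ?f b c)) (d \<circ> ?f a c)"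
    by (rule paths_homotopic_image[where T="top_of_set {0..1}"])
      (use d f a b c in \<open>auto simp: pathin_def[of X] intro!: paths_homotopic_convex pathin_loop_concat\<close>)
  moreover have "d \<circ> (?f a b \<bowtie> ?f b c) = subpath d a b \<bowtie> subpath d b c"
    unfolding image_loop_concat by (simp add: subpath_def comp_def)
  ultimately show ?thesis by (simp add: subpath_def comp_def)
qed

locale subgroup_covering = path_frame M x0 \<gamma>
  for M :: "'a topology" and x0 :: 'a and \<gamma> :: "'a \<Rightarrow> real \<Rightarrow> 'a" +
  fixes F :: "(real \<Rightarrow> 'a) set set"
  assumes F: "subgroup F (fundamental_group M x0)" and loc: "locally_simple M"
begin

abbreviation "cosets \<equiv> rcosets\<^bsub>\<Gamma>\<^esub> F"

abbreviation total :: "('a \<times> (real \<Rightarrow> 'a) set set) set" where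
  "total \<equiv> topspace M \<times> cosets"

text \<open>The sheet over \<open>U\<close> through the point \<open>(z, C)\<close>: along a path
  \<open>d\<close> in \<open>U\<close> the coset is multiplied by the element \<open>tr d\<close>.
  The product \<open>total\<close> is only the underlying set. Frame paths of neighbouring points
  may be unrelated, and the patches record which points are close.\<close>

definition patch :: "'a set \<Rightarrow> 'a \<Rightarrow> (real \<Rightarrow> 'a) set set \<Rightarrow> ('a \<times> (real \<Rightarrow> 'a) set set) set" where
  "patch U z C = {(d 1, C #>\<^bsub>\<Gamma>\<^esub> tr d) | d. pathin (subtopology M U) d \<and> d 0 = z}"

lemma cosets_subset: "C \<in> cosets \<Longrightarrow> C \<subseteq> carrier \<Gamma>"
  using subgroup.rcosets_carrier[OF F] G.is_group by blast

lemma coset_tr: "C \<in> cosets \<Longrightarrow> pathin M d \<Longrightarrow> C #>\<^bsub>\<Gamma>\<^esub> tr d \<in> cosets"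
  using tr_in_carrier[of d] subgroup.subset[OF F] by (auto simp: RCOSETS_def G.coset_mult_assoc)

lemma coset_tr_concat:
  "C \<in> cosets \<Longrightarrow> pathin M d \<Longrightarrow> pathin M e \<Longrightarrow> d 1 = e 0 \<Longrightarrow>
     C #>\<^bsub>\<Gamma>\<^esub> tr (d \<bowtie> e) = C #>\<^bsub>\<Gamma>\<^esub> tr d #>\<^bsub>\<Gamma>\<^esub> tr e"
  by (simp add: tr_concat G.coset_mult_assoc cosets_subset tr_in_carrier)

lemma coset_tr_const: "C \<in> cosets \<Longrightarrow> y \<in> topspace M \<Longrightarrow> C #>\<^bsub>\<Gamma>\<^esub> tr (\<lambda>t. y) = C"
  by (simp add: tr_const cosets_subset)

lemma patch_mono: "U \<subseteq> V \<Longrightarrow> patch U z C \<subseteq> patch V z C"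
  by (force simp: patch_def pathin_subtopology)

lemma patch_self: "z \<in> topspace M \<Longrightarrow> z \<in> U \<Longrightarrow> C \<in> cosets \<Longrightarrow> (z, C) \<in> patch U z C"
  unfolding patch_def using coset_tr_const[of C z]
  by (intro CollectI exI[of _ "\<lambda>t. z"]) auto

lemma patch_subset: "C \<in> cosets \<Longrightarrow> patch U z C \<subseteq> total"
  by (auto simp: patch_def pathin_subtopology coset_tr path_finish_in_topspace)

lemma patch_fst: "e \<in> patch U z C \<Longrightarrow> fst e \<in> U"
  using path_finish_in_topspace by (fastforce simp: patch_def)

text \<open>With \<open>patch_sym\<close> this shows that two patches over the same \<open>U\<close>
  coincide or are disjoint.\<close>

lemma patch_trans:
  assumes C: "C \<in> cosets" and wD: "(w, D) \<in> patch U z C"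
  shows "patch U w D \<subseteq> patch U z C"
proof
  fix e assume "e \<in> patch U w D"
  then obtain d where d: "e = (d 1, D #>\<^bsub>\<Gamma>\<^esub> tr d)" "pathin (subtopology M U) d" "d 0 = w"
    by (auto simp: patch_def)
  obtain c where c: "w = c 1" "D = C #>\<^bsub>\<Gamma>\<^esub> tr c" "pathin (subtopology M U) c" "c 0 = z"
    using wD by (auto simp: patch_def)
  have "pathin (subtopology M U) (c \<bowtie> d)"
    using c d by (intro pathin_loop_concat) auto
  moreover have "C #>\<^bsub>\<Gamma>\<^esub> tr (c \<bowtie> d) = D #>\<^bsub>\<Gamma>\<^esub> tr d"
    using c d C by (subst coset_tr_concat) (auto simp: pathin_subtopology)
  ultimately show "e \<in> patch U z C"
    unfolding patch_def using c d by (intro CollectI exI[of _ "c \<bowtie> d"]) auto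
qed

lemma patch_sym:
  assumes C: "C \<in> cosets" and wD: "(w, D) \<in> patch U z C"
  shows "(z, C) \<in> patch U w D"
proof -
  obtain c where c: "w = c 1" "D = C #>\<^bsub>\<Gamma>\<^esub> tr c" "pathin (subtopology M U) c" "c 0 = z"
    using wD by (auto simp: patch_def)
  have cM: "pathin M c" using c by (simp add: pathin_subtopology)
  have "D #>\<^bsub>\<Gamma>\<^esub> tr (rev_path c) = C #>\<^bsub>\<Gamma>\<^esub> tr (c \<bowtie> rev_path c)"
    using c cM C by (subst coset_tr_concat) (auto intro: pathin_rev_path)
  also have "tr (c \<bowtie> rev_path c) = tr (\<lambda>t. z)"
    using c cM by (intro tr_cong path_homotopic_concat_rev)
  also have "C #>\<^bsub>\<Gamma>\<^esub> tr (\<lambda>t. z) = C"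
    using C c path_start_in_topspace[OF cM] by (intro coset_tr_const) auto
  finally have "D #>\<^bsub>\<Gamma>\<^esub> tr (rev_path c) = C" .
  then show ?thesis
    unfolding patch_def using c pathin_rev_path[OF c(3)] by (intro CollectI exI[of _ "rev_path c"]) auto
qed

text \<open>Openness is given by a neighbourhood criterion, so the axioms of a topology follow from
  the monotonicity of patches in \<open>U\<close>; that patches over open sets are open is then
  \<open>patch_trans\<close>.\<close>

definition cover :: "('a \<times> (real \<Rightarrow> 'a) set set) topology" where
  "cover = topology (\<lambda>W. W \<subseteq> total \<and>
     (\<forall>(z, C)\<in>W. \<exists>U. openin M U \<and> z \<in> U \<and> patch U z C \<subseteq> W))"

lemma openin_cover:
  "openin cover W \<longleftrightarrow> W \<subseteq> total \<and> (\<forall>(z, C)\<in>W. \<exists>U. openin M U \<and> z \<in> U \<and> patch U z C \<subseteq> W)"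
proof -
  let ?P = "\<lambda>W. W \<subseteq> total \<and> (\<forall>(z, C)\<in>W. \<exists>U. openin M U \<and> z \<in> U \<and> patch U z C \<subseteq> W)"
  have "istopology ?P"
    unfolding istopology_def
  proof (intro conjI allI impI)
    fix S T assume S: "?P S" and T: "?P T"
    show "S \<inter> T \<subseteq> total" using S by blast
    show "\<forall>(z, C)\<in>S \<inter> T. \<exists>U. openin M U \<and> z \<in> U \<and> patch U z C \<subseteq> S \<inter> T"
    proof clarify
      fix z C assume "(z, C) \<in> S" "(z, C) \<in> T"
      then obtain U V where U: "openin M U" "z \<in> U" "patch U z C \<subseteq> S"
        and V: "openin M V" "z \<in> V" "patch V z C \<subseteq> T" using S T by blast
      then show "\<exists>U. openin M U \<and> z \<in> U \<and> patch U z C \<subseteq> S \<inter> T"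
        using patch_mono[of "U \<inter> V" U z C] patch_mono[of "U \<inter> V" V z C]
        by (intro exI[of _ "U \<inter> V"]) auto
    qed
  next
    fix \<K> assume K: "\<forall>K\<in>\<K>. ?P K"
    then show "\<Union> \<K> \<subseteq> total" by (simp add: Union_least)
    show "\<forall>(z, C)\<in>\<Union> \<K>. \<exists>U. openin M U \<and> z \<in> U \<and> patch U z C \<subseteq> \<Union> \<K>"
    proof clarify
      fix z C K assume K': "(z, C) \<in> K" "K \<in> \<K>"
      then have "?P K" using K by simp
      then obtain U where "openin M U" "z \<in> U" "patch U z C \<subseteq> K" using K'(1) by auto
      then show "\<exists>U. openin M U \<and> z \<in> U \<and> patch U z C \<subseteq> \<Union> \<K>"
        using K'(2) by (intro exI[of _ U]) auto
    qed
  qed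
  then show ?thesis unfolding cover_def by (simp add: topology_inverse')
qed

lemma topspace_cover: "topspace cover = total"
proof -
  have "openin cover total"
    unfolding openin_cover using patch_subset by blast
  then show ?thesis
    using openin_subset[of cover total] openin_topspace[of cover] unfolding openin_cover[of "topspace cover"] by blast
qed

lemma openin_patch:
  assumes "openin M U" "C \<in> cosets" shows "openin cover (patch U z C)"
  unfolding openin_cover
proof (intro conjI patch_subset assms(2), clarify)
  fix w D assume "(w, D) \<in> patch U z C"
  then show "\<exists>V. openin M V \<and> w \<in> V \<and> patch V w D \<subseteq> patch U z C"
    using patch_trans[OF assms(2)] patch_fst[of "(w, D)" U z C] assms(1) by (intro exI[of _ U]) auto
qed

lemma continuous_map_fst_cover: "continuous_map cover M fst"
  unfolding continuous_map_def topspace_cover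
proof (intro conjI allI impI)
  fix U assume U: "openin M U"
  show "openin cover {e \<in> total. fst e \<in> U}"
    unfolding openin_cover
  proof (intro conjI, blast, clarify)
    fix z C assume "C \<in> cosets" "fst (z, C) \<in> U"
    then show "\<exists>V. openin M V \<and> z \<in> V \<and> patch V z C \<subseteq> {e \<in> total. fst e \<in> U}"
      using U patch_subset patch_fst by (intro exI[of _ U]) auto
  qed
qed auto

lemma fst_patch:
  assumes "path_connectedin M U" "z \<in> U"
  shows "fst ` patch U z C = U"
proof
  show "fst ` patch U z C \<subseteq> U" using patch_fst by blast
  show "U \<subseteq> fst ` patch U z C"
  proof
    fix w assume "w \<in> U"
    then obtain d where "pathin M d" "d \<in> {0..1} \<rightarrow> U" "d 0 = z" "d 1 = w"
      using assms unfolding path_connectedin by blast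
    then have "(w, C #>\<^bsub>\<Gamma>\<^esub> tr d) \<in> patch U z C"
      unfolding patch_def pathin_subtopology by blast
    then show "w \<in> fst ` patch U z C" by force
  qed
qed

lemma open_map_fst_cover: "open_map cover M fst"
  unfolding open_map_def
proof (intro allI impI)
  fix W assume W: "openin cover W"
  show "openin M (fst ` W)"
  proof (subst openin_subopen, clarify)
    fix z C assume zC: "(z, C) \<in> W"
    then obtain U where U: "openin M U" "z \<in> U" "patch U z C \<subseteq> W"
      using W unfolding openin_cover by blast
    then obtain V where V: "openin M V" "path_connectedin M V" "z \<in> V" "V \<subseteq> U"
      using locally_simple_imp_locally_path_connected[OF loc] unfolding locally_path_connected_space by blast
    have "V = fst ` patch V z C" using fst_patch V by blast
    also have "\<dots> \<subseteq> fst ` W" using patch_mono[OF V(4)] U(3) by blast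
    finally show "\<exists>T. openin M T \<and> fst (z, C) \<in> T \<and> T \<subseteq> fst ` W" using V by auto
  qed
qed

text \<open>Two paths in \<open>U\<close> with common ends are homotopic, so they multiply the coset
  \<open>C\<close> by the same element.\<close>

lemma patch_inj:
  assumes U: "paths_homotopic (subtopology M U)"
  shows "inj_on fst (patch U z C)"
proof (rule inj_onI)
  fix e f assume "e \<in> patch U z C" "f \<in> patch U z C" "fst e = fst f"
  then obtain c d where cd: "e = (c 1, C #>\<^bsub>\<Gamma>\<^esub> tr c)" "f = (d 1, C #>\<^bsub>\<Gamma>\<^esub> tr d)"
    "pathin (subtopology M U) c" "pathin (subtopology M U) d" "c 0 = d 0" "c 1 = d 1"
    by (auto simp: patch_def)
  have "path_homotopic (subtopology M U) c d"
    using U cd unfolding paths_homotopic_def by blast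
  then have "path_homotopic M (id \<circ> c) (id \<circ> d)"
    by (rule path_homotopic_image) simp
  then show "e = f" using cd tr_cong[of c d] by simp
qed

lemma homeomorphic_map_patch:
  assumes U: "openin M U" "path_connectedin M U" "paths_homotopic (subtopology M U)"
    and z: "z \<in> U" and C: "C \<in> cosets"
  shows "homeomorphic_map (subtopology cover (patch U z C)) (subtopology M U) fst"
proof (rule bijective_open_imp_homeomorphic_map)
  have t: "topspace (subtopology cover (patch U z C)) = patch U z C"
    using patch_subset[OF C] by (auto simp: topspace_cover)
  have UM: "U \<subseteq> topspace M" using U(1) openin_subset by blast
  show "continuous_map (subtopology cover (patch U z C)) (subtopology M U) fst"
    using continuous_map_fst_cover t fst_patch[OF U(2) z, of C]
    by (auto simp: continuous_map_in_subtopology continuous_map_from_subtopology)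
  have "open_map (subtopology cover (patch U z C)) M fst"
    using open_map_from_subtopology[OF open_map_fst_cover openin_patch[OF U(1) C]] .
  then show "open_map (subtopology cover (patch U z C)) (subtopology M U) fst"
    by (rule open_map_into_subtopology) (use fst_patch[OF U(2) z, of C] t in auto)
  show "fst ` topspace (subtopology cover (patch U z C)) = topspace (subtopology M U)"
    using fst_patch[OF U(2) z, of C] t UM by (simp add: Int_absorb1)
  show "inj_on fst (topspace (subtopology cover (patch U z C)))"
    using patch_inj[OF U(3)] t by simp
qed

lemma F_in_cosets: "F \<in> cosets"
  using subgroup.subgroup_in_rcosets[OF F G.is_group] .

lemma covering_map_cover: "covering_map cover M fst"
  unfolding covering_map_def
proof (intro conjI ballI continuous_map_fst_cover)
  show "fst ` topspace cover = topspace M" using F_in_cosets by (force simp: topspace_cover)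
  fix y assume y: "y \<in> topspace M"
  then obtain U where U: "openin M U" "y \<in> U" "path_connectedin M U" "paths_homotopic (subtopology M U)"
    using loc[unfolded locally_simple_def, rule_format, of "topspace M" y] by auto
  have UM: "U \<subseteq> topspace M" using U(1) openin_subset by blast
  define \<V> where "\<V> = {patch U z C | z C. z \<in> U \<and> C \<in> cosets}"
  \<comment> \<open>A patch is recovered from each of its points; hence the family, although indexed
    by all points over \<open>U\<close>, is pairwise disjoint as a set of sets.\<close>
  have eq: "patch U z C = patch U w D" if "C \<in> cosets" "(w, D) \<in> patch U z C" for z C w D
    using that patch_trans patch_sym patch_subset[of C U z] by (intro equalityI) blast+
  have "\<Union>\<V> = {x \<in> topspace cover. fst x \<in> U}"
  proof (intro equalityI subsetI)
    fix e assume "e \<in> \<Union>\<V>"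
    then obtain z C where zC: "C \<in> cosets" "e \<in> patch U z C" by (auto simp: \<V>_def)
    then show "e \<in> {x \<in> topspace cover. fst x \<in> U}"
      using subsetD[OF patch_subset[OF zC(1)] zC(2)] patch_fst[OF zC(2)] unfolding topspace_cover by simp
  next
    fix e assume "e \<in> {x \<in> topspace cover. fst x \<in> U}"
    then obtain z C where e: "e = (z, C)" "z \<in> U" "C \<in> cosets" by (auto simp: topspace_cover)
    then show "e \<in> \<Union>\<V>" using patch_self[of z U C] UM unfolding \<V>_def by blast
  qed
  moreover have "\<forall>V\<in>\<V>. openin cover V" unfolding \<V>_def using openin_patch[OF U(1)] by blast
  moreover have "pairwise disjnt \<V>"
  proof (rule pairwiseI, rule ccontr)
    fix P Q assume "P \<in> \<V>" "Q \<in> \<V>" "P \<noteq> Q" "\<not> disjnt P Q"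
    then obtain z C z' C' where *: "P = patch U z C" "Q = patch U z' C'" "C \<in> cosets" "C' \<in> cosets"
      by (auto simp: \<V>_def)
    obtain w D where "(w, D) \<in> P" "(w, D) \<in> Q" using \<open>\<not> disjnt P Q\<close> by (auto simp: disjnt_iff)
    then show False using * eq \<open>P \<noteq> Q\<close> by metis
  qed
  moreover have "\<forall>V\<in>\<V>. homeomorphic_map (subtopology cover V) (subtopology M U) fst"
    unfolding \<V>_def using homeomorphic_map_patch[OF U(1,3,4)] by blast
  ultimately show "\<exists>T. openin M T \<and> y \<in> T \<and>
       (\<exists>\<V>. \<Union>\<V> = {x \<in> topspace cover. fst x \<in> T} \<and> (\<forall>U\<in>\<V>. openin cover U) \<and> pairwise disjnt \<V> \<and>
          (\<forall>U\<in>\<V>. homeomorphic_map (subtopology cover U) (subtopology M T) fst))"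
    using U(1,2) by blast
qed

text \<open>The lift is explicit: at time \<open>t\<close> the coset has been multiplied by the
  element of the part of \<open>d\<close> up to \<open>t\<close>. For \<open>t\<close> near
  \<open>s\<close> the part between \<open>s\<close> and \<open>t\<close> stays in a small
  \<open>U\<close>, so the lift stays in a patch.\<close>

lemma is_lift_cover:
  assumes d: "pathin M d" and C: "C \<in> cosets"
  shows "is_lift cover fst d (d 0, C) (\<lambda>t. (d t, C #>\<^bsub>\<Gamma>\<^esub> tr (subpath d 0 t)))"
proof -
  let ?k = "\<lambda>t. (d t, C #>\<^bsub>\<Gamma>\<^esub> tr (subpath d 0 t))"
  have tot: "?k t \<in> total" if "t \<in> {0..1}" for t
    using that path_image_subset_topspace[OF d] C pathin_subpath[OF d, of 0 t]
    by (auto simp: Pi_iff intro: coset_tr)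
  have step: "C #>\<^bsub>\<Gamma>\<^esub> tr (subpath d 0 t) = C #>\<^bsub>\<Gamma>\<^esub> tr (subpath d 0 s) #>\<^bsub>\<Gamma>\<^esub> tr (subpath d s t)"
    if "s \<in> {0..1}" "t \<in> {0..1}" for s t
  proof -
    have "tr (subpath d 0 t) = tr (subpath d 0 s \<bowtie> subpath d s t)"
      using that by (intro tr_cong path_homotopic_sym[OF path_homotopic_subpath[OF d]]) auto
    moreover have "C #>\<^bsub>\<Gamma>\<^esub> tr (subpath d 0 s \<bowtie> subpath d s t) =
        C #>\<^bsub>\<Gamma>\<^esub> tr (subpath d 0 s) #>\<^bsub>\<Gamma>\<^esub> tr (subpath d s t)"
      using that by (intro coset_tr_concat[OF C] pathin_subpath[OF d]) (auto simp: subpath_def)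
    ultimately show ?thesis by simp
  qed
  have "pathin cover ?k"
    unfolding pathin_def continuous_map_eq_topcontinuous_at topcontinuous_at_def
  proof (intro ballI conjI allI impI)
    fix s W assume s: "s \<in> topspace (top_of_set {0..1::real})" and W: "openin cover W \<and> ?k s \<in> W"
    then obtain U where U: "openin M U" "d s \<in> U" "patch U (d s) (C #>\<^bsub>\<Gamma>\<^esub> tr (subpath d 0 s)) \<subseteq> W"
      unfolding openin_cover by blast
    have "openin (top_of_set {0..1}) {t \<in> {0..1}. d t \<in> U}"
      using d U(1) by (auto simp: pathin_def continuous_map_def)
    then obtain e where e: "e > 0" "\<And>t. t \<in> {0..1} \<Longrightarrow> \<bar>t - s\<bar> < e \<Longrightarrow> d t \<in> U"
      using s U(2) by (force simp: openin_contains_ball dist_real_def ball_def abs_minus_commute)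
    have "?k t \<in> W" if t: "t \<in> {0..1} \<inter> ball s e" for t
    proof -
      have "subpath d s t u \<in> U" if u: "u \<in> {0..1}" for u
      proof -
        have "\<bar>u * (t - s)\<bar> \<le> 1 * \<bar>t - s\<bar>"
          unfolding abs_mult using u by (intro mult_right_mono) auto
        then show ?thesis
          unfolding subpath_def using t s u affine_in_interval[of s 0 1 t u]
          by (intro e(2)) (auto simp: dist_real_def abs_minus_commute)
      qed
      then have "pathin (subtopology M U) (subpath d s t)"
        using pathin_subpath[OF d, of s t] s t by (auto simp: pathin_subtopology)
      then have "(subpath d s t 1, C #>\<^bsub>\<Gamma>\<^esub> tr (subpath d 0 s) #>\<^bsub>\<Gamma>\<^esub> tr (subpath d s t))
          \<in> patch U (d s) (C #>\<^bsub>\<Gamma>\<^esub> tr (subpath d 0 s))"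
        unfolding patch_def by (intro CollectI exI[of _ "subpath d s t"]) (auto simp: subpath_def)
      then have "(d t, C #>\<^bsub>\<Gamma>\<^esub> tr (subpath d 0 s) #>\<^bsub>\<Gamma>\<^esub> tr (subpath d s t)) \<in> W"
        using U(3) by (auto simp: subpath_def)
      then show ?thesis using step[of s t] s t by simp
    qed
    then show "\<exists>T. openin (top_of_set {0..1}) T \<and> s \<in> T \<and> (\<forall>t\<in>T. ?k t \<in> W)"
      using e(1) s by (intro exI[of _ "{0..1} \<inter> ball s e"]) auto
  qed (use tot in \<open>auto simp: topspace_cover\<close>)
  moreover have "?k 0 = (d 0, C)"
    using coset_tr_const[OF C path_start_in_topspace[OF d]] by (simp add: subpath_def)
  ultimately show ?thesis by (simp add: is_lift_def)
qed

lemma lift_end_cover: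
  assumes "pathin M d" "C \<in> cosets"
  shows "lift_end cover fst (d 0, C) d = (d 1, C #>\<^bsub>\<Gamma>\<^esub> tr d)"
  using lift_end_eq[OF covering_map_cover is_lift_cover[OF assms]] by (simp add: subpath_def)

text \<open>The point over \<open>z\<close> with the coset of \<open>a\<close> is reached from
  \<open>(x0, F)\<close> by lifting a loop of class \<open>a\<close> followed by the frame path to
  \<open>z\<close>, which contributes the unit element.\<close>

lemma path_connected_cover: "path_connected_space cover"
proof -
  have base_path: "path_component_of cover (x0, F) e" if "e \<in> total" for e
  proof -
    obtain z a where e: "e = (z, F #>\<^bsub>\<Gamma>\<^esub> a)" "z \<in> topspace M" "a \<in> carrier \<Gamma>"
      using \<open>e \<in> total\<close> by (auto simp: RCOSETS_def)
    obtain g where g: "g \<in> loops M x0" "a = loop_class M x0 g"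
      using e(3) by (auto simp: carrier_fundamental_group)
    have gl: "pathin M g" "g 0 = x0" "g 1 = x0" using g by (auto simp: loops_def)
    let ?d = "g \<bowtie> \<gamma> z"
    have d: "pathin M ?d" using gl frame[OF e(2)] by (auto intro: pathin_loop_concat)
    have "tr ?d = a"
      using gl frame[OF e(2)] e(3) g by (simp add: tr_concat tr_frame e(2) tr_loop)
    then have k: "is_lift cover fst ?d (x0, F) (\<lambda>t. (?d t, F #>\<^bsub>\<Gamma>\<^esub> tr (subpath ?d 0 t)))"
      "(?d 1, F #>\<^bsub>\<Gamma>\<^esub> tr (subpath ?d 0 1)) = e"
      using is_lift_cover[OF d F_in_cosets] gl frame[OF e(2)] e(1) by (auto simp: subpath_def)
    then show ?thesis unfolding path_component_of_def is_lift_def by (metis (no_types, lifting))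
  qed
  show ?thesis
    unfolding path_connected_space_iff_path_component topspace_cover
  proof (intro ballI)
    fix e f assume "e \<in> total" "f \<in> total"
    then show "path_component_of cover e f"
      using base_path path_component_of_sym path_component_of_trans by metis
  qed
qed

text \<open>A loop at \<open>x0\<close> lifts from \<open>(x0, F)\<close> to the point over
  \<open>x0\<close> with the coset of its class, and this coset is \<open>F\<close> exactly for
  classes in \<open>F\<close>.\<close>

lemma stab_cover: "stab cover fst M (x0, F) = F"
proof -
  have x: "(x0, F) \<in> topspace cover" using base F_in_cosets by (simp add: topspace_cover)
  have *: "loop_class M x0 g \<in> stab cover fst M (x0, F) \<longleftrightarrow> loop_class M x0 g \<in> F" if g: "g \<in> loops M x0" for g
  proof -
    have gl: "pathin M g" "g 0 = x0" "g 1 = x0" using g by (auto simp: loops_def)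
    have "loop_class M x0 g \<in> stab cover fst M (x0, F) \<longleftrightarrow> lift_end cover fst (x0, F) g = (x0, F)"
      using loop_class_in_stab_iff[OF covering_map_cover x] g by simp
    also have "lift_end cover fst (x0, F) g = (x0, F #>\<^bsub>\<Gamma>\<^esub> loop_class M x0 g)"
      using lift_end_cover[OF gl(1) F_in_cosets] gl tr_loop[OF g] by simp
    also have "\<dots> = (x0, F) \<longleftrightarrow> loop_class M x0 g \<in> F"
    proof
      assume "(x0, F #>\<^bsub>\<Gamma>\<^esub> loop_class M x0 g) = (x0, F)"
      then show "loop_class M x0 g \<in> F"
        using G.rcos_self[OF loop_class_in_carrier[OF g] F] by blast
    next
      assume "loop_class M x0 g \<in> F"
      then show "(x0, F #>\<^bsub>\<Gamma>\<^esub> loop_class M x0 g) = (x0, F)"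
        using G.coset_join2[OF loop_class_in_carrier[OF g] F] by blast
    qed
    finally show ?thesis .
  qed
  have "stab cover fst M (x0, F) \<subseteq> carrier \<Gamma>" by (auto simp: stab_def)
  then show ?thesis
    using * subgroup.subset[OF F] unfolding carrier_fundamental_group by blast
qed

lemma connected_covering_cover:
  assumes "card cosets = n" "n \<ge> 1"
  shows "connected_covering n M (cover, fst)"
proof -
  have "{e \<in> topspace cover. fst e = y} = Pair y ` cosets" if "y \<in> topspace M" for y
    using that by (auto simp: topspace_cover)
  moreover have "finite cosets" using assms card_ge_0_finite by force
  ultimately show ?thesis
    unfolding connected_covering_def
    using path_connected_imp_connected_space[OF path_connected_cover] covering_map_cover assms(1)
    by (simp add: card_image inj_on_def)
qed

end

text \<open>The points of \<open>cover\<close> carry cosets of loop classes. The covering is moved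
  to the type on which coverings are counted, and its stabilizer is carried along by the
  homeomorphism.\<close>

lemma subgroup_covering_exists:
  assumes x0: "x0 \<in> topspace M" and pc: "path_connected_space M" and loc: "locally_simple M"
    and sub: "subgroup F (fundamental_group M x0)" "card (rcosets\<^bsub>fundamental_group M x0\<^esub> F) = n" "n \<ge> 1"
  obtains X p x where "(X, p) \<in> connected_coverings n M" "x \<in> topspace X" "p x = x0" "stab X p M x = F"
proof -
  obtain \<gamma> where "path_frame M x0 \<gamma>" using path_frame_exists[OF pc x0] .
  then interpret subgroup_covering M x0 \<gamma> F
    by (intro subgroup_covering.intro subgroup_covering_axioms.intro sub(1) loc)
  obtain X p where Xp: "(X, p) \<in> connected_coverings n M" "equivalent_coverings (cover, fst) (X, p)"
    using connected_covering_representable[OF connected_covering_cover[OF sub(2,3)]] by force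
  then obtain h where h: "homeomorphic_map cover X h" "\<And>u. u \<in> topspace cover \<Longrightarrow> p (h u) = fst u"
    by (auto simp: equivalent_coverings_def)
  have cov: "covering_map X M p" using Xp(1) by (simp add: connected_coverings_def connected_covering_def)
  have x: "(x0, F) \<in> topspace cover" using base F_in_cosets by (simp add: topspace_cover)
  show thesis
  proof (rule that[OF Xp(1)])
    show "h (x0, F) \<in> topspace X" using homeomorphic_imp_surjective_map[OF h(1)] x by blast
    show "p (h (x0, F)) = x0" using h(2)[OF x] by simp
    show "stab X p M (h (x0, F)) = F"
      using stab_homeomorphic[OF covering_map_cover cov h x] stab_cover by simp
  qed
qed


section \<open>Manifolds are locally simple\<close>

lemma path_connectedin_convex_powertop:
  assumes conv: "\<And>x y u. x \<in> S \<Longrightarrow> y \<in> S \<Longrightarrow> 0 \<le> u \<Longrightarrow> u \<le> 1 \<Longrightarrow>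
      (\<lambda>i. (1 - u) * x i + u * y i) \<in> S"
  shows "path_connectedin (powertop_real UNIV) S"
  unfolding path_connectedin
proof (intro conjI ballI)
  fix x y assume xy: "x \<in> S" "y \<in> S"
  let ?g = "\<lambda>u i. (1 - u) * x i + u * y i"
  have "continuous_map (top_of_set {0..1}) (powertop_real UNIV) ?g"
    by (rule continuous_map_powertop_real_affine) (auto intro!: continuous_intros)
  then show "\<exists>g. pathin (powertop_real UNIV) g \<and> g \<in> {0..1} \<rightarrow> S \<and> g 0 = x \<and> g 1 = y"
    using conv xy by (intro exI[of _ ?g]) (auto simp: pathin_def)
qed auto

text \<open>A basic open box around \<open>v\<close> is shrunk to a box whose factors are
  convex.\<close>

lemma convex_neighbourhood_powertop:
  fixes v :: "nat \<Rightarrow> real"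
  assumes "openin (powertop_real UNIV) O1" "v \<in> O1"
  obtains C where "openin (powertop_real UNIV) C" "v \<in> C" "C \<subseteq> O1"
    "\<And>x y u. x \<in> C \<Longrightarrow> y \<in> C \<Longrightarrow> 0 \<le> u \<Longrightarrow> u \<le> 1 \<Longrightarrow> (\<lambda>i. (1 - u) * x i + u * y i) \<in> C"
proof -
  obtain B where B: "finite {i \<in> UNIV. B i \<noteq> (UNIV :: real set)}" "\<And>i. open (B i)" "v \<in> Pi\<^sub>E UNIV B" "Pi\<^sub>E UNIV B \<subseteq> O1"
    using assms unfolding openin_product_topology_alt by fastforce
  have "\<exists>e>0. ball (v i) e \<subseteq> B i" for i
    using B(2)[of i] B(3) by (auto simp: open_contains_ball)
  then obtain e where e: "\<And>i. e i > 0" "\<And>i. ball (v i) (e i) \<subseteq> B i" by metis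
  \<comment> \<open>Coordinates that the box leaves free stay free; shrinking all of them would
    destroy openness in the product topology.\<close>
  define D where "D i = (if B i = UNIV then UNIV else ball (v i) (e i))" for i
  have D: "D i \<subseteq> B i" "v i \<in> D i" "open (D i)" "convex (D i)" for i
    using e by (auto simp: D_def)
  have "finite {i. D i \<noteq> UNIV}"
    by (rule finite_subset[OF _ B(1)]) (auto simp: D_def)
  then have "openin (powertop_real UNIV) (Pi\<^sub>E UNIV D)"
    using D(3) by (auto simp: openin_PiE_gen)
  moreover have "(\<lambda>i. (1 - u) * x i + u * y i) \<in> Pi\<^sub>E UNIV D"
    if "x \<in> Pi\<^sub>E UNIV D" "y \<in> Pi\<^sub>E UNIV D" "0 \<le> u" "u \<le> 1" for x y u
  proof -
    have "(1 - u) * x i + u * y i \<in> D i" for i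
      using convexD[OF D(4), of "x i" i "y i" "1 - u" u] that by (auto simp: PiE_def Pi_iff)
    then show ?thesis unfolding PiE_def Pi_def extensional_def by blast
  qed
  moreover have "v \<in> Pi\<^sub>E UNIV D" using D(2) by auto
  moreover have "Pi\<^sub>E UNIV D \<subseteq> O1" by (rule subset_trans[OF PiE_mono B(4)]) (rule D(1))
  ultimately show thesis by (intro that[of "Pi\<^sub>E UNIV D"])
qed

text \<open>A convex neighbourhood in the space of sequences is intersected with the half-space
  \<open>Q\<close>, which is itself convex, and transported by the chart. Interior and boundary
  points are thus treated alike.\<close>

lemma manifold_locally_simple:
  assumes "manifold n M" shows "locally_simple M"
  unfolding locally_simple_def
proof (intro allI impI)
  fix W x assume W: "openin M W \<and> x \<in> W"
  then have x: "x \<in> topspace M" using openin_subset by blast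
  let ?P = "powertop_real (UNIV :: nat set)"
  define Q :: "(nat \<Rightarrow> real) set" where "Q = {v. (\<forall>i\<ge>n. v i = 0) \<and> 0 \<le> v 0}"
  have half: "Euclidean_half_space n = subtopology ?P Q"
    unfolding Euclidean_half_space_def Euclidean_space_def Q_def
    by (simp add: subtopology_subtopology Collect_conj_eq)
  have Qc: "(\<lambda>i. (1 - u) * a i + u * b i) \<in> Q" if "a \<in> Q" "b \<in> Q" "0 \<le> u" "u \<le> 1" for a b u
    using that by (auto simp: Q_def)
  obtain U0 V where U0: "openin M U0" "x \<in> U0" and V: "openin (Euclidean_half_space n) V"
    and "subtopology M U0 homeomorphic_space subtopology (Euclidean_half_space n) V"
    using assms x unfolding manifold_def by blast
  then obtain f g where fg: "homeomorphic_maps (subtopology M U0) (subtopology (Euclidean_half_space n) V) f g"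
    by (auto simp: homeomorphic_space_def)
  have VQ: "V \<subseteq> Q" using openin_subset[OF V] by (simp add: half)
  have subV: "subtopology (Euclidean_half_space n) V = subtopology ?P V"
    using VQ by (simp add: half subtopology_subtopology Int_absorb1)
  note fg = fg[unfolded subV]
  have U0M: "U0 \<subseteq> topspace M" using U0(1) openin_subset by blast
  have hf: "homeomorphic_map (subtopology M U0) (subtopology ?P V) f"
    and hg: "homeomorphic_map (subtopology ?P V) (subtopology M U0) g"
    using fg homeomorphic_maps_map by blast+
  have gf: "g (f z) = z" if "z \<in> U0" for z using fg that U0M by (auto simp: homeomorphic_maps_def)
  have fV: "f ` U0 = V" using homeomorphic_imp_surjective_map[OF hf] U0M by (simp add: Int_absorb1)
  have fgv: "f (g v) = v" if "v \<in> V" for v using fg that by (auto simp: homeomorphic_maps_def)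
  have "openin (subtopology M U0) (W \<inter> U0)"
    using W U0 by (simp add: openin_open_subtopology openin_Int)
  then have "openin (subtopology ?P V) (f ` (W \<inter> U0))"
    using homeomorphic_map_openness[OF hf, of "W \<inter> U0"] U0M by auto
  then have "openin (subtopology ?P Q) (f ` (W \<inter> U0))"
    using V openin_trans_full[of "subtopology ?P Q" V] by (simp add: half openin_open_subtopology flip: subV)
  \<comment> \<open>The chart image of \<open>W \<inter> U0\<close> is open in the half-space, hence
    the trace of an ambient open set. A convex \<open>C\<close> inside that set keeps
    \<open>C \<inter> Q\<close> within the chart image.\<close>
  then obtain O1 where O1: "openin ?P O1" "f ` (W \<inter> U0) = O1 \<inter> Q"
    by (auto simp: openin_subtopology)
  have fx: "f x \<in> O1" using O1(2) W U0 by blast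
  obtain C where C: "openin ?P C" "f x \<in> C" "C \<subseteq> O1"
    and Cc: "\<And>a b u. a \<in> C \<Longrightarrow> b \<in> C \<Longrightarrow> 0 \<le> u \<Longrightarrow> u \<le> 1 \<Longrightarrow> (\<lambda>i. (1 - u) * a i + u * b i) \<in> C"
    using convex_neighbourhood_powertop[OF O1(1) fx] by blast
  define D where "D = C \<inter> Q"
  have Dc: "(\<lambda>i. (1 - u) * a i + u * b i) \<in> D" if "a \<in> D" "b \<in> D" "0 \<le> u" "u \<le> 1" for a b u
    using that Cc Qc unfolding D_def by blast
  have DW: "D \<subseteq> f ` (W \<inter> U0)" using C(3) O1(2) by (auto simp: D_def)
  have DV: "D \<subseteq> V" using DW fV by blast
  have "D = C \<inter> V" using DV VQ by (auto simp: D_def)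
  then have "openin (subtopology ?P V) D" using C(1) by (auto simp: openin_subtopology)
  then have "openin (subtopology M U0) (g ` D)"
    using homeomorphic_map_openness[OF hg, of D] DV by simp
  then have "openin M (g ` D)" using U0(1) openin_open_subtopology by blast
  moreover have "x \<in> g ` D"
    using gf[OF U0(2)] C(2) O1(2) W U0 unfolding D_def by (metis IntI Int_iff image_eqI)
  moreover have gDW: "g ` D \<subseteq> W \<inter> U0"
  proof clarify
    fix v assume "v \<in> D"
    then obtain z where "z \<in> W \<inter> U0" "v = f z" using DW by blast
    then show "g v \<in> W \<inter> U0" using gf by simp
  qed
  moreover have "path_connectedin M (g ` D)"
  proof -
    have "path_connectedin ?P D" by (rule path_connectedin_convex_powertop) (rule Dc)
    then have "path_connectedin (subtopology ?P V) D"
      using DV unfolding path_connectedin_subtopology by blast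
    then have "path_connectedin (subtopology M U0) (g ` D)"
      using path_connectedin_continuous_map_image[OF homeomorphic_imp_continuous_map[OF hg]] by blast
    then show ?thesis by (simp add: path_connectedin_subtopology)
  qed
  moreover have "paths_homotopic (subtopology M (g ` D))"
  proof (rule paths_homotopic_homeomorphic[OF paths_homotopic_convex_powertop[OF Dc]])
    have "f ` g ` D = (\<lambda>v. v) ` D"
      unfolding image_image by (intro image_cong) (use fgv DV in auto)
    then have fgD: "f ` g ` D = D" by simp
    have eq: "topspace (subtopology M U0) \<inter> g ` D = g ` D" "topspace (subtopology ?P V) \<inter> D = D"
      using gDW U0M DV by auto
    have "homeomorphic_maps (subtopology (subtopology M U0) (g ` D)) (subtopology (subtopology ?P V) D) f g"
      by (rule homeomorphic_maps_subtopologies[OF fg]) (simp only: eq fgD)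
    then show "homeomorphic_maps (subtopology M (g ` D)) (subtopology ?P D) f g"
      using gDW DV by (simp add: subtopology_subtopology Int_absorb1)
  qed
  ultimately show "\<exists>U. openin M U \<and> x \<in> U \<and> U \<subseteq> W \<and> path_connectedin M U \<and> paths_homotopic (subtopology M U)"
    by (intro exI[of _ "g ` D"]) auto
qed


section \<open>Counting conjugacy classes of subgroups of finite index\<close>

context group
begin

definition index_subgroups :: "nat \<Rightarrow> 'a set set" where
  "index_subgroups n = {K. subgroup K G \<and> card (rcosets K) = n}"

text \<open>These cosets make up the quotient of the normalizer of \<open>K\<close> by
  \<open>K\<close>; selecting them among all cosets avoids forming the normalizer as a
  group.\<close>

definition normalizing_cosets :: "'a set \<Rightarrow> 'a set set" where
  "normalizing_cosets K = {C \<in> rcosets K. \<forall>a\<in>C. conjugate G K a = K}"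

lemma rcoset_eq_iff:
  assumes "subgroup K G" "a \<in> carrier G" "b \<in> carrier G"
  shows "K #> a = K #> b \<longleftrightarrow> a \<otimes> inv b \<in> K"
  using subgroup.rcos_module[OF assms(1) is_group assms(3,2)] repr_independence[OF _ assms(3,1)]
    rcos_self[OF assms(2,1)] by metis

lemma rcoset_act: "subgroup K G \<Longrightarrow> C \<in> rcosets K \<Longrightarrow> a \<in> carrier G \<Longrightarrow> C #> a \<in> rcosets K"
  using subgroup.subset[of K G] by (auto simp: RCOSETS_def coset_mult_assoc)

lemma right_action_rcosets:
  assumes K: "subgroup K G" shows "right_action G (rcosets K) (\<lambda>C a. C #> a)"
proof unfold_locales
  have sub: "C \<subseteq> carrier G" if "C \<in> rcosets K" for C
    using subgroup.rcosets_carrier[OF K is_group that] .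
  fix C a b assume C: "C \<in> rcosets K"
  show "C #> \<one> = C" using sub[OF C] by simp
  assume a: "a \<in> carrier G"
  then show "C #> a \<in> rcosets K" using rcoset_act[OF K C] by simp
  assume b: "b \<in> carrier G"
  then show "C #> (a \<otimes> b) = C #> a #> b" using sub[OF C] a by (simp add: coset_mult_assoc)
qed

text \<open>\<open>K\<close>, as a coset, has stabilizer \<open>K\<close>, and stabilizers are
  conjugated along the action. Conjugates and normalizing cosets thereby become values and fibres of
  one map on the cosets.\<close>

lemma rcosets_stabilizer:
  assumes K: "subgroup K G" and a: "a \<in> carrier G"
  shows "right_action.stabilizer G (\<lambda>C a. C #> a) (K #> a) = conjugate G K a"
proof -
  interpret A: right_action G "rcosets K" "\<lambda>C a. C #> a" by (rule right_action_rcosets[OF K])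
  have "A.stabilizer K = K"
    unfolding A.stabilizer_def using coset_join1[OF _ _ K] coset_join2[OF _ K] subgroup.subset[OF K] by auto
  then show ?thesis using A.stabilizer_act[OF subgroup.subgroup_in_rcosets[OF K is_group] a] by simp
qed

lemma rcosets_transitive:
  assumes K: "subgroup K G" and C: "C \<in> rcosets K" and D: "D \<in> rcosets K"
  shows "\<exists>a\<in>carrier G. D = C #> a"
proof -
  obtain b c where b: "b \<in> carrier G" "C = K #> b" and c: "c \<in> carrier G" "D = K #> c"
    using C D by (auto simp: RCOSETS_def)
  have "C #> (inv b \<otimes> c) = K #> (b \<otimes> (inv b \<otimes> c))"
    using b c subgroup.subset[OF K] by (simp add: coset_mult_assoc)
  also have "b \<otimes> (inv b \<otimes> c) = c" using b c by (simp flip: m_assoc)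
  finally show ?thesis using b c by (intro bexI[of _ "inv b \<otimes> c"]) auto
qed

text \<open>A conjugate of \<open>K\<close> is the stabilizer of a coset of \<open>K\<close>, so by
  transitivity its index is again the number of cosets of \<open>K\<close>.\<close>

lemma conjugate_index_subgroups:
  assumes K: "K \<in> index_subgroups n" and a: "a \<in> carrier G"
  shows "conjugate G K a \<in> index_subgroups n"
proof -
  have sub: "subgroup K G" using K by (simp add: index_subgroups_def)
  interpret A: right_action G "rcosets K" "\<lambda>C a. C #> a" by (rule right_action_rcosets[OF sub])
  have Ka: "K #> a \<in> rcosets K" using rcosetsI[OF subgroup.subset[OF sub] a] .
  show ?thesis
    using A.subgroup_stabilizer[OF Ka] A.index_stabilizer[OF Ka rcosets_transitive[OF sub Ka]] K
    by (simp add: rcosets_stabilizer[OF sub a] index_subgroups_def)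
qed

lemma right_action_conjugate: "right_action G (index_subgroups n) (conjugate G)"
proof unfold_locales
  fix K a b assume K: "K \<in> index_subgroups n"
  then have sub: "subgroup K G" "K \<subseteq> carrier G"
    by (auto simp: index_subgroups_def dest: subgroup.subset)
  show "conjugate G K \<one> = K" using sub(2) by (force simp: conjugate_def)
  assume a: "a \<in> carrier G"
  then show "conjugate G K a \<in> index_subgroups n" using conjugate_index_subgroups[OF K] by simp
  assume b: "b \<in> carrier G"
  show "conjugate G K (a \<otimes> b) = conjugate G (conjugate G K a) b"
    unfolding conjugate_def image_image using a b sub(2)
    by (intro image_cong) (auto simp: m_assoc inv_mult_group)
qed

lemma conjugate_normalizing_coset:
  assumes K: "subgroup K G" and C: "C \<in> rcosets K"
  shows "C \<in> normalizing_cosets K \<longleftrightarrow> right_action.stabilizer G (\<lambda>C a. C #> a) C = K"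
proof -
  have "conjugate G K a = right_action.stabilizer G (\<lambda>C a. C #> a) C" if "a \<in> C" for a
  proof -
    have "a \<in> carrier G" using subgroup.rcosets_carrier[OF K is_group C] that by blast
    moreover have "C = K #> a" using C that repr_independence[OF _ _ K] by (auto simp: RCOSETS_def)
    ultimately show ?thesis using rcosets_stabilizer[OF K] by simp
  qed
  moreover have "C \<noteq> {}" using subgroup.rcosets_non_empty[OF K C] .
  ultimately show ?thesis using C by (auto simp: normalizing_cosets_def)
qed

text \<open>The map sending a coset of \<open>K\<close> to its stabilizer has the conjugates of
  \<open>K\<close> as values. Its fibre over \<open>K\<close> is
  \<open>normalizing_cosets K\<close>, and right multiplication by \<open>a\<close> carries this
  fibre to the one over the conjugate by \<open>a\<close>; so the \<open>n\<close> cosets split into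
  fibres of equal size.\<close>

lemma card_conjugates_times_normalizing_cosets:
  assumes K: "K \<in> index_subgroups n" and n: "n \<ge> 1"
  shows "card (conjugate G K ` carrier G) * card (normalizing_cosets K) = n"
proof -
  have sub: "subgroup K G" and cK: "card (rcosets K) = n" using K by (auto simp: index_subgroups_def)
  interpret A: right_action G "rcosets K" "\<lambda>C a. C #> a" by (rule right_action_rcosets[OF sub])
  have fin: "finite (rcosets K)" using cK n card_ge_0_finite by force
  have K0: "K \<in> rcosets K" using subgroup.subgroup_in_rcosets[OF sub is_group] .
  have orb: "A.stabilizer ` (rcosets K) = conjugate G K ` carrier G"
    unfolding RCOSETS_def using rcosets_stabilizer[OF sub] by force
  have N: "normalizing_cosets K = {C \<in> rcosets K. A.stabilizer C = K}"
    using conjugate_normalizing_coset[OF sub] by (auto simp: normalizing_cosets_def)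
  have fibre: "card {C \<in> rcosets K. A.stabilizer C = L} = card (normalizing_cosets K)"
    if "L \<in> A.stabilizer ` (rcosets K)" for L
  proof -
    obtain D where D: "D \<in> rcosets K" "L = A.stabilizer D" using \<open>L \<in> _\<close> by blast
    obtain a where a: "a \<in> carrier G" "D = K #> a" using D(1) by (auto simp: RCOSETS_def)
    have L: "L = conjugate G K a" using D(2) a rcosets_stabilizer[OF sub] by simp
    have "bij_betw (\<lambda>C. C #> a) (normalizing_cosets K) {C \<in> rcosets K. A.stabilizer C = L}"
    proof (rule bij_betwI[where g="\<lambda>C. C #> inv a"])
      show "(\<lambda>C. C #> a) \<in> normalizing_cosets K \<rightarrow> {C \<in> rcosets K. A.stabilizer C = L}"
        using a A.stabilizer_act A.act_closed by (auto simp: N L)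
      have "conjugate G L (inv a) = K"
        using right_action.act_inv[OF right_action_conjugate K a(1)] L by simp
      then show "(\<lambda>C. C #> inv a) \<in> {C \<in> rcosets K. A.stabilizer C = L} \<rightarrow> normalizing_cosets K"
        using a A.stabilizer_act[of _ "inv a"] A.act_closed[of _ "inv a"] by (auto simp: N)
      show "C #> a #> inv a = C" if "C \<in> normalizing_cosets K" for C
        using that a A.act_inv by (auto simp: N)
      show "C #> inv a #> a = C" if "C \<in> {C \<in> rcosets K. A.stabilizer C = L}" for C
        using that a A.act_inv[of C "inv a"] by auto
    qed
    then show ?thesis by (simp add: bij_betw_same_card)
  qed
  have "n = (\<Sum>C\<in>rcosets K. 1)" using cK by simp
  also have "\<dots> = (\<Sum>L\<in>A.stabilizer ` (rcosets K). \<Sum>C | C \<in> rcosets K \<and> A.stabilizer C = L. 1)"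
    by (rule sum.image_gen[OF fin])
  also have "\<dots> = (\<Sum>L\<in>A.stabilizer ` (rcosets K). card (normalizing_cosets K))"
    using fibre by (intro sum.cong) auto
  finally show ?thesis by (simp add: orb)
qed

text \<open>Each conjugacy class contributes \<open>n\<close>: every member has \<open>n\<close>
  divided by the size of the class many normalizing cosets.\<close>

lemma sum_normalizing_cosets:
  assumes fin: "finite (index_subgroups n)" and n: "n \<ge> 1"
  shows "(\<Sum>K\<in>index_subgroups n. card (normalizing_cosets K)) =
    n * card ((\<lambda>K. conjugate G K ` carrier G) ` index_subgroups n)"
proof -
  interpret A: right_action G "index_subgroups n" "conjugate G" by (rule right_action_conjugate)
  let ?O = "\<lambda>K. conjugate G K ` carrier G"
  have self: "K \<in> ?O K" if "K \<in> index_subgroups n" for K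
    using A.act_one[OF that] by (metis image_eqI one_closed)
  have orb: "?O (conjugate G K a) = ?O K" if K: "K \<in> index_subgroups n" and a: "a \<in> carrier G" for K a
  proof -
    have le: "?O (conjugate G K a) \<subseteq> ?O K" if "K \<in> index_subgroups n" "a \<in> carrier G" for K a
    proof clarify
      fix b assume b: "b \<in> carrier G"
      have "conjugate G (conjugate G K a) b = conjugate G K (a \<otimes> b)" using A.act_mult[OF that b] by simp
      then show "conjugate G (conjugate G K a) b \<in> ?O K" using that(2) b by simp
    qed
    from le[of "conjugate G K a" "inv a"] show ?thesis
      using le[OF K a] A.act_inv[OF K a] A.act_closed[OF K a] a by auto
  qed
  have fibre: "{L \<in> index_subgroups n. ?O L = ?O K} = ?O K" if K: "K \<in> index_subgroups n" for K
  proof (intro equalityI subsetI)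
    fix L assume "L \<in> {L \<in> index_subgroups n. ?O L = ?O K}"
    then have "L \<in> index_subgroups n" "?O L = ?O K" by auto
    then show "L \<in> ?O K" using self[of L] by simp
  next
    fix L assume "L \<in> ?O K"
    then obtain a where "a \<in> carrier G" "L = conjugate G K a" by blast
    then show "L \<in> {L \<in> index_subgroups n. ?O L = ?O K}" using orb[OF K] A.act_closed[OF K] by simp
  qed
  have "(\<Sum>L | L \<in> index_subgroups n \<and> ?O L = X. card (normalizing_cosets L)) = n"
    if X: "X \<in> ?O ` index_subgroups n" for X
  proof -
    obtain K where K: "K \<in> index_subgroups n" "X = ?O K" using X by blast
    have "card (normalizing_cosets L) = card (normalizing_cosets K)" if "L \<in> ?O K" for L
    proof -
      have L: "L \<in> index_subgroups n" "?O L = ?O K" using that fibre[OF K(1)] by blast+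
      have "card (?O K) * card (normalizing_cosets L) = card (?O K) * card (normalizing_cosets K)"
        using card_conjugates_times_normalizing_cosets[OF L(1) n]
          card_conjugates_times_normalizing_cosets[OF K(1) n] L(2) by simp
      moreover have "card (?O K) \<noteq> 0"
        using card_conjugates_times_normalizing_cosets[OF K(1) n] n by (metis mult_is_0 not_one_le_zero)
      ultimately show ?thesis by simp
    qed
    then have "(\<Sum>L\<in>?O K. card (normalizing_cosets L)) = card (?O K) * card (normalizing_cosets K)"
      by simp
    then show ?thesis
      unfolding K(2) using fibre[OF K(1)] card_conjugates_times_normalizing_cosets[OF K(1) n] by simp
  qed
  then show ?thesis
    by (subst sum.image_gen[OF fin, of _ ?O]) simp
qed

text \<open>A subgroup of index \<open>n\<close> is the stabilizer of \<open>0\<close> in a permutation action on \<open>n\<close> points, and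
  such an action is determined by the generators.\<close>

lemma finite_index_subgroups:
  assumes "finitely_generated_group G" and n: "n \<ge> 1"
  shows "finite (index_subgroups n)"
proof -
  obtain S where S: "finite S" "S \<subseteq> carrier G" "generate G S = carrier G"
    using assms(1) by (auto simp: finitely_generated_group_def)
  have "\<exists>e. bij_betw e (rcosets K) {0..<n} \<and> e K = 0" if K: "K \<in> index_subgroups n" for K
  proof -
    have sub: "subgroup K G" "card (rcosets K) = n" using K by (auto simp: index_subgroups_def)
    then have fin: "finite (rcosets K)" using n card_ge_0_finite by force
    have K0: "K \<in> rcosets K" using subgroup.subgroup_in_rcosets[OF sub(1) is_group] .
    obtain e where e: "bij_betw e (rcosets K) {0..<n}"
      using ex_bij_betw_finite_nat[OF fin] sub by blast
    have eK: "e K \<in> {0..<n}" using e K0 by (auto simp: bij_betw_def)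
    \<comment> \<open>A labelling of the cosets is corrected by a transposition so that
      \<open>K\<close> gets the label 0; then \<open>K\<close> can be read off as the stabilizer of
      0.\<close>
    have "bij_betw (Transposition.transpose 0 (e K)) {0..<n} {0..<n}"
      using eK n by (intro bij_betwI[where g="Transposition.transpose 0 (e K)"])
        (auto simp: Transposition.transpose_def)
    then have "bij_betw (Transposition.transpose 0 (e K) \<circ> e) (rcosets K) {0..<n}"
      using e by (rule bij_betw_trans[rotated])
    then show ?thesis by (intro exI[of _ "Transposition.transpose 0 (e K) \<circ> e"]) auto
  qed
  then obtain e where e: "\<And>K. K \<in> index_subgroups n \<Longrightarrow> bij_betw (e K) (rcosets K) {0..<n} \<and> e K K = 0"
    by metis
  \<comment> \<open>The action on labels, recorded for the generators only. Restricting the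
    functions to \<open>S\<close> and \<open>{0..<n}\<close> makes them range over a finite
    set.\<close>
  define \<Phi> where "\<Phi> K = (\<lambda>s\<in>S. \<lambda>i\<in>{0..<n}. e K (inv_into (rcosets K) (e K) i #> s))" for K
  have gen: "e K (C #> s) = \<Phi> K s (e K C)" if "K \<in> index_subgroups n" "C \<in> rcosets K" "s \<in> S" for K C s
    using e[OF that(1)] that(2,3) bij_betw_inv_into_left[of "e K" "rcosets K" "{0..<n}" C]
    by (auto simp: \<Phi>_def bij_betw_def)
  have inj: "inj_on \<Phi> (index_subgroups n)"
  proof (rule inj_onI)
    fix K L assume K: "K \<in> index_subgroups n" and L: "L \<in> index_subgroups n" and eq: "\<Phi> K = \<Phi> L"
    have sub: "subgroup K G" "subgroup L G" using K L by (auto simp: index_subgroups_def)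
    note KL = subgroup.subset[OF sub(1)] subgroup.subset[OF sub(2)]
    \<comment> \<open>Equal actions of the generators propagate along words: cosets of
      \<open>K\<close> and of \<open>L\<close> with equal labels keep equal labels under every
      element.\<close>
    have step: "\<forall>C\<in>rcosets K. \<forall>D\<in>rcosets L. e K C = e L D \<longrightarrow> e K (C #> g) = e L (D #> g)"
      if "g \<in> generate G S" for g
      using that
    proof (induction rule: generate.induct)
      case one
      then show ?case
        using subgroup.rcosets_carrier[OF sub(1) is_group] subgroup.rcosets_carrier[OF sub(2) is_group] by simp
    next
      case (incl s)
      then show ?case using gen[OF K] gen[OF L] eq by simp
    next
      case (inv s)
      then have s: "s \<in> carrier G" using S(2) by blast
      show ?case
      proof (intro ballI impI)
        fix C D assume CD: "C \<in> rcosets K" "D \<in> rcosets L" "e K C = e L D"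
        interpret A: right_action G "rcosets K" "\<lambda>C a. C #> a" by (rule right_action_rcosets[OF sub(1)])
        interpret B: right_action G "rcosets L" "\<lambda>C a. C #> a" by (rule right_action_rcosets[OF sub(2)])
        have C': "C #> inv s \<in> rcosets K" and D': "D #> inv s \<in> rcosets L"
          using A.act_closed B.act_closed CD s by auto
        \<comment> \<open>For an inverse generator, take the coset \<open>D2\<close> of
          \<open>L\<close> with the label of \<open>C #> inv s\<close>; it is carried by
          \<open>s\<close> to a coset with the label of \<open>D\<close>, hence to
          \<open>D\<close>.\<close>
        obtain D2 where D2: "D2 \<in> rcosets L" "e L D2 = e K (C #> inv s)"
          using e[OF K] e[OF L] C' unfolding bij_betw_def by (metis image_iff)
        have "e L (D2 #> s) = e K (C #> inv s #> s)"
          using gen[OF K C' inv] gen[OF L D2(1) inv] eq D2(2) by simp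
        also have "C #> inv s #> s = C" using A.act_inv[OF CD(1), of "inv s"] s by simp
        finally have "e L (D2 #> s) = e L D" using CD(3) by simp
        then have "D2 #> s = D"
          using e[OF L] CD(2) B.act_closed[OF D2(1) s] unfolding bij_betw_def by (metis inj_onD)
        then have "D #> inv s = D2" using B.act_inv[OF D2(1) s] by simp
        then show "e K (C #> inv s) = e L (D #> inv s)" using D2(2) by simp
      qed
    next
      case (eng g h)
      have gh: "g \<in> carrier G" "h \<in> carrier G" using eng(1,2) S(3) by auto
      interpret A: right_action G "rcosets K" "\<lambda>C a. C #> a" by (rule right_action_rcosets[OF sub(1)])
      interpret B: right_action G "rcosets L" "\<lambda>C a. C #> a" by (rule right_action_rcosets[OF sub(2)])
      show ?case
        using eng(3,4) gh A.act_mult B.act_mult A.act_closed B.act_closed by simp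
    qed
    have "g \<in> K \<longleftrightarrow> g \<in> L" if g: "g \<in> carrier G" for g
    proof -
      have K0: "K \<in> rcosets K" "L \<in> rcosets L" using subgroup.subgroup_in_rcosets[OF _ is_group] sub by auto
      have *: "g \<in> M \<longleftrightarrow> e M (M #> g) = 0" if M: "M \<in> index_subgroups n" for M
      proof -
        have Ms: "subgroup M G" using M by (simp add: index_subgroups_def)
        have "g \<in> M \<longleftrightarrow> M #> g = M"
          using coset_join1[OF _ g Ms] coset_join2[OF g Ms] by blast
        also have "\<dots> \<longleftrightarrow> e M (M #> g) = e M M"
          using e[OF M] rcosetsI[OF subgroup.subset[OF Ms] g] subgroup.subgroup_in_rcosets[OF Ms is_group]
          unfolding bij_betw_def by (metis inj_onD)
        finally show ?thesis using e[OF M] by simp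
      qed
      have "e K (K #> g) = e L (L #> g)" using step[of g] K0 e[OF K] e[OF L] g S(3) by auto
      then show ?thesis using *[OF K] *[OF L] by simp
    qed
    then show "K = L" using KL by blast
  qed
  have "\<Phi> ` index_subgroups n \<subseteq> (S \<rightarrow>\<^sub>E ({0..<n} \<rightarrow>\<^sub>E {0..<n}))"
  proof clarify
    fix K assume K: "K \<in> index_subgroups n"
    have sub: "subgroup K G" using K by (simp add: index_subgroups_def)
    have "e K (inv_into (rcosets K) (e K) i #> s) \<in> {0..<n}" if "s \<in> S" "i \<in> {0..<n}" for s i
    proof -
      have "inv_into (rcosets K) (e K) i \<in> rcosets K"
        using e[OF K] that(2) by (auto simp: bij_betw_def intro!: inv_into_into)
      then have "inv_into (rcosets K) (e K) i #> s \<in> rcosets K"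
        using rcoset_act[OF sub] that(1) S(2) by blast
      then show ?thesis using e[OF K] by (auto simp: bij_betw_def)
    qed
    then show "\<Phi> K \<in> (S \<rightarrow>\<^sub>E ({0..<n} \<rightarrow>\<^sub>E {0..<n}))" by (auto simp: \<Phi>_def)
  qed
  moreover have "finite (S \<rightarrow>\<^sub>E ({0..<n} \<rightarrow>\<^sub>E {0..<n}))" using S(1) by (intro finite_PiE) auto
  ultimately show ?thesis using inj finite_imageD finite_subset by blast
qed

text \<open>With a representative \<open>r D\<close> chosen in each coset \<open>D\<close> of
  \<open>F\<close>, every coset of \<open>K\<close> is uniquely \<open>C #> r D\<close> with
  \<open>C\<close> a coset of \<open>K\<close> inside \<open>F\<close>. Counting the cosets inside
  \<open>F\<close> expresses the index of \<open>K\<close> in \<open>F\<close> without changing the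
  ambient group.\<close>

lemma index_subgroups_mult:
  assumes K: "subgroup K G" and F: "subgroup F G" and KF: "K \<subseteq> F"
  shows "card (rcosets K) = card (rcosets F) * card {C \<in> rcosets K. C \<subseteq> F}"
proof -
  define r where "r D = (SOME d. d \<in> D)" for D :: "'a set"
  have r: "r D \<in> D" "r D \<in> carrier G" "D = F #> r D" if D: "D \<in> rcosets F" for D
  proof -
    show rD: "r D \<in> D" unfolding r_def using subgroup.rcosets_non_empty[OF F D] by (simp add: some_in_eq)
    then show rc: "r D \<in> carrier G" using subgroup.rcosets_carrier[OF F is_group D] by blast
    show "D = F #> r D" using D rD repr_independence[OF _ _ F] by (auto simp: RCOSETS_def)
  qed
  have sub: "K \<subseteq> carrier G" "F \<subseteq> carrier G" using K F subgroup.subset by auto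
  let ?A = "{C \<in> rcosets K. C \<subseteq> F}"
  have KfF: "K #> f \<subseteq> F" if "f \<in> F" for f
    using that KF subgroup.m_closed[OF F] by (auto simp: r_coset_def)
  have "bij_betw (\<lambda>(D, C). C #> r D) ((rcosets F) \<times> ?A) (rcosets K)"
  proof (rule bij_betw_imageI)
    show "inj_on (\<lambda>(D, C). C #> r D) ((rcosets F) \<times> ?A)"
    proof (rule inj_onI, clarify)
      fix D C D' C' assume D: "D \<in> rcosets F" "D' \<in> rcosets F" and C: "C \<in> rcosets K" "C \<subseteq> F" "C' \<in> rcosets K" "C' \<subseteq> F"
        and eq: "C #> r D = C' #> r D'"
      obtain c where c: "c \<in> C" using subgroup.rcosets_non_empty[OF K C(1)] by blast
      then have "c \<otimes> r D \<in> C' #> r D'" using eq by (auto simp: r_coset_def)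
      then obtain c' where c': "c' \<in> C'" "c \<otimes> r D = c' \<otimes> r D'" by (auto simp: r_coset_def)
      have "c \<in> F" "c' \<in> F" using c c' C by auto
      then have "F #> (c \<otimes> r D) = F #> r D" "F #> (c' \<otimes> r D') = F #> r D'"
        using r[OF D(1)] r[OF D(2)] sub coset_mult_assoc[of F c "r D"] coset_mult_assoc[of F c' "r D'"]
          coset_join2[OF _ F] by auto
      then have DD: "D = D'" using c'(2) r[OF D(1)] r[OF D(2)] by simp
      interpret A: right_action G "rcosets K" "\<lambda>C a. C #> a" by (rule right_action_rcosets[OF K])
      have "C = C'" using eq DD A.act_inv[OF C(1) r(2)[OF D(1)]] A.act_inv[OF C(3) r(2)[OF D(1)]] by simp
      with DD show "D = D' \<and> C = C'" ..
    qed
    show "(\<lambda>(D, C). C #> r D) ` ((rcosets F) \<times> ?A) = rcosets K"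
    proof
      show "(\<lambda>(D, C). C #> r D) ` ((rcosets F) \<times> ?A) \<subseteq> rcosets K"
        using r(2) rcoset_act[OF K] by auto
      show "rcosets K \<subseteq> (\<lambda>(D, C). C #> r D) ` ((rcosets F) \<times> ?A)"
      proof
        fix E assume "E \<in> rcosets K"
        then obtain a where a: "a \<in> carrier G" "E = K #> a" by (auto simp: RCOSETS_def)
        let ?D = "F #> a"
        have D: "?D \<in> rcosets F" using rcosetsI[OF sub(2) a(1)] .
        have "a \<otimes> inv (r ?D) \<in> F" using r(3)[OF D] rcoset_eq_iff[OF F a(1) r(2)[OF D]] by simp
        then have "K #> (a \<otimes> inv (r ?D)) \<in> ?A"
          using KfF rcosetsI[OF sub(1)] a r(2)[OF D] by auto
        moreover have "K #> (a \<otimes> inv (r ?D)) #> r ?D = E"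
          using a r(2)[OF D] sub by (simp add: coset_mult_assoc m_assoc)
        ultimately show "E \<in> (\<lambda>(D, C). C #> r D) ` ((rcosets F) \<times> ?A)"
          using D by (intro image_eqI[where x="(?D, K #> (a \<otimes> inv (r ?D)))"]) auto
      qed
    qed
  qed
  from bij_betw_same_card[OF this] show ?thesis by (simp add: card_cartesian_product)
qed

end


section \<open>Cosets in the normalizer as epimorphisms to cyclic groups\<close>

text \<open>For \<open>l \<ge> 1\<close> the set \<open>{0..<int l}\<close> is the carrier of
  \<open>integer_mod_group l\<close>, so the last condition is surjectivity. The functions are
  extensional, as in \<open>num_hom\<close>, to make the count meaningful.\<close>

definition epis :: "('a, 'b) monoid_scheme \<Rightarrow> nat \<Rightarrow> ('a \<Rightarrow> int) set" where
  "epis A l = {\<phi> \<in> hom A (integer_mod_group l) \<inter> extensional (carrier A). \<phi> ` carrier A = {0..<int l}}"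

context group
begin

lemma epis_subgroupD:
  assumes F: "subgroup F G" and l: "l \<ge> 1" and \<phi>: "\<phi> \<in> epis (G\<lparr>carrier := F\<rparr>) l"
  shows "\<And>x y. x \<in> F \<Longrightarrow> y \<in> F \<Longrightarrow> \<phi> (x \<otimes> y) = (\<phi> x + \<phi> y) mod int l"
    and "\<And>x. x \<in> F \<Longrightarrow> 0 \<le> \<phi> x \<and> \<phi> x < int l"
    and "\<And>j. 0 \<le> j \<Longrightarrow> j < int l \<Longrightarrow> \<exists>x\<in>F. \<phi> x = j"
    and "\<And>x i. x \<in> F \<Longrightarrow> \<phi> (x [^] (i::int)) = (i * \<phi> x) mod int l"
    and "\<And>x. x \<in> F \<Longrightarrow> \<phi> (inv x) = (- \<phi> x) mod int l"
    and "\<phi> \<in> extensional F"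
    and "\<phi> \<one> = 0"
proof -
  let ?F = "G\<lparr>carrier := F\<rparr>" and ?Z = "integer_mod_group l"
  have h: "\<phi> \<in> hom ?F ?Z" "\<phi> ` F = {0..<int l}" and ext: "\<phi> \<in> extensional F"
    using \<phi> by (auto simp: epis_def)
  show "\<phi> \<in> extensional F" by (rule ext)
  interpret h: group_hom ?F ?Z \<phi>
    by (intro group_hom.intro group_hom_axioms.intro subgroup_imp_group[OF F] group_integer_mod_group h(1))
  show "\<phi> (x \<otimes> y) = (\<phi> x + \<phi> y) mod int l" if "x \<in> F" "y \<in> F" for x y
    using h.hom_mult[of x y] that by simp
  show "0 \<le> \<phi> x \<and> \<phi> x < int l" if "x \<in> F" for x using h(2) that by auto
  show "\<exists>x\<in>F. \<phi> x = j" if "0 \<le> j" "j < int l" for j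
  proof -
    have "j \<in> \<phi> ` F" using that h(2) by simp
    then show ?thesis by auto
  qed
  show "\<phi> (x [^] (i::int)) = (i * \<phi> x) mod int l" if "x \<in> F" for x i
    using h.hom_int_pow[of x i] that int_pow_consistent[OF F that, of i] by (simp add: int_pow_integer_mod_group)
  show "\<phi> (inv x) = (- \<phi> x) mod int l" if "x \<in> F" for x
    using h.hom_inv[of x] h.hom_closed[of x] that F by simp
  show "\<phi> \<one> = 0" using h.hom_one by simp
qed

text \<open>The kernel and the preimage of the generator. Writing \<open>1 mod int l\<close> covers
  \<open>l = 1\<close>, where the generator is 0 and both components are \<open>F\<close>.\<close>

definition epi_pair :: "nat \<Rightarrow> 'a set \<Rightarrow> ('a \<Rightarrow> int) \<Rightarrow> 'a set \<times> 'a set" where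
  "epi_pair l F \<phi> = ({x \<in> F. \<phi> x = 0}, {x \<in> F. \<phi> x = 1 mod int l})"

text \<open>The fibres of \<open>\<phi>\<close> are the cosets of its kernel inside
  \<open>F\<close>, so there are \<open>l\<close> of them and the kernel has index
  \<open>l * m\<close>. All of \<open>F\<close> normalizes the kernel, in particular the fibre over
  the generator.\<close>

lemma epi_pair_in:
  assumes F: "F \<in> index_subgroups m" and l: "l \<ge> 1" and \<phi>: "\<phi> \<in> epis (G\<lparr>carrier := F\<rparr>) l"
  shows "epi_pair l F \<phi> \<in> Sigma (index_subgroups (l * m)) normalizing_cosets"
proof -
  have Fs: "subgroup F G" "card (rcosets F) = m" using F by (auto simp: index_subgroups_def)
  note e = epis_subgroupD[OF Fs(1) l \<phi>]
  note Fc = subgroup.m_closed[OF Fs(1)] subgroup.m_inv_closed[OF Fs(1)] subgroup.one_closed[OF Fs(1)]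
  have FG: "x \<in> carrier G" if "x \<in> F" for x using subgroup.subset[OF Fs(1)] that by blast
  define K where "K = {x \<in> F. \<phi> x = 0}"
  have K: "subgroup K G"
  proof (rule subgroupI)
    show "K \<subseteq> carrier G" using FG by (auto simp: K_def)
    show "K \<noteq> {}" using Fc(3) e(7) by (auto simp: K_def)
    show "inv a \<in> K" if "a \<in> K" for a using that Fc e(5) by (auto simp: K_def)
    show "a \<otimes> b \<in> K" if "a \<in> K" "b \<in> K" for a b using that Fc e(1) by (auto simp: K_def)
  qed
  have fib: "{x \<in> F. \<phi> x = \<phi> a} = K #> a" if a: "a \<in> F" for a
  proof (intro equalityI subsetI)
    fix x assume x: "x \<in> {x \<in> F. \<phi> x = \<phi> a}"
    then have "x \<otimes> inv a \<in> K" using a Fc e(1)[of x "inv a"] e(5)[OF a]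
      by (simp add: K_def mod_add_right_eq)
    moreover have "x = x \<otimes> inv a \<otimes> a" using x a FG by (simp add: m_assoc)
    ultimately show "x \<in> K #> a" unfolding r_coset_def by blast
  next
    fix x assume "x \<in> K #> a"
    then obtain k where k: "k \<in> K" "x = k \<otimes> a" by (auto simp: r_coset_def)
    then show "x \<in> {x \<in> F. \<phi> x = \<phi> a}" using a Fc e(1)[of k a] e(2)[OF a] by (simp add: K_def)
  qed
  have "bij_betw (\<lambda>j. {x \<in> F. \<phi> x = j}) {0..<int l} {C \<in> rcosets K. C \<subseteq> F}"
  proof (rule bij_betw_imageI)
    show "inj_on (\<lambda>j. {x \<in> F. \<phi> x = j}) {0..<int l}"
    proof (rule inj_onI)
      fix i j assume "i \<in> {0..<int l}" and eq: "{x \<in> F. \<phi> x = i} = {x \<in> F. \<phi> x = j}"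
      then obtain x where "x \<in> F" "\<phi> x = i" using e(3)[of i] by auto
      then show "i = j" using eq by blast
    qed
    show "(\<lambda>j. {x \<in> F. \<phi> x = j}) ` {0..<int l} = {C \<in> rcosets K. C \<subseteq> F}"
    proof (intro equalityI subsetI)
      fix C assume "C \<in> (\<lambda>j. {x \<in> F. \<phi> x = j}) ` {0..<int l}"
      then obtain j where j: "j \<in> {0..<int l}" "C = {x \<in> F. \<phi> x = j}" by blast
      then obtain a where a: "a \<in> F" "\<phi> a = j" using e(3)[of j] by auto
      then have "C = K #> a" using j(2) fib[OF a(1)] a(2) by simp
      then show "C \<in> {C \<in> rcosets K. C \<subseteq> F}"
        using j rcosetsI[OF subgroup.subset[OF K] FG[OF a(1)]] by auto
    next
      fix C assume C: "C \<in> {C \<in> rcosets K. C \<subseteq> F}"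
      then obtain a where a: "a \<in> carrier G" "C = K #> a" by (auto simp: RCOSETS_def)
      then have "a \<in> F" using C rcos_self[OF a(1) K] by blast
      then show "C \<in> (\<lambda>j. {x \<in> F. \<phi> x = j}) ` {0..<int l}"
        using fib e(2) a by (intro image_eqI[where x="\<phi> a"]) auto
    qed
  qed
  then have "card {C \<in> rcosets K. C \<subseteq> F} = l" using bij_betw_same_card by fastforce
  then have "card (rcosets K) = l * m"
    using index_subgroups_mult[OF K Fs(1)] Fs(2) by (auto simp: K_def)
  moreover have "{x \<in> F. \<phi> x = 1 mod int l} \<in> normalizing_cosets K"
    unfolding normalizing_cosets_def
  proof (intro CollectI conjI ballI)
    have "\<exists>a\<in>F. \<phi> a = 1 mod int l" using e(3)[of "1 mod int l"] l by simp
    then obtain a where a: "a \<in> F" "\<phi> a = 1 mod int l" by blast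
    then show "{x \<in> F. \<phi> x = 1 mod int l} \<in> rcosets K"
      using fib[OF a(1)] rcosetsI[OF subgroup.subset[OF K] FG[OF a(1)]] by simp
    fix b assume "b \<in> {x \<in> F. \<phi> x = 1 mod int l}"
    then have b: "b \<in> F" by blast
    have sub: "inv c \<otimes> k \<otimes> c \<in> K" if "k \<in> K" "c \<in> F" for k c
      using that Fc e(1,5) by (simp add: K_def mod_add_left_eq mod_add_right_eq)
    show "conjugate G K b = K"
    proof
      show "conjugate G K b \<subseteq> K" unfolding conjugate_def using sub b by blast
      show "K \<subseteq> conjugate G K b"
      proof
        fix k assume k: "k \<in> K"
        then have kF: "k \<in> F" by (simp add: K_def)
        have "inv (inv b) \<otimes> k \<otimes> inv b \<in> K" using sub[OF k Fc(2)[OF b]] .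
        moreover have "k = inv b \<otimes> (inv (inv b) \<otimes> k \<otimes> inv b) \<otimes> b"
          using FG[OF b] FG[OF kF] by (simp add: m_assoc) (simp flip: m_assoc)
        ultimately show "k \<in> conjugate G K b" unfolding conjugate_def by (rule image_eqI[rotated])
      qed
    qed
  qed
  ultimately show ?thesis using K by (simp add: epi_pair_def K_def index_subgroups_def)
qed

text \<open>For \<open>a\<close> in the second component every \<open>x\<close> in \<open>F\<close>
  is \<open>k \<otimes> a [^] \<phi> x\<close> with \<open>k\<close> in the common kernel, so
  \<open>x\<close> lies in \<open>F'\<close> and \<open>\<phi>'\<close> agrees with
  \<open>\<phi>\<close> modulo \<open>l'\<close>. As \<open>a [^] int l\<close> lies in the kernel,
  \<open>l'\<close> divides \<open>l\<close>. The auxiliary fact \<open>main\<close> is this half,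
  applied in both directions.\<close>

lemma epi_pair_inj:
  assumes F: "subgroup F G" and l: "l \<ge> 1" and \<phi>: "\<phi> \<in> epis (G\<lparr>carrier := F\<rparr>) l"
    and F': "subgroup F' G" and l': "l' \<ge> 1" and \<phi>': "\<phi>' \<in> epis (G\<lparr>carrier := F'\<rparr>) l'"
    and eq: "epi_pair l F \<phi> = epi_pair l' F' \<phi>'"
  shows "l = l' \<and> F = F' \<and> \<phi> = \<phi>'"
proof -
  have main: "F \<subseteq> F' \<and> (\<forall>x\<in>F. \<phi>' x = \<phi> x mod int l') \<and> l' dvd l"
    if F: "subgroup F G" and l: "l \<ge> 1" and \<phi>: "\<phi> \<in> epis (G\<lparr>carrier := F\<rparr>) l"
    and F': "subgroup F' G" and l': "l' \<ge> 1" and \<phi>': "\<phi>' \<in> epis (G\<lparr>carrier := F'\<rparr>) l'"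
    and eq: "epi_pair l F \<phi> = epi_pair l' F' \<phi>'" for F F' l l' \<phi> \<phi>'
  proof -
    note e = epis_subgroupD[OF F l \<phi>] and e' = epis_subgroupD[OF F' l' \<phi>']
    have FG: "x \<in> carrier G" if "x \<in> F" for x using subgroup.subset[OF F] that by blast
    have K: "{x \<in> F. \<phi> x = 0} = {x \<in> F'. \<phi>' x = 0}" and C: "{x \<in> F. \<phi> x = 1 mod int l} = {x \<in> F'. \<phi>' x = 1 mod int l'}"
      using eq by (auto simp: epi_pair_def)
    have "\<exists>a\<in>F. \<phi> a = 1 mod int l" using e(3)[of "1 mod int l"] l by simp
    then obtain a where a: "a \<in> F" "\<phi> a = 1 mod int l" by blast
    then have a': "a \<in> F'" "\<phi>' a = 1 mod int l'" using C by auto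
    have pow: "a [^] (i::int) \<in> F" "a [^] i \<in> F'" for i
      using a a' F F' subgroup_int_pow_closed by auto
    have pa: "\<phi> (a [^] (i::int)) = i mod int l" "\<phi>' (a [^] i) = i mod int l'" for i
      using e(4)[OF a(1)] e'(4)[OF a'(1)] a a' by (simp_all add: mod_mult_right_eq)
    have *: "x \<in> F' \<and> \<phi>' x = \<phi> x mod int l'" if x: "x \<in> F" for x
    proof -
      define k where "k = x \<otimes> inv (a [^] \<phi> x)"
      have kF: "k \<in> F" unfolding k_def
        using x pow subgroup.m_closed[OF F] subgroup.m_inv_closed[OF F] by blast
      have "\<phi> (inv (a [^] \<phi> x)) = (- (\<phi> x mod int l)) mod int l"
        using e(5)[OF pow(1)] pa(1) by simp
      then have "\<phi> k = 0"
        unfolding k_def using e(1)[OF x subgroup.m_inv_closed[OF F pow(1)]]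
        by (simp add: mod_add_right_eq mod_minus_eq)
      then have k': "k \<in> F'" "\<phi>' k = 0" using K kF by auto
      have "x = k \<otimes> a [^] \<phi> x"
        unfolding k_def using FG x pow by (simp add: m_assoc)
      then show ?thesis
        using e'(1)[OF k'(1) pow(2)] subgroup.m_closed[OF F' k'(1) pow(2)] k'(2) pa(2) by (metis add_0 mod_mod_trivial)
    qed
    have "a [^] int l \<in> {x \<in> F. \<phi> x = 0}" using pow pa by simp
    then have "\<phi>' (a [^] int l) = 0" unfolding K by blast
    then have "int l mod int l' = 0" using pa by simp
    then have "l' dvd l" using zmod_eq_0_iff by (metis int_dvd_int_iff mod_0_imp_dvd)
    then show ?thesis using * by blast
  qed
  have 1: "F \<subseteq> F' \<and> (\<forall>x\<in>F. \<phi>' x = \<phi> x mod int l') \<and> l' dvd l" using main[OF assms] .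
  have 2: "F' \<subseteq> F \<and> l dvd l'" using main[OF F' l' \<phi>' F l \<phi> eq[symmetric]] by blast
  have ll: "l = l'" using 1 2 by (simp add: dvd_antisym)
  have FF: "F = F'" using 1 2 by blast
  have "\<phi> x = \<phi>' x" for x
  proof (cases "x \<in> F")
    case True
    then show ?thesis using 1 epis_subgroupD(2)[OF F l \<phi>] ll by simp
  next
    case False
    then show ?thesis using epis_subgroupD(6)[OF F l \<phi>] epis_subgroupD(6)[OF F' l' \<phi>'] FF
      by (simp add: extensional_def)
  qed
  then show ?thesis using ll FF by blast
qed

text \<open>For \<open>a\<close> in \<open>C\<close>, \<open>F\<close> is the union of the cosets of
  \<open>K\<close> by powers of \<open>a\<close>, a group because \<open>a\<close> normalizes
  \<open>K\<close>. The order \<open>l\<close> of \<open>a\<close> modulo \<open>K\<close> is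
  finite, and \<open>\<phi>\<close> reads off the exponent modulo \<open>l\<close>.\<close>

lemma epi_pair_surj:
  assumes K: "K \<in> index_subgroups n" and n: "n \<ge> 1" and C: "C \<in> normalizing_cosets K"
  shows "\<exists>l m F \<phi>. l * m = n \<and> F \<in> index_subgroups m \<and> \<phi> \<in> epis (G\<lparr>carrier := F\<rparr>) l \<and> epi_pair l F \<phi> = (K, C)"
proof -
  have Ks: "subgroup K G" "card (rcosets K) = n" using K by (auto simp: index_subgroups_def)
  note Kc = subgroup.m_closed[OF Ks(1)] subgroup.m_inv_closed[OF Ks(1)] subgroup.one_closed[OF Ks(1)]
  have KG: "k \<in> carrier G" if "k \<in> K" for k using subgroup.subset[OF Ks(1)] that by blast
  have finK: "finite (rcosets K)" using Ks(2) n card_ge_0_finite by force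
  obtain a where a: "a \<in> carrier G" "C = K #> a" using C by (auto simp: normalizing_cosets_def RCOSETS_def)
  have aC: "a \<in> C" using a rcos_self[OF a(1) Ks(1)] by simp
  interpret N: right_action G "index_subgroups n" "conjugate G" by (rule right_action_conjugate)
  have aN: "a \<in> N.stabilizer K" using C aC a(1) by (auto simp: normalizing_cosets_def N.stabilizer_def)
  have norm: "a [^] i \<otimes> k \<otimes> inv (a [^] i) \<in> K" if k: "k \<in> K" for i :: int and k
  proof -
    have "a [^] (- i) \<in> N.stabilizer K" using subgroup_int_pow_closed[OF N.subgroup_stabilizer[OF K] aN] .
    then have "conjugate G K (inv (a [^] i)) = K" using a(1) by (simp add: N.stabilizer_def int_pow_neg)
    then have "inv (inv (a [^] i)) \<otimes> k \<otimes> inv (a [^] i) \<in> K" using k unfolding conjugate_def by blast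
    then show ?thesis using a(1) by simp
  qed
  have pG [simp]: "a [^] i \<in> carrier G" for i :: int using a(1) by simp
  have padd: "a [^] (i + j) = a [^] i \<otimes> a [^] j" for i j :: int using int_pow_mult[OF a(1)] .
  have pneg: "a [^] (- i) = inv (a [^] i)" for i :: int using int_pow_neg[OF a(1)] .
  \<comment> \<open>Pigeonhole: \<open>K\<close> has finitely many cosets, so two powers of
    \<open>a\<close> share one and some positive power lies in \<open>K\<close>.\<close>
  have "\<not> inj_on (\<lambda>i::nat. K #> a [^] int i) UNIV"
  proof
    assume inj: "inj_on (\<lambda>i::nat. K #> a [^] int i) UNIV"
    have "range (\<lambda>i::nat. K #> a [^] int i) \<subseteq> rcosets K"
      using rcosetsI[OF subgroup.subset[OF Ks(1)]] a(1) by auto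
    then show False using inj finK finite_subset finite_imageD infinite_UNIV_nat by metis
  qed
  then obtain i j :: nat where ij: "i < j" "K #> a [^] int i = K #> a [^] int j"
    unfolding inj_on_def by (metis linorder_neqE_nat)
  have ex: "int (j - i) > 0 \<and> a [^] int (j - i) \<in> K"
  proof -
    have "a [^] int j \<otimes> inv (a [^] int i) \<in> K" using rcoset_eq_iff[OF Ks(1)] ij(2)[symmetric] by simp
    then have "a [^] (int j - int i) \<in> K" using padd[of "int j" "- int i"] pneg by simp
    then show ?thesis using ij(1) by (simp add: of_nat_diff)
  qed
  define l where "l = (LEAST l::nat. l > 0 \<and> a [^] int l \<in> K)"
  have l: "l > 0" "a [^] int l \<in> K" and lmin: "\<And>q. q > 0 \<Longrightarrow> a [^] int q \<in> K \<Longrightarrow> l \<le> q"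
    using LeastI[of "\<lambda>l::nat. l > 0 \<and> a [^] int l \<in> K" "j - i"] ex
      Least_le[of "\<lambda>l::nat. l > 0 \<and> a [^] int l \<in> K"] by (auto simp: l_def)
  have ap: "a [^] i \<in> K \<longleftrightarrow> int l dvd i" for i
  proof
    assume "int l dvd i"
    then obtain q where "i = int l * q" by blast
    then have "a [^] i = (a [^] int l) [^] q" using int_pow_pow[OF a(1)] by simp
    then show "a [^] i \<in> K" using subgroup_int_pow_closed[OF Ks(1) l(2)] by simp
  next
    assume iK: "a [^] i \<in> K"
    \<comment> \<open>Division with remainder: the remainder is an exponent below \<open>l\<close>
      whose power lies in \<open>K\<close>, hence 0 by minimality.\<close>
    let ?r = "i mod int l"
    have "a [^] ?r = a [^] i \<otimes> inv ((a [^] int l) [^] (i div int l))"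
      using padd[of i "- (int l * (i div int l))"] pneg int_pow_pow[OF a(1)]
      by (simp add: minus_mult_div_eq_mod)
    also have "\<dots> \<in> K" using iK Kc subgroup_int_pow_closed[OF Ks(1) l(2)] by simp
    finally have rK: "a [^] int (nat ?r) \<in> K" using l(1) by simp
    have r: "0 \<le> ?r" "?r < int l" using l(1) by auto
    have "?r = 0"
    proof (rule ccontr)
      assume "?r \<noteq> 0"
      then have "nat ?r > 0" using r(1) by linarith
      then have "l \<le> nat ?r" using lmin rK by blast
      then show False using r by linarith
    qed
    then show "int l dvd i" by auto
  qed
  have coset_iff: "k \<otimes> a [^] i = k' \<otimes> a [^] i' \<Longrightarrow> i mod int l = i' mod int l" if "k \<in> K" "k' \<in> K" for k k' i i'
  proof -
    assume eq: "k \<otimes> a [^] i = k' \<otimes> a [^] i'"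
    have "a [^] (i - i') = a [^] i \<otimes> inv (a [^] i')" using padd[of i "- i'"] pneg by simp
    also have "a [^] i = inv k \<otimes> k' \<otimes> a [^] i'"
      using eq KG[OF that(1)] KG[OF that(2)] by (metis inv_solve_left' m_assoc m_closed inv_closed pG)
    also have "inv k \<otimes> k' \<otimes> a [^] i' \<otimes> inv (a [^] i') = inv k \<otimes> k'"
      using KG[OF that(1)] KG[OF that(2)] by (simp add: m_assoc)
    finally have "a [^] (i - i') \<in> K" using that Kc by simp
    then show "i mod int l = i' mod int l" using ap by (simp add: mod_eq_dvd_iff)
  qed
  define F where "F = {k \<otimes> a [^] i | k i::int. k \<in> K}"
  have mult: "(k \<otimes> a [^] i) \<otimes> (k' \<otimes> a [^] j) = (k \<otimes> (a [^] i \<otimes> k' \<otimes> inv (a [^] i))) \<otimes> a [^] (i + j)"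
    if "k \<in> K" "k' \<in> K" for k k' and i j :: int
    using KG[OF that(1)] KG[OF that(2)] by (simp add: padd m_assoc) (simp flip: m_assoc)
  have FG: "F \<subseteq> carrier G" using KG by (auto simp: F_def)
  have F: "subgroup F G"
  proof (rule subgroupI)
    show "F \<subseteq> carrier G" by (rule FG)
    show "F \<noteq> {}" using Kc(3) by (auto simp: F_def)
    show "x \<otimes> y \<in> F" if "x \<in> F" "y \<in> F" for x y
      using that mult norm Kc(1) unfolding F_def by blast
    show "inv x \<in> F" if xF: "x \<in> F" for x
    proof -
      obtain k i where x: "x = k \<otimes> a [^] (i::int)" "k \<in> K" using xF by (auto simp: F_def)
      have "inv x = (a [^] (- i) \<otimes> inv k \<otimes> inv (a [^] (- i))) \<otimes> a [^] (- i)"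
        using x KG[OF x(2)] by (simp add: pneg inv_mult_group m_assoc)
      then show ?thesis using norm[OF Kc(2)[OF x(2)], of "- i"] unfolding F_def by blast
    qed
  qed
  \<comment> \<open>An element of \<open>F\<close> may have several expressions, but
    \<open>coset_iff\<close> shows that they share the exponent modulo \<open>l\<close>.\<close>
  define \<phi> where "\<phi> = (\<lambda>x\<in>F. THE r. \<exists>k i. k \<in> K \<and> x = k \<otimes> a [^] i \<and> r = i mod int l)"
  have \<phi>: "\<phi> (k \<otimes> a [^] i) = i mod int l" if "k \<in> K" for k i
  proof -
    have "k \<otimes> a [^] i \<in> F" using that by (auto simp: F_def)
    moreover have "(THE r. \<exists>k' i'. k' \<in> K \<and> k \<otimes> a [^] i = k' \<otimes> a [^] i' \<and> r = i' mod int l) = i mod int l"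
    proof (rule the_equality)
      fix r assume "\<exists>k' i'. k' \<in> K \<and> k \<otimes> a [^] i = k' \<otimes> a [^] i' \<and> r = i' mod int l"
      then obtain k' i' where *: "k' \<in> K" "k \<otimes> a [^] i = k' \<otimes> a [^] i'" "r = i' mod int l" by blast
      then show "r = i mod int l" using coset_iff[OF that *(1,2)] by simp
    qed (use that in blast)
    ultimately show ?thesis by (simp add: \<phi>_def)
  qed
  have \<phi>_epi: "\<phi> \<in> epis (G\<lparr>carrier := F\<rparr>) l"
    unfolding epis_def
  proof (intro CollectI conjI IntI)
    have "\<phi> (x \<otimes> y) = (\<phi> x + \<phi> y) mod int l" if "x \<in> F" "y \<in> F" for x y
    proof -
      obtain k i where x: "x = k \<otimes> a [^] (i::int)" "k \<in> K" using \<open>x \<in> F\<close> by (auto simp: F_def)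
      obtain k' j where y: "y = k' \<otimes> a [^] (j::int)" "k' \<in> K" using \<open>y \<in> F\<close> by (auto simp: F_def)
      have "\<phi> (x \<otimes> y) = (i + j) mod int l"
        unfolding x(1) y(1) mult[OF x(2) y(2)] by (rule \<phi>[OF Kc(1)[OF x(2) norm[OF y(2)]]])
      then show ?thesis using \<phi>[OF x(2)] \<phi>[OF y(2)] x y by (simp add: mod_add_eq)
    qed
    moreover have "\<phi> x \<in> {0..<int l}" if "x \<in> F" for x
      using that \<phi> l(1) by (auto simp: F_def)
    ultimately show "\<phi> \<in> hom (G\<lparr>carrier := F\<rparr>) (integer_mod_group l)"
      using l(1) by (auto simp: hom_def carrier_integer_mod_group)
    have "j \<in> \<phi> ` F" if "j \<in> {0..<int l}" for j
    proof (rule image_eqI)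
      show "j = \<phi> (\<one> \<otimes> a [^] j)" using \<phi>[OF Kc(3), of j] that by simp
      show "\<one> \<otimes> a [^] j \<in> F" using Kc(3) unfolding F_def by blast
    qed
    then show "\<phi> ` carrier (G\<lparr>carrier := F\<rparr>) = {0..<int l}"
      using \<open>\<And>x. x \<in> F \<Longrightarrow> \<phi> x \<in> {0..<int l}\<close> by auto
  qed (simp add: \<phi>_def)
  have mod_K: "k \<otimes> a [^] i \<in> K #> a [^] j" if "k \<in> K" "i mod int l = j mod int l" for k i j
  proof -
    have "a [^] (i - j) \<in> K" using ap that(2) by (simp add: mod_eq_dvd_iff)
    then have "k \<otimes> a [^] (i - j) \<in> K" using Kc that by simp
    moreover have "k \<otimes> a [^] i = k \<otimes> a [^] (i - j) \<otimes> a [^] j"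
      using KG[OF that(1)] padd[of "i - j" j] by (simp add: m_assoc)
    ultimately show ?thesis unfolding r_coset_def by blast
  qed
  have fibre: "{x \<in> F. \<phi> x = j mod int l} = K #> a [^] j" for j
  proof (intro equalityI subsetI)
    fix x assume "x \<in> {x \<in> F. \<phi> x = j mod int l}"
    then show "x \<in> K #> a [^] j" using \<phi> mod_K by (auto simp: F_def)
  next
    fix x assume "x \<in> K #> a [^] j"
    then show "x \<in> {x \<in> F. \<phi> x = j mod int l}" using \<phi> by (auto simp: F_def r_coset_def)
  qed
  have "K #> a [^] (0::int) = K" using subgroup.subset[OF Ks(1)] by simp
  then have pair: "epi_pair l F \<phi> = (K, C)"
    using fibre[of 0] fibre[of 1] a by (simp add: epi_pair_def)
  \<comment> \<open>\<open>m\<close> is taken to be the index of \<open>F\<close>, whatever it is;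
    \<open>l * m = n\<close> is then read off from \<open>epi_pair_in\<close>, since the kernel
    \<open>K\<close> has index \<open>n\<close>.\<close>
  have ix: "F \<in> index_subgroups (card (rcosets F))" using F by (simp add: index_subgroups_def)
  moreover have "l * card (rcosets F) = n"
    using epi_pair_in[OF ix _ \<phi>_epi] l(1) pair Ks(2) by (simp add: index_subgroups_def)
  ultimately show ?thesis using \<phi>_epi pair by blast
qed

abbreviation epi_triples :: "nat \<Rightarrow> ((nat \<times> nat) \<times> 'a set \<times> ('a \<Rightarrow> int)) set" where
  "epi_triples n \<equiv> SIGMA (l, m) : {(l, m). l * m = n}. SIGMA F : index_subgroups m. epis (G\<lparr>carrier := F\<rparr>) l"

lemma bij_betw_epi_triples:
  assumes n: "n \<ge> 1"
  shows "bij_betw (\<lambda>((l, m), F, \<phi>). epi_pair l F \<phi>) (epi_triples n)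
    (Sigma (index_subgroups n) normalizing_cosets)"
proof (rule bij_betw_imageI)
  have pos: "l \<ge> 1" if "l * m = n" for l m using that n by (cases l) auto
  show "inj_on (\<lambda>((l, m), F, \<phi>). epi_pair l F \<phi>) (epi_triples n)"
  proof (rule inj_onI)
    fix t t' assume t: "t \<in> epi_triples n" "t' \<in> epi_triples n"
      and tt: "(\<lambda>((l, m), F, \<phi>). epi_pair l F \<phi>) t = (\<lambda>((l, m), F, \<phi>). epi_pair l F \<phi>) t'"
    obtain l m F \<phi> where 1: "t = ((l, m), F, \<phi>)" "l * m = n" "F \<in> index_subgroups m" "\<phi> \<in> epis (G\<lparr>carrier := F\<rparr>) l"
      using t(1) by auto
    obtain l' m' F' \<phi>' where 2: "t' = ((l', m'), F', \<phi>')" "l' * m' = n" "F' \<in> index_subgroups m'"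
      "\<phi>' \<in> epis (G\<lparr>carrier := F'\<rparr>) l'"
      using t(2) by auto
    have eq: "epi_pair l F \<phi> = epi_pair l' F' \<phi>'" using tt 1(1) 2(1) by simp
    have l: "l \<ge> 1" "l' \<ge> 1" using pos 1 2 by blast+
    have "l = l' \<and> F = F' \<and> \<phi> = \<phi>'"
      using epi_pair_inj[OF _ l(1) 1(4) _ l(2) 2(4) eq] 1 2 by (simp add: index_subgroups_def)
    moreover have "m = m'" using calculation 1(2) 2(2) l by auto
    ultimately show "t = t'" using 1(1) 2(1) by simp
  qed
  show "(\<lambda>((l, m), F, \<phi>). epi_pair l F \<phi>) ` epi_triples n = Sigma (index_subgroups n) normalizing_cosets"
  proof (intro equalityI subsetI)
    fix z assume "z \<in> (\<lambda>((l, m), F, \<phi>). epi_pair l F \<phi>) ` epi_triples n"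
    then show "z \<in> Sigma (index_subgroups n) normalizing_cosets"
      using epi_pair_in pos by fastforce
  next
    fix z assume "z \<in> Sigma (index_subgroups n) normalizing_cosets"
    then obtain K C where z: "z = (K, C)" "K \<in> index_subgroups n" "C \<in> normalizing_cosets K" by blast
    obtain l m F \<phi> where *: "l * m = n" "F \<in> index_subgroups m" "\<phi> \<in> epis (G\<lparr>carrier := F\<rparr>) l"
      "epi_pair l F \<phi> = (K, C)"
      using epi_pair_surj[OF z(2) n z(3)] by blast
    then have "((l, m), F, \<phi>) \<in> epi_triples n" by simp
    then show "z \<in> (\<lambda>((l, m), F, \<phi>). epi_pair l F \<phi>) ` epi_triples n"
      using z *(4) by (intro image_eqI[where x="((l, m), F, \<phi>)"]) auto
  qed
qed

lemma finite_factor_pairs: "(n::nat) \<ge> 1 \<Longrightarrow> finite {(l, m). l * m = n}"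
  by (rule finite_subset[of _ "{..n} \<times> {..n}"]) (auto simp: Suc_le_eq)

lemma finite_normalizing_cosets:
  assumes "K \<in> index_subgroups n" "n \<ge> 1" shows "finite (normalizing_cosets K)"
proof -
  have "finite (rcosets K)" using assms card_ge_0_finite by (force simp: index_subgroups_def)
  then show ?thesis by (auto simp: normalizing_cosets_def)
qed

lemma finite_epi_triples:
  assumes fg: "finitely_generated_group G" and n: "n \<ge> 1"
  shows "finite (epi_triples n)"
proof -
  have "finite (Sigma (index_subgroups n) normalizing_cosets)"
    using finite_index_subgroups[OF fg n] finite_normalizing_cosets[OF _ n] by (intro finite_SigmaI) auto
  then show ?thesis using bij_betw_finite[OF bij_betw_epi_triples[OF n]] by simp
qed

text \<open>The epimorphisms embed into the finite set of triples for \<open>l * m\<close>. Their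
  finiteness thus comes from counting cosets in \<open>G\<close> rather than from generators of
  \<open>F\<close>.\<close>

lemma finite_epis:
  assumes fg: "finitely_generated_group G" and F: "F \<in> index_subgroups m" and m: "m \<ge> 1" and l: "l \<ge> 1"
  shows "finite (epis (G\<lparr>carrier := F\<rparr>) l)"
proof -
  have "Pair (l, m) ` Pair F ` epis (G\<lparr>carrier := F\<rparr>) l \<subseteq> epi_triples (l * m)" using F by auto
  then have "finite (Pair (l, m) ` Pair F ` epis (G\<lparr>carrier := F\<rparr>) l)"
    using finite_epi_triples[OF fg, of "l * m"] m l finite_subset by (metis mult_le_mono nat_mult_1)
  then show ?thesis by (auto simp: finite_image_iff inj_on_def)
qed

theorem card_conjugacy_classes_index:
  assumes fg: "finitely_generated_group G" and n: "n \<ge> 1"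
  shows "n * card ((\<lambda>K. conjugate G K ` carrier G) ` index_subgroups n) =
    (\<Sum>(l, m) \<in> {(l, m). l * m = n}. \<Sum>F\<in>index_subgroups m. card (epis (G\<lparr>carrier := F\<rparr>) l))"
proof -
  note fin = finite_index_subgroups[OF fg]
  have pos: "l \<ge> 1 \<and> m \<ge> 1" if "l * m = n" for l m using that n by (cases l; cases m) auto
  have "n * card ((\<lambda>K. conjugate G K ` carrier G) ` index_subgroups n) =
      card (Sigma (index_subgroups n) normalizing_cosets)"
  proof -
    show ?thesis
      using sum_normalizing_cosets[OF fin[OF n] n] fin[OF n] finite_normalizing_cosets[OF _ n]
      by (simp add: card_SigmaI)
  qed
  also have "\<dots> = card (epi_triples n)"
    using bij_betw_same_card[OF bij_betw_epi_triples[OF n]] by simp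
  also have "\<dots> = (\<Sum>(l, m) \<in> {(l, m). l * m = n}. card (SIGMA F : index_subgroups m. epis (G\<lparr>carrier := F\<rparr>) l))"
    using finite_factor_pairs[OF n] fin finite_epis[OF fg] pos
    by (subst card_SigmaI) (auto intro!: finite_SigmaI sum.cong)
  also have "\<dots> = (\<Sum>(l, m) \<in> {(l, m). l * m = n}. \<Sum>F\<in>index_subgroups m. card (epis (G\<lparr>carrier := F\<rparr>) l))"
  proof (intro sum.cong refl, clarify)
    fix l m assume "n = l * m"
    then have "l \<ge> 1" "m \<ge> 1" using pos by auto
    then show "card (SIGMA F : index_subgroups m. epis (G\<lparr>carrier := F\<rparr>) l) =
        (\<Sum>F\<in>index_subgroups m. card (epis (G\<lparr>carrier := F\<rparr>) l))"
      using fin finite_epis[OF fg] by (intro card_SigmaI) auto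
  qed
  finally show ?thesis .
qed

end


section \<open>Moebius inversion and homomorphisms to cyclic groups\<close>

text \<open>With \<open>squarefree_eq_prod_prime_factors\<close> this identifies squarefree numbers
  with finite sets of primes.\<close>

lemma squarefree_prod_primes:
  assumes "finite S" "\<And>p. p \<in> S \<Longrightarrow> prime (p::nat)"
  shows "squarefree (\<Prod>S)" "prime_factors (\<Prod>S) = S"
proof -
  show "squarefree (\<Prod>S)"
    by (rule squarefree_prod_coprime) (use assms in \<open>auto intro: primes_coprime squarefree_prime\<close>)
  have "prime_factors (\<Prod>S) = (\<Union>p\<in>S. prime_factors p)"
    using assms assms(2)[of 0] by (subst prime_factors_prod) auto
  also have "\<dots> = S" using assms(2) by (auto simp: prime_prime_factors)
  finally show "prime_factors (\<Prod>S) = S" .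
qed

lemma squarefree_eq_prod_prime_factors:
  assumes "squarefree (d::nat)" shows "\<Prod>(prime_factors d) = d"
proof -
  have d: "d \<noteq> 0" using assms by (metis not_squarefree_0)
  have "d = (\<Prod>p\<in>prime_factors d. p ^ multiplicity p d)"
    using prod_prime_factors[OF d] by simp
  also have "\<dots> = (\<Prod>p\<in>prime_factors d. p)"
    using assms squarefree_factorial_semiring'[OF d] by (intro prod.cong) auto
  finally show ?thesis by simp
qed

text \<open>Only squarefree divisors contribute, and they correspond to the sets \<open>S\<close> of
  prime factors of \<open>n\<close>. The sum of \<open>(-1) ^ card S\<close> expands a product of
  factors \<open>-1 + 1\<close>, which is 0 unless the product is empty.\<close>

lemma sum_moebius_function:
  assumes n: "n \<ge> 1"
  shows "(\<Sum>d | d dvd n. moebius_function d) = (if n = 1 then 1 else 0)"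
proof -
  let ?P = "prime_factors n"
  have fin: "finite {d. d dvd n}" using n by (intro finite_divisors_nat) auto
  have "(\<Sum>d | d dvd n. moebius_function d) = (\<Sum>d | d dvd n \<and> squarefree d. (-1) ^ card (prime_factors d))"
    using fin by (intro sum.mono_neutral_cong_right) (auto simp: moebius_function_def)
  also have "\<dots> = (\<Sum>S\<in>Pow ?P. (-1) ^ card S)"
  proof (rule sum.reindex_bij_witness[where i="\<lambda>S. \<Prod>S" and j=prime_factors])
    fix d assume "d \<in> {d. d dvd n \<and> squarefree d}"
    then show "\<Prod>(prime_factors d) = d" "prime_factors d \<in> Pow ?P"
      using squarefree_eq_prod_prime_factors n dvd_prime_factors[of n d] by auto
  next
    fix S assume "S \<in> Pow ?P"
    then have S: "S \<subseteq> ?P" "finite S" "\<And>p. p \<in> S \<Longrightarrow> prime p"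
      using finite_subset by (auto dest: in_prime_factors_imp_prime)
    show "prime_factors (\<Prod>S) = S" using squarefree_prod_primes[OF S(2,3)] by simp
    have "\<Prod>S dvd (\<Prod>p\<in>S. p ^ multiplicity p n)"
      using S(1) by (intro prod_dvd_prod) (auto simp: prime_factors_multiplicity intro!: dvd_power)
    also have "\<dots> dvd (\<Prod>p\<in>?P. p ^ multiplicity p n)" using S(1) by (intro prod_dvd_prod_subset) auto
    also have "\<dots> = n" using n by (subst prod_prime_factors) auto
    finally show "\<Prod>S \<in> {d. d dvd n \<and> squarefree d}" using squarefree_prod_primes[OF S(2,3)] by simp
  qed auto
  also have "\<dots> = (\<Prod>p\<in>?P. (-1) + 1 :: int)"
    by (subst prod_add) auto
  also have "\<dots> = (if n = 1 then 1 else 0)"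
  proof (cases "n = 1")
    case False
    then have "?P \<noteq> {}" using n prime_factor_nat[of n] by (auto simp: prime_factors_dvd)
    then have "card ?P > 0" by (simp add: card_gt_0_iff)
    then show ?thesis using False by simp
  qed simp
  finally show ?thesis .
qed

text \<open>After exchanging the sums, the inner sum for a divisor \<open>c\<close> with
  \<open>l = c * q\<close> becomes, through \<open>k = l div d\<close>, the sum of Moebius values
  over the divisors \<open>k\<close> of \<open>q\<close>. It vanishes unless \<open>q = 1\<close>,
  so only \<open>e l\<close> survives.\<close>

lemma moebius_inversion:
  fixes e f :: "nat \<Rightarrow> int"
  assumes f: "\<And>d. d dvd l \<Longrightarrow> f d = (\<Sum>c | c dvd d. e c)" and l: "l \<ge> 1"
  shows "e l = (\<Sum>d | d dvd l. moebius_function (l div d) * f d)"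
proof -
  have fin: "finite {d. d dvd k}" if "k \<ge> 1" for k :: nat using that by (intro finite_divisors_nat) auto
  have "(\<Sum>d | d dvd l. moebius_function (l div d) * f d) =
      (\<Sum>d | d dvd l. \<Sum>c | c dvd d. moebius_function (l div d) * e c)"
    using f by (intro sum.cong) (auto simp: sum_distrib_left)
  also have "\<dots> = (\<Sum>d | d dvd l. \<Sum>c | c dvd l \<and> c dvd d. moebius_function (l div d) * e c)"
    by (intro sum.cong refl) (auto intro: dvd_trans)
  also have "\<dots> = (\<Sum>c | c dvd l. \<Sum>d | d dvd l \<and> c dvd d. moebius_function (l div d) * e c)"
    using sum.swap_restrict[OF fin[OF l] fin[OF l], of "\<lambda>d c. moebius_function (l div d) * e c" "\<lambda>d c. c dvd d"]
    by simp
  also have "\<dots> = (\<Sum>c | c dvd l. if c = l then e c else 0)"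
  proof (intro sum.cong refl)
    fix c assume "c \<in> {c. c dvd l}"
    then obtain q where q: "l = c * q" by auto
    have pos: "c \<ge> 1" "q \<ge> 1" using q l by (cases c; cases q; auto)+
    have "(\<Sum>d | d dvd l \<and> c dvd d. moebius_function (l div d) * e c) =
        (\<Sum>k | k dvd q. moebius_function k * e c)"
    proof (rule sum.reindex_bij_witness[where i="\<lambda>k. l div k" and j="\<lambda>d. l div d"])
      fix d assume "d \<in> {d. d dvd l \<and> c dvd d}"
      then obtain r s where r: "d = c * r" "l = d * s" by (metis dvdE mem_Collect_eq)
      then have "q = r * s" "d \<noteq> 0" using q pos l by auto
      then show "l div (l div d) = d" "l div d \<in> {k. k dvd q}" using r l by auto
    next
      fix k assume "k \<in> {k. k dvd q}"
      then obtain s where s: "q = k * s" by auto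
      then have "k \<noteq> 0" "s \<noteq> 0" using pos by auto
      then show "l div (l div k) = k" "l div k \<in> {d. d dvd l \<and> c dvd d}"
        using q s pos by (auto simp: mult.left_commute[of c k s])
    qed auto
    also have "\<dots> = (if q = 1 then 1 else 0) * e c"
      using sum_moebius_function[OF pos(2)] by (simp flip: sum_distrib_right)
    also have "\<dots> = (if c = l then e c else 0)" using q pos by auto
    finally show "(\<Sum>d | d dvd l \<and> c dvd d. moebius_function (l div d) * e c) = (if c = l then e c else 0)" .
  qed
  also have "\<dots> = e l" using fin[OF l] by simp
  finally show ?thesis ..
qed

text \<open>A homomorphism to the cyclic group of order \<open>l\<close> is an epimorphism onto its image, the
  multiples of \<open>l div d\<close> for a divisor \<open>d\<close> of \<open>l\<close>.\<close>

lemma num_hom_cyclic_eq_sum_epis: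
  assumes A: "group A" and l: "l \<ge> 1" and fin: "\<And>d. d dvd l \<Longrightarrow> finite (epis A d)"
  shows "num_hom A (integer_mod_group l) = (\<Sum>d | d dvd l. card (epis A d))"
proof -
  interpret A: group A by (rule A)
  \<comment> \<open>Composition of \<open>\<psi>\<close> with the embedding of the cyclic group of
    order \<open>d\<close> into that of order \<open>l\<close>, which is multiplication by
    \<open>l div d\<close>.\<close>
  define \<Psi> where "\<Psi> = (\<lambda>(d, \<psi>). \<lambda>x\<in>carrier A. int (l div d) * \<psi> x)"
  have pos: "d \<ge> 1" if "d dvd l" for d using that l by (metis dvd_pos_nat less_eq_Suc_le One_nat_def)
  have carr: "carrier (integer_mod_group d) = {0..<int d}" if "d \<ge> 1" for d
    using that by (simp add: carrier_integer_mod_group)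
  have "bij_betw \<Psi> (SIGMA d : {d. d dvd l}. epis A d) (hom A (integer_mod_group l) \<inter> extensional (carrier A))"
  proof (rule bij_betw_imageI)
    have q: "int l = int (l div d) * int d" "int (l div d) > 0" if "d dvd l" for d
    proof -
      show "int l = int (l div d) * int d" using that by (simp flip: of_nat_mult)
      show "int (l div d) > 0" using that l pos[OF that] by (simp add: dvd_imp_le div_greater_zero_iff)
    qed
    have im: "\<Psi> (d, \<psi>) ` carrier A = (\<lambda>j. int (l div d) * j) ` {0..<int d}" if "\<psi> \<in> epis A d" for d \<psi>
    proof -
      have "\<Psi> (d, \<psi>) ` carrier A = (\<lambda>j. int (l div d) * j) ` (\<psi> ` carrier A)"
        unfolding image_image by (intro image_cong) (auto simp: \<Psi>_def)
      then show ?thesis using that by (simp add: epis_def)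
    qed
    show "inj_on \<Psi> (SIGMA d : {d. d dvd l}. epis A d)"
    proof (rule inj_onI, clarify)
      fix d \<psi> d' \<psi>' assume d: "d dvd l" "\<psi> \<in> epis A d" and d': "d' dvd l" "\<psi>' \<in> epis A d'"
        and eq: "\<Psi> (d, \<psi>) = \<Psi> (d', \<psi>')"
      \<comment> \<open>The image has \<open>d\<close> elements, so the composite determines
        \<open>d\<close>.\<close>
      have card: "card ((\<lambda>j. int (l div d) * j) ` {0..<int d}) = d" if "d dvd l" for d
        using q(2)[OF that] by (subst card_image) (auto simp: inj_on_def)
      have dd: "d = d'" using im[OF d(2)] im[OF d'(2)] eq card[OF d(1)] card[OF d'(1)] by simp
      have "\<psi> x = \<psi>' x" for x
      proof (cases "x \<in> carrier A")
        case True
        then have "int (l div d) * \<psi> x = int (l div d) * \<psi>' x"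
          using fun_cong[OF eq, of x] dd by (simp add: \<Psi>_def)
        then show ?thesis using q(2)[OF d(1)] by simp
      next
        case False
        then show ?thesis using d(2) d'(2) by (simp add: epis_def extensional_def)
      qed
      then show "d = d' \<and> \<psi> = \<psi>'" using dd by auto
    qed
    show "\<Psi> ` (SIGMA d : {d. d dvd l}. epis A d) = hom A (integer_mod_group l) \<inter> extensional (carrier A)"
    proof (intro equalityI subsetI)
      fix \<phi> assume "\<phi> \<in> \<Psi> ` (SIGMA d : {d. d dvd l}. epis A d)"
      then obtain d \<psi> where d: "d dvd l" "\<psi> \<in> epis A d" "\<phi> = \<Psi> (d, \<psi>)" by blast
      have \<psi>: "\<psi> x \<in> {0..<int d}" "\<psi> (x \<otimes>\<^bsub>A\<^esub> y) = (\<psi> x + \<psi> y) mod int d"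
        if "x \<in> carrier A" "y \<in> carrier A" for x y
        using d(2) that carr[OF pos[OF d(1)]] by (auto simp: epis_def hom_def)
      have "int (l div d) * \<psi> x < int l" if "x \<in> carrier A" for x
        using \<psi>(1)[OF that that] q[OF d(1)] by simp
      then have "\<phi> \<in> hom A (integer_mod_group l)"
        using \<psi> l q[OF d(1)] unfolding d(3)
        by (intro homI) (auto simp: \<Psi>_def carr mult_mod_right distrib_left)
      then show "\<phi> \<in> hom A (integer_mod_group l) \<inter> extensional (carrier A)"
        unfolding d(3) by (simp add: \<Psi>_def)
    next
      fix \<phi> assume \<phi>: "\<phi> \<in> hom A (integer_mod_group l) \<inter> extensional (carrier A)"
      interpret h: group_hom A "integer_mod_group l" \<phi>
        using \<phi> by (intro group_hom.intro group_hom_axioms.intro A group_integer_mod_group) auto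
      define I where "I = \<phi> ` carrier A"
      have I: "0 \<le> i \<and> i < int l" if "i \<in> I" for i
        using that h.hom_closed carr[OF l] by (auto simp: I_def)
      have I0: "0 \<in> I" using h.hom_one A.one_closed unfolding I_def by (metis image_eqI one_integer_mod_group)
      \<comment> \<open>\<open>I\<close> is a subgroup; this form of closure is made for division
        with remainder, with \<open>k\<close> the negated quotient.\<close>
      have comb: "(i + k * j) mod int l \<in> I" if ij: "i \<in> I" "j \<in> I" for i j k :: int
      proof -
        obtain x y where x: "x \<in> carrier A" "i = \<phi> x" and y: "y \<in> carrier A" "j = \<phi> y"
          using ij by (auto simp: I_def)
        have "\<phi> (x \<otimes>\<^bsub>A\<^esub> y [^]\<^bsub>A\<^esub> k) = (i + k * j) mod int l"
          using x y by (simp add: h.hom_int_pow int_pow_integer_mod_group mod_add_right_eq)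
        then show ?thesis unfolding I_def using x y by (metis A.int_pow_closed A.m_closed image_eqI)
      qed
      \<comment> \<open>The positive generator of the image. For the zero homomorphism the image has
        no positive element, and the alternative \<open>g = l\<close> supplies the value for which
        \<open>d = 1\<close>.\<close>
      define g where "g = (LEAST g::nat. g > 0 \<and> (int g \<in> I \<or> g = l))"
      have g: "g > 0" "int g \<in> I \<or> g = l" and gmin: "\<And>k. k > 0 \<Longrightarrow> int k \<in> I \<or> k = l \<Longrightarrow> g \<le> k"
        using LeastI[of "\<lambda>g::nat. g > 0 \<and> (int g \<in> I \<or> g = l)" l] l
          Least_le[of "\<lambda>g::nat. g > 0 \<and> (int g \<in> I \<or> g = l)"] by (auto simp: g_def)
      have gl: "g \<le> l" using gmin[of l] l by simp
      have small: "r = 0" if "0 \<le> r" "r < int g" "r \<in> I" for r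
      proof (rule ccontr)
        assume "r \<noteq> 0"
        then have "g \<le> nat r" using gmin[of "nat r"] that by simp
        then show False using that by linarith
      qed
      have gI: "int g dvd i" if i: "i \<in> I" for i
      proof (cases "int g \<in> I")
        case True
        have "(i + (- (i div int g)) * int g) mod int l \<in> I" using comb[OF i True] .
        also have "i + (- (i div int g)) * int g = i mod int g" by (simp add: minus_div_mult_eq_mod)
        also have "(i mod int g) mod int l = i mod int g"
          using gl g(1) by (intro mod_pos_pos_trivial) (auto intro: order_less_le_trans[OF pos_mod_bound])
        finally have "i mod int g = 0" using g(1) by (intro small) auto
        then show ?thesis by (rule mod_0_imp_dvd)
      next
        case False
        then show ?thesis using small[of i] I[OF i] g i by simp
      qed
      have gdl: "g dvd l"
      proof (cases "int g \<in> I")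
        case True
        have "(0 + (- (int l div int g)) * int g) mod int l \<in> I" using comb[OF I0 True] .
        also have "(0 + (- (int l div int g)) * int g) mod int l = (int l + (- (int l div int g)) * int g) mod int l"
          by (metis add.commute add_0 mod_add_self2)
        also have "int l + (- (int l div int g)) * int g = int l mod int g" by (simp add: minus_div_mult_eq_mod)
        also have "(int l mod int g) mod int l = int l mod int g"
          using gl g(1) by (intro mod_pos_pos_trivial) (auto intro: order_less_le_trans[OF pos_mod_bound])
        finally have "int l mod int g = 0" using g(1) by (intro small) auto
        then show ?thesis by (metis int_dvd_int_iff dvd_eq_mod_eq_0)
      qed (use g in simp)
      define d where "d = l div g"
      have d: "d dvd l" "l div d = g" "int l = int g * int d" "d \<ge> 1"
        using gdl g(1) l unfolding d_def by (auto simp: dvd_imp_le div_greater_zero_iff Suc_le_eq simp flip: of_nat_mult)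
      define \<psi> where "\<psi> = (\<lambda>x\<in>carrier A. \<phi> x div int g)"
      have \<phi>\<psi>: "\<phi> x = int g * \<psi> x" if "x \<in> carrier A" for x
        using gI[of "\<phi> x"] that by (simp add: \<psi>_def I_def)
      have \<psi>r: "\<psi> x \<in> {0..<int d}" if "x \<in> carrier A" for x
      proof -
        have "\<phi> x \<in> I" using that by (simp add: I_def)
        then have "0 \<le> int g * \<psi> x \<and> int g * \<psi> x < int g * int d"
          using I \<phi>\<psi>[OF that] d(3) by simp
        then show ?thesis using g(1) by (simp add: zero_le_mult_iff)
      qed
      have "\<psi> (x \<otimes>\<^bsub>A\<^esub> y) = (\<psi> x + \<psi> y) mod int d" if "x \<in> carrier A" "y \<in> carrier A" for x y
      proof -
        have "int g * \<psi> (x \<otimes>\<^bsub>A\<^esub> y) = (int g * \<psi> x + int g * \<psi> y) mod int l"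
          using h.hom_mult[OF that] \<phi>\<psi> that by simp
        also have "\<dots> = int g * ((\<psi> x + \<psi> y) mod int d)"
          unfolding d(3) by (simp add: mult_mod_right distrib_left)
        finally show ?thesis using g(1) by simp
      qed
      then have "\<psi> \<in> hom A (integer_mod_group d)"
        using \<psi>r carr[OF d(4)] by (auto simp: hom_def)
      moreover have "\<psi> ` carrier A = {0..<int d}"
      proof
        show "\<psi> ` carrier A \<subseteq> {0..<int d}" using \<psi>r by blast
        show "{0..<int d} \<subseteq> \<psi> ` carrier A"
        proof
          fix j assume j: "j \<in> {0..<int d}"
          have "int g * j \<in> I"
          proof (cases "int g \<in> I")
            case True
            have "int g * j < int l" using j d(3) g(1) by simp
            then show ?thesis using comb[OF I0 True, of j] j by (simp add: mult.commute)
          next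
            case False
            then have "d = 1" using g d_def by simp
            then have "j = 0" using j by simp
            then show ?thesis using I0 by simp
          qed
          then obtain x where x: "x \<in> carrier A" "int g * j = \<phi> x" by (auto simp: I_def)
          then have "j = \<psi> x" using \<phi>\<psi>[OF x(1)] g(1) by simp
          then show "j \<in> \<psi> ` carrier A" using x(1) by blast
        qed
      qed
      ultimately have "\<psi> \<in> epis A d" by (simp add: epis_def \<psi>_def)
      moreover have "\<Psi> (d, \<psi>) = \<phi>"
        using \<phi> \<phi>\<psi> d(2) by (auto simp: \<Psi>_def fun_eq_iff extensional_def)
      ultimately show "\<phi> \<in> \<Psi> ` (SIGMA d : {d. d dvd l}. epis A d)" using d(1) by force
    qed
  qed
  then have "num_hom A (integer_mod_group l) = card (SIGMA d : {d. d dvd l}. epis A d)"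
    unfolding num_hom_def by (simp add: bij_betw_same_card)
  also have "\<dots> = (\<Sum>d | d dvd l. card (epis A d))"
    using l fin by (intro card_SigmaI) (auto intro: finite_divisors_nat)
  finally show ?thesis .
qed

lemma derived_subset_kernel:
  assumes "group_hom G H h" "comm_group H"
  shows "derived G (carrier G) \<subseteq> kernel G H h"
proof -
  interpret h: group_hom G H h by (rule assms(1))
  interpret H: comm_group H by (rule assms(2))
  show ?thesis
    unfolding derived_def
  proof (rule h.G.generate_subgroup_incl[OF _ h.subgroup_kernel], clarify)
    fix a b assume ab: "a \<in> carrier G" "b \<in> carrier G"
    then have "h (a \<otimes>\<^bsub>G\<^esub> b \<otimes>\<^bsub>G\<^esub> inv\<^bsub>G\<^esub> a \<otimes>\<^bsub>G\<^esub> inv\<^bsub>G\<^esub> b) =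
        h b \<otimes>\<^bsub>H\<^esub> h a \<otimes>\<^bsub>H\<^esub> inv\<^bsub>H\<^esub> h a \<otimes>\<^bsub>H\<^esub> inv\<^bsub>H\<^esub> h b"
      using H.m_comm[of "h a" "h b"] by simp
    also have "\<dots> = \<one>\<^bsub>H\<^esub>" using ab by (simp add: h.H.m_assoc)
    finally show "a \<otimes>\<^bsub>G\<^esub> b \<otimes>\<^bsub>G\<^esub> inv\<^bsub>G\<^esub> a \<otimes>\<^bsub>G\<^esub> inv\<^bsub>G\<^esub> b \<in> kernel G H h"
      using ab by (simp add: kernel_def)
  qed
qed

text \<open>Precomposition with the projection \<open>\<pi>\<close> of \<open>A\<close> onto its
  abelianization, read in \<open>B\<close>, is a bijection: a homomorphism to a commutative group
  sends the derived subgroup to the unit and is therefore constant on the fibres of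
  \<open>\<pi>\<close>.\<close>

lemma num_hom_abelianization:
  assumes A: "group A" and B: "group B" and Z: "comm_group Z" and iso: "abelianization A \<cong> B"
  shows "num_hom B Z = num_hom A Z"
proof -
  interpret A: group A by (rule A)
  interpret B: group B by (rule B)
  interpret Z: comm_group Z by (rule Z)
  let ?D = "derived A (carrier A)"
  interpret D: normal ?D A by (rule A.derived_self_is_normal)
  obtain f where f: "f \<in> iso (A Mod ?D) B" using iso by (auto simp: is_iso_def abelianization_def)
  define \<pi> where "\<pi> x = f (?D #>\<^bsub>A\<^esub> x)" for x
  have \<pi>: "\<pi> \<in> hom A B"
    using hom_compose[OF D.r_coset_hom_Mod, of f B] f by (simp add: iso_def \<pi>_def[abs_def] comp_def)
  have carrD: "carrier (A Mod ?D) = (\<lambda>x. ?D #>\<^bsub>A\<^esub> x) ` carrier A"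
    by (auto simp: FactGroup_def RCOSETS_def)
  have surj: "\<pi> ` carrier A = carrier B"
  proof -
    have "f ` carrier (A Mod ?D) = carrier B" using f by (auto simp: iso_def bij_betw_def)
    then show ?thesis unfolding carrD image_image \<pi>_def .
  qed
  have pre: "\<exists>a\<in>carrier A. b = \<pi> a" if "b \<in> carrier B" for b
  proof -
    have "b \<in> \<pi> ` carrier A" using that by (simp only: surj)
    then show ?thesis by auto
  qed
  have ker: "\<xi> x = \<xi> y" if \<xi>: "\<xi> \<in> hom A Z" and xy: "x \<in> carrier A" "y \<in> carrier A" "\<pi> x = \<pi> y" for \<xi> x y
  proof -
    interpret \<xi>: group_hom A Z \<xi>
      by (intro group_hom.intro group_hom_axioms.intro A.is_group Z.is_group \<xi>)
    have "inj_on f (carrier (A Mod ?D))" using f by (auto simp: iso_def bij_betw_def)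
    then have "?D #>\<^bsub>A\<^esub> x = ?D #>\<^bsub>A\<^esub> y"
      using xy unfolding \<pi>_def carrD by (auto simp: inj_on_def)
    then have "x \<otimes>\<^bsub>A\<^esub> inv\<^bsub>A\<^esub> y \<in> ?D"
      using A.rcoset_eq_iff[OF D.subgroup_axioms xy(1,2)] by simp
    then have "\<xi> (x \<otimes>\<^bsub>A\<^esub> inv\<^bsub>A\<^esub> y) = \<one>\<^bsub>Z\<^esub>"
      using derived_subset_kernel[OF \<xi>.group_hom_axioms Z] by (auto simp: kernel_def)
    then have "\<xi> x \<otimes>\<^bsub>Z\<^esub> inv\<^bsub>Z\<^esub> \<xi> y = \<one>\<^bsub>Z\<^esub>" using xy by simp
    then show ?thesis using xy Z.inv_equality[of "\<xi> x" "inv\<^bsub>Z\<^esub> \<xi> y"] by simp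
  qed
  have "bij_betw (\<lambda>\<theta>. \<lambda>x\<in>carrier A. \<theta> (\<pi> x)) (hom B Z \<inter> extensional (carrier B)) (hom A Z \<inter> extensional (carrier A))"
  proof (rule bij_betw_imageI)
    show "inj_on (\<lambda>\<theta>. \<lambda>x\<in>carrier A. \<theta> (\<pi> x)) (hom B Z \<inter> extensional (carrier B))"
    proof (rule inj_onI)
      fix \<theta> \<theta>' assume ext: "\<theta> \<in> hom B Z \<inter> extensional (carrier B)" "\<theta>' \<in> hom B Z \<inter> extensional (carrier B)"
        and eq: "(\<lambda>x\<in>carrier A. \<theta> (\<pi> x)) = (\<lambda>x\<in>carrier A. \<theta>' (\<pi> x))"
      have "\<theta> b = \<theta>' b" if "b \<in> carrier B" for b
      proof -
        obtain a where "a \<in> carrier A" "b = \<pi> a" using pre \<open>b \<in> carrier B\<close> by blast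
        then show ?thesis using fun_cong[OF eq, of a] by simp
      qed
      then show "\<theta> = \<theta>'" using ext by (auto intro: extensionalityI)
    qed
    show "(\<lambda>\<theta>. \<lambda>x\<in>carrier A. \<theta> (\<pi> x)) ` (hom B Z \<inter> extensional (carrier B)) = hom A Z \<inter> extensional (carrier A)"
    proof (intro equalityI subsetI)
      fix \<xi> assume "\<xi> \<in> (\<lambda>\<theta>. \<lambda>x\<in>carrier A. \<theta> (\<pi> x)) ` (hom B Z \<inter> extensional (carrier B))"
      then obtain \<theta> where "\<theta> \<in> hom B Z" "\<xi> = (\<lambda>x\<in>carrier A. \<theta> (\<pi> x))" by blast
      then show "\<xi> \<in> hom A Z \<inter> extensional (carrier A)" using \<pi> by (auto simp: hom_def Pi_iff)
    next
      fix \<xi> assume \<xi>: "\<xi> \<in> hom A Z \<inter> extensional (carrier A)"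
      define s where "s b = (SOME a. a \<in> carrier A \<and> \<pi> a = b)" for b
      have s: "s b \<in> carrier A \<and> \<pi> (s b) = b" if "b \<in> carrier B" for b
        unfolding s_def by (rule someI_ex) (use pre[OF that] in blast)
      define \<theta> where "\<theta> = (\<lambda>b\<in>carrier B. \<xi> (s b))"
      have \<theta>\<pi>: "\<theta> (\<pi> x) = \<xi> x" if "x \<in> carrier A" for x
      proof -
        have "\<pi> x \<in> carrier B" using \<pi> that by (auto simp: hom_def)
        then show ?thesis using ker[of \<xi> "s (\<pi> x)" x] \<xi> s that by (simp add: \<theta>_def)
      qed
      have "\<theta> \<in> hom B Z"
      proof (rule homI)
        fix b assume b: "b \<in> carrier B"
        then obtain x where x: "x \<in> carrier A" "b = \<pi> x" using pre by blast
        then show "\<theta> b \<in> carrier Z" using \<theta>\<pi> \<xi> by (auto simp: hom_def)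
        fix c assume "c \<in> carrier B"
        then obtain y where y: "y \<in> carrier A" "c = \<pi> y" using pre by blast
        have "b \<otimes>\<^bsub>B\<^esub> c = \<pi> (x \<otimes>\<^bsub>A\<^esub> y)" using x y \<pi> by (simp add: hom_def)
        then show "\<theta> (b \<otimes>\<^bsub>B\<^esub> c) = \<theta> b \<otimes>\<^bsub>Z\<^esub> \<theta> c" using x y \<theta>\<pi> \<xi> by (simp add: hom_def)
      qed
      moreover have "\<theta> \<in> extensional (carrier B)" by (simp add: \<theta>_def)
      moreover have "\<xi> = (\<lambda>x\<in>carrier A. \<theta> (\<pi> x))"
        using \<theta>\<pi> \<xi> by (auto simp: fun_eq_iff extensional_def)
      ultimately show "\<xi> \<in> (\<lambda>\<theta>. \<lambda>x\<in>carrier A. \<theta> (\<pi> x)) ` (hom B Z \<inter> extensional (carrier B))"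
        by blast
    qed
  qed
  then show ?thesis unfolding num_hom_def by (simp add: bij_betw_same_card)
qed


section \<open>First homology is the abelianized fundamental group\<close>

text \<open>The parameter is the second barycentric coordinate, so the edge runs from vertex 0,
  where it is \<open>g 0\<close>, to vertex 1, where it is \<open>g 1\<close>. Off the simplex it is
  undefined, as singular simplices are.\<close>

definition edge :: "(real \<Rightarrow> 'a) \<Rightarrow> (nat \<Rightarrow> real) \<Rightarrow> 'a" where
  "edge g = restrict (\<lambda>v. g (v 1)) (standard_simplex 1)"

abbreviation edge_chain :: "(real \<Rightarrow> 'a) \<Rightarrow> 'a chain" where
  "edge_chain g \<equiv> frag_of (edge g)"

definition point_simplex :: "'a \<Rightarrow> (nat \<Rightarrow> real) \<Rightarrow> 'a" where
  "point_simplex x = restrict (\<lambda>v. x) (standard_simplex 0)"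

definition segment :: "'b::real_vector \<Rightarrow> 'b \<Rightarrow> real \<Rightarrow> 'b" where
  "segment a b = (\<lambda>t. (1 - t) *\<^sub>R a + t *\<^sub>R b)"

lemma sum_atMost_1_2:
  fixes f :: "nat \<Rightarrow> 'b::comm_monoid_add"
  shows "(\<Sum>k\<le>1. f k) = f 0 + f 1" "(\<Sum>k\<le>2. f k) = f 0 + f 1 + f 2"
  by (simp_all add: numeral_2_eq_2)

declare One_nat_def [simp del]

lemma continuous_on_coordinate: "continuous_on S (\<lambda>v::nat \<Rightarrow> real. v i)"
  by (rule continuous_on_subset[OF continuous_on_product_coordinates]) simp

lemma standard_simplex_1_iff:
  "v \<in> standard_simplex 1 \<longleftrightarrow> v 0 = 1 - v 1 \<and> 0 \<le> v 1 \<and> v 1 \<le> 1 \<and> (\<forall>i>1. v i = 0)"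
proof
  assume "v \<in> standard_simplex 1"
  then show "v 0 = 1 - v 1 \<and> 0 \<le> v 1 \<and> v 1 \<le> 1 \<and> (\<forall>i>1. v i = 0)"
    by (auto simp: standard_simplex_def sum_atMost_1_2)
next
  assume v: "v 0 = 1 - v 1 \<and> 0 \<le> v 1 \<and> v 1 \<le> 1 \<and> (\<forall>i>1. v i = 0)"
  then have "0 \<le> v i \<and> v i \<le> 1" for i
    by (cases "i = 0"; cases "i = 1") (auto simp: not_less_eq_eq)
  then show "v \<in> standard_simplex 1" using v by (auto simp: standard_simplex_def sum_atMost_1_2)
qed

lemma powertop_subtopology_eq: "subtopology (powertop_real UNIV) S = top_of_set S"
  by (simp add: euclidean_product_topology)

lemma edge_cong: "(\<And>t. t \<in> {0..1} \<Longrightarrow> g t = h t) \<Longrightarrow> edge g = edge h"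
  by (auto simp: edge_def restrict_def standard_simplex_1_iff fun_eq_iff)

lemma singular_simplex_edge:
  assumes "pathin X g" shows "singular_simplex 1 X (edge g)"
proof -
  have "continuous_map (top_of_set (standard_simplex 1)) (top_of_set {0..1}) (\<lambda>v. v 1)"
    by (auto simp: standard_simplex_1_iff intro: continuous_on_coordinate)
  then have "continuous_map (top_of_set (standard_simplex 1)) X (g \<circ> (\<lambda>v. v 1))"
    using assms unfolding pathin_def by (rule continuous_map_compose)
  then have "continuous_map (top_of_set (standard_simplex 1)) X (edge g)"
    by (rule continuous_map_eq) (auto simp: edge_def)
  then show ?thesis by (simp add: singular_simplex_def powertop_subtopology_eq edge_def)
qed

lemma singular_chain_edge: "pathin X g \<Longrightarrow> singular_chain 1 X (edge_chain g)"
  by (simp add: singular_chain_of singular_simplex_edge)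

lemma chain_boundary_edge:
  "chain_boundary 1 (edge_chain g) = frag_of (point_simplex (g 1)) - frag_of (point_simplex (g 0))"
proof -
  have "singular_face 1 0 (edge g) = point_simplex (g 1)"
    using simplical_face_in_standard_simplex[of 1 0]
    by (auto simp: singular_face_def edge_def point_simplex_def restrict_def fun_eq_iff
        simplical_face_def standard_simplex_0)
  moreover have "singular_face 1 1 (edge g) = point_simplex (g 0)"
    using simplical_face_in_standard_simplex[of 1 1]
    by (auto simp: singular_face_def edge_def point_simplex_def restrict_def fun_eq_iff
        simplical_face_def standard_simplex_0)
  ultimately show ?thesis by (simp add: chain_boundary_of sum_atMost_1_2)
qed

lemma cycle_edge: "g \<in> loops X x \<Longrightarrow> singular_relcycle 1 X {} (edge_chain g)"
  using chain_boundary_edge[of g] by (simp add: singular_cycle singular_chain_edge loops_def)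

text \<open>The affine triangle with corners \<open>a\<close>, \<open>b\<close>, \<open>c\<close>
  lies in \<open>S\<close> by convexity, and its image under \<open>G\<close> is a singular
  2-simplex whose boundary is the difference of the two chains. Degenerate triangles are
  allowed.\<close>

lemma homologous_edge_triangle:
  fixes S :: "'b::real_normed_vector set"
  assumes S: "convex S" and G: "continuous_map (top_of_set S) X G"
    and abc: "a \<in> S" "b \<in> S" "c \<in> S"
  shows "homologous_rel 1 X {} (edge_chain (G \<circ> segment a b) + edge_chain (G \<circ> segment b c))
           (edge_chain (G \<circ> segment a c))"
proof -
  let ?f = "\<lambda>v::nat \<Rightarrow> real. v 0 *\<^sub>R a + v 1 *\<^sub>R b + v 2 *\<^sub>R c"
  define \<sigma> where "\<sigma> = restrict (G \<circ> ?f) (standard_simplex 2)"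
  have sum2: "v 0 + v 1 + v 2 = 1" "0 \<le> v i" if "v \<in> standard_simplex 2" for v :: "nat \<Rightarrow> real" and i
    using that by (auto simp: standard_simplex_def sum_atMost_1_2)
  have f_in: "?f v \<in> S" if v: "v \<in> standard_simplex 2" for v
  proof -
    have "(\<Sum>i\<in>{0,1,2::nat}. v i *\<^sub>R (if i = 0 then a else if i = 1 then b else c)) \<in> S"
      by (rule convex_sum[OF _ S]) (use sum2[OF v] abc in \<open>auto simp: add.assoc\<close>)
    then show ?thesis by (simp add: add.assoc)
  qed
  have "continuous_on (standard_simplex 2) ?f"
    by (intro continuous_intros continuous_on_coordinate)
  then have "continuous_map (top_of_set (standard_simplex 2)) (top_of_set S) ?f"
    using f_in by auto
  then have "continuous_map (top_of_set (standard_simplex 2)) X (G \<circ> ?f)"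
    using G by (rule continuous_map_compose)
  then have "continuous_map (top_of_set (standard_simplex 2)) X \<sigma>"
    by (rule continuous_map_eq) (auto simp: \<sigma>_def)
  then have \<sigma>: "singular_simplex 2 X \<sigma>"
    by (simp add: singular_simplex_def powertop_subtopology_eq) (simp add: \<sigma>_def)
  have face: "simplical_face k v \<in> standard_simplex 2" if "k \<le> 2" "v \<in> standard_simplex 1" for k and v :: "nat \<Rightarrow> real"
    using simplical_face_in_standard_simplex[of 2 k v] that by simp
  have ev: "singular_face 2 k \<sigma> v = (if v \<in> standard_simplex 1 then G (?f (simplical_face k v)) else undefined)"
    if "k \<le> 2" for k v
    using face[OF that, of v] by (simp add: singular_face_def \<sigma>_def)
  have fc: "singular_face 2 0 \<sigma> = edge (G \<circ> segment b c)"
    "singular_face 2 1 \<sigma> = edge (G \<circ> segment a c)"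
    "singular_face 2 2 \<sigma> = edge (G \<circ> segment a b)"
    by (auto simp: fun_eq_iff ev edge_def segment_def simplical_face_def standard_simplex_1_iff
        simp flip: One_nat_def)
  have "chain_boundary 2 (frag_of \<sigma>) = edge_chain (G \<circ> segment b c) - edge_chain (G \<circ> segment a c)
      + edge_chain (G \<circ> segment a b)"
    using fc by (simp add: chain_boundary_of sum_atMost_1_2)
  moreover have "singular_chain (Suc 1) X (frag_of \<sigma>)"
    using \<sigma> by (simp add: singular_chain_of numeral_2_eq_2)
  ultimately have "singular_relboundary 1 X {} (edge_chain (G \<circ> segment b c)
      - edge_chain (G \<circ> segment a c) + edge_chain (G \<circ> segment a b))"
    unfolding singular_boundary by (intro exI[of _ "frag_of \<sigma>"]) (simp add: numeral_2_eq_2)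
  then show ?thesis unfolding homologous_rel_def by (simp add: algebra_simps)
qed

text \<open>The degenerate triangle with corners 0, 1/2 and 1 in the unit interval, mapped by the
  concatenated path.\<close>

lemma homologous_edge_concat:
  assumes "pathin X g" "pathin X h" "g 1 = h 0"
  shows "homologous_rel 1 X {} (edge_chain g + edge_chain h) (edge_chain (g \<bowtie> h))"
proof -
  have c: "continuous_map (top_of_set {0..1}) X (g \<bowtie> h)"
    using pathin_loop_concat[OF assms] by (simp add: pathin_def)
  have "edge ((g \<bowtie> h) \<circ> segment 0 (1/2)) = edge g"
    by (rule edge_cong) (auto simp: segment_def loop_concat_def)
  moreover have "edge ((g \<bowtie> h) \<circ> segment (1/2) 1) = edge h"
  proof (rule edge_cong)
    fix t :: real assume "t \<in> {0..1}"
    then show "((g \<bowtie> h) \<circ> segment (1/2) 1) t = h t"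
      using assms(3) by (cases "t = 0") (auto simp: segment_def loop_concat_def field_simps)
  qed
  moreover have "edge ((g \<bowtie> h) \<circ> segment 0 1) = edge (g \<bowtie> h)"
    by (rule edge_cong) (auto simp: segment_def)
  ultimately show ?thesis
    using homologous_edge_triangle[OF _ c, of 0 "1/2" 1] by simp
qed

text \<open>A constant path is its own concatenation with itself, so its edge is homologous to twice
  itself.\<close>

lemma homologous_edge_const:
  assumes "x \<in> topspace X"
  shows "homologous_rel 1 X {} (edge_chain (\<lambda>t. x)) 0"
proof -
  have "(\<lambda>t. x) \<bowtie> (\<lambda>t. x) = (\<lambda>t. x)" by (auto simp: loop_concat_def)
  then show ?thesis
    using homologous_edge_concat[of X "\<lambda>t. x" "\<lambda>t. x"] assms
    by (simp add: homologous_rel_def)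
qed

text \<open>The diagonal cuts the square into two triangles. Each makes the diagonal homologous to
  the sum of its other two sides: \<open>g\<close> and a constant edge, or a constant edge and
  \<open>h\<close>. Constant edges are null-homologous.\<close>

lemma homologous_edge_homotopic:
  assumes "path_homotopic X g h"
  shows "homologous_rel 1 X {} (edge_chain g) (edge_chain h)"
proof -
  let ?Q = "{0..1} \<times> {0..1} :: (real \<times> real) set"
  obtain H where H: "continuous_map (top_of_set ?Q) X H"
    "\<forall>t\<in>{0..1}. H (0, t) = g t" "\<forall>t\<in>{0..1}. H (1, t) = h t"
    "\<forall>t\<in>{0..1}. H (t, 0) = g 0" "\<forall>t\<in>{0..1}. H (t, 1) = g 1"
    using assms unfolding path_homotopic_iff by blast
  have Q: "convex ?Q" by (intro convex_Times) auto
  note tri = homologous_edge_triangle[OF Q H(1)]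
  have e: "edge (H \<circ> segment (0,0) (0,1)) = edge g" "edge (H \<circ> segment (0,1) (1,1)) = edge (\<lambda>t. g 1)"
    "edge (H \<circ> segment (0,0) (1,0)) = edge (\<lambda>t. g 0)" "edge (H \<circ> segment (1,0) (1,1)) = edge h"
    using H by (auto intro!: edge_cong simp: segment_def)
  let ?d = "edge_chain (H \<circ> segment (0,0) (1,1))"
  have gX: "g 0 \<in> topspace X" "g 1 \<in> topspace X"
    using path_homotopic_pathin(1)[OF assms] path_start_in_topspace path_finish_in_topspace by blast+
  have "homologous_rel 1 X {} (edge_chain g + edge_chain (\<lambda>t. g 1)) ?d"
    "homologous_rel 1 X {} (edge_chain (\<lambda>t. g 0) + edge_chain h) ?d"
    using tri[of "(0,0)" "(0,1)" "(1,1)"] tri[of "(0,0)" "(1,0)" "(1,1)"] e by auto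
  from homologous_rel_diff[OF homologous_rel_diff[OF this(1) homologous_edge_const[OF gX(2)]]
      homologous_rel_diff[OF this(2) homologous_edge_const[OF gX(1)]]]
  show ?thesis by (simp add: homologous_rel_def)
qed

lemma homologous_edge_rev:
  assumes "pathin X g"
  shows "homologous_rel 1 X {} (edge_chain (rev_path g)) (- edge_chain g)"
proof -
  have x: "g 0 \<in> topspace X" using assms by (rule path_start_in_topspace)
  have "homologous_rel 1 X {} (edge_chain g + edge_chain (rev_path g)) (edge_chain (g \<bowtie> rev_path g))"
    using assms by (intro homologous_edge_concat pathin_rev_path) auto
  moreover have "homologous_rel 1 X {} (edge_chain (g \<bowtie> rev_path g)) (edge_chain (\<lambda>t. g 0))"
    using assms by (intro homologous_edge_homotopic path_homotopic_concat_rev) auto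
  ultimately have "homologous_rel 1 X {} (edge_chain g + edge_chain (rev_path g)) 0"
    using homologous_edge_const[OF x] homologous_rel_trans by metis
  then show ?thesis by (simp add: homologous_rel_def add.commute)
qed

section \<open>Reading 1-simplices as paths\<close>

definition side :: "((nat \<Rightarrow> real) \<Rightarrow> 'a) \<Rightarrow> real \<Rightarrow> 'a" where
  "side \<sigma> t = \<sigma> (\<lambda>i. if i = 0 then 1 - t else if i = 1 then t else 0)"

abbreviation segment_point :: "real \<Rightarrow> nat \<Rightarrow> real" where
  "segment_point t \<equiv> \<lambda>i. if i = 0 then 1 - t else if i = 1 then t else 0"

lemma segment_point_in_simplex: "t \<in> {0..1} \<Longrightarrow> segment_point t \<in> standard_simplex 1"
  by (auto simp: standard_simplex_1_iff)

lemma continuous_map_segment_point: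
  "continuous_map (top_of_set {0..1}) (subtopology (powertop_real UNIV) (standard_simplex 1)) segment_point"
proof -
  have "continuous_map (top_of_set {0..1}) euclideanreal (\<lambda>t. segment_point t i)" for i
    by (cases "i = 0"; cases "i = 1") (auto intro!: continuous_intros)
  then show ?thesis
    unfolding continuous_map_in_subtopology continuous_map_componentwise_UNIV
    using segment_point_in_simplex by auto
qed

lemma pathin_side:
  assumes "singular_simplex 1 X \<sigma>" shows "pathin X (side \<sigma>)"
proof -
  have "pathin X (\<sigma> \<circ> segment_point)"
    using continuous_map_compose[OF continuous_map_segment_point] assms
    unfolding pathin_def singular_simplex_def by blast
  then show ?thesis by (simp add: side_def[abs_def] comp_def)
qed

lemma edge_side:
  assumes "singular_simplex 1 X \<sigma>" shows "edge (side \<sigma>) = \<sigma>"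
proof
  fix v
  show "edge (side \<sigma>) v = \<sigma> v"
  proof (cases "v \<in> standard_simplex 1")
    case True
    then have "(\<lambda>i. if i = 0 then 1 - v 1 else if i = 1 then v 1 else 0) = v"
      by (auto simp: standard_simplex_1_iff fun_eq_iff)
    then show ?thesis using True by (simp add: edge_def side_def)
  qed (use assms in \<open>auto simp: edge_def singular_simplex_def extensional_def\<close>)
qed

lemma side_edge: "t \<in> {0..1} \<Longrightarrow> side (edge g) t = g t"
  using segment_point_in_simplex[of t] by (simp add: side_def edge_def)

text \<open>The two ways around a 2-simplex are homotopic, as the simplex is convex.\<close>

lemma path_homotopic_sides:
  assumes \<sigma>: "singular_simplex 2 X \<sigma>"
  shows "path_homotopic X (side (singular_face 2 2 \<sigma>) \<bowtie> side (singular_face 2 0 \<sigma>)) (side (singular_face 2 1 \<sigma>))"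
proof -
  let ?T = "subtopology (powertop_real UNIV) (standard_simplex 2)"
  let ?w = "\<lambda>k t. simplical_face k (segment_point t)"
  have w: "pathin ?T (?w k)" if "k \<le> 2" for k
  proof -
    have "continuous_map (top_of_set {0..1}) euclideanreal (\<lambda>t. simplical_face k (segment_point t) i)" for i
      by (cases "i < k"; cases "i = k"; cases "i = 0"; cases "i = 1"; cases "i = 2")
        (auto simp: simplical_face_def intro!: continuous_intros)
    moreover have "?w k t \<in> standard_simplex 2" if "t \<in> {0..1}" for t
      using simplical_face_in_standard_simplex[of 2 k "segment_point t"] segment_point_in_simplex[OF that]
        \<open>k \<le> 2\<close> by simp
    ultimately show ?thesis
      unfolding pathin_def continuous_map_in_subtopology continuous_map_componentwise_UNIV by auto
  qed
  have ends: "?w 2 1 = ?w 0 0" "?w 2 0 = ?w 1 0" "?w 0 1 = ?w 1 1"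
    by (auto simp: simplical_face_def fun_eq_iff)
  have "paths_homotopic ?T"
    by (rule paths_homotopic_convex_powertop) (rule convex_standard_simplex)
  moreover have "continuous_map ?T X \<sigma>" using \<sigma> by (simp add: singular_simplex_def)
  moreover have "pathin ?T (?w 2 \<bowtie> ?w 0)" using w ends by (intro pathin_loop_concat) auto
  ultimately have *: "path_homotopic X (\<sigma> \<circ> (?w 2 \<bowtie> ?w 0)) (\<sigma> \<circ> ?w 1)"
    using w ends by (intro paths_homotopic_image) auto
  have side: "side (singular_face 2 k \<sigma>) t = (\<sigma> \<circ> ?w k) t" if "t \<in> {0..1}" for k t
    using segment_point_in_simplex[OF that] by (simp add: side_def singular_face_def)
  have "path_homotopic X (\<sigma> \<circ> ?w k) (side (singular_face 2 k \<sigma>))" if "k \<le> 2" for k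
    using pathin_compose[OF w[OF that], of X \<sigma>] \<sigma> side
    by (intro path_homotopic_cong) (auto simp: singular_simplex_def)
  note e = this
  have "path_homotopic X ((\<sigma> \<circ> ?w 2) \<bowtie> (\<sigma> \<circ> ?w 0)) (side (singular_face 2 2 \<sigma>) \<bowtie> side (singular_face 2 0 \<sigma>))"
    using ends by (intro path_homotopic_concat e) auto
  then show ?thesis
    using * e[of 1] path_homotopic_sym path_homotopic_trans unfolding image_loop_concat by (meson one_le_numeral)
qed

section \<open>The Hurewicz homomorphism in degree one\<close>

context path_frame
begin

definition homology_class :: "'a chain \<Rightarrow> 'a chain set" where
  "homology_class c = homologous_rel_set 1 X {} c"

abbreviation "H1 \<equiv> homology_group 1 X"

lemma carrier_H1: "carrier H1 = homology_class ` singular_relcycle_set 1 X {}"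
  using carrier_relative_homology_group[of 1 X "{}"] by (simp add: homology_class_def[abs_def])

lemma homology_class_eq_iff: "homology_class a = homology_class b \<longleftrightarrow> homologous_rel 1 X {} a b"
  unfolding homology_class_def by (rule homologous_rel_set_eq)

lemma mult_homology_class:
  "homology_class a \<otimes>\<^bsub>H1\<^esub> homology_class b = homology_class (a + b)"
proof -
  have "homology_class a \<otimes>\<^bsub>H1\<^esub> homology_class b = (\<Union>r\<in>homology_class a. \<Union>s\<in>homology_class b. {r + s})"
    using mult_relative_homology_group[of 1 X "{}"] by simp
  also have "\<dots> = homology_class (a + b)"
  proof (intro equalityI subsetI)
    fix x assume "x \<in> (\<Union>r\<in>homology_class a. \<Union>s\<in>homology_class b. {r + s})"
    then show "x \<in> homology_class (a + b)"
      by (auto simp: homology_class_def intro: homologous_rel_add)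
  next
    fix x assume "x \<in> homology_class (a + b)"
    then have "x - a \<in> homology_class b"
      by (simp add: homology_class_def homologous_rel_def algebra_simps)
    moreover have "a \<in> homology_class a" by (simp add: homology_class_def)
    ultimately show "x \<in> (\<Union>r\<in>homology_class a. \<Union>s\<in>homology_class b. {r + s})"
      by (intro UN_I[of a] UN_I[of "x - a"]) auto
  qed
  finally show ?thesis .
qed

lemma one_H1: "\<one>\<^bsub>H1\<^esub> = singular_relboundary_set 1 X {}"
  using one_relative_homology_group[of 1 X "{}"] by simp

definition hurewicz :: "(real \<Rightarrow> 'a) set \<Rightarrow> 'a chain set" where
  "hurewicz A = homology_class (edge_chain (SOME g. g \<in> A))"

lemma hurewicz_loop_class:
  assumes g: "g \<in> loops X x0"
  shows "hurewicz (loop_class X x0 g) = homology_class (edge_chain g)"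
proof -
  have "g \<in> loop_class X x0 g"
    using g by (auto simp: loop_homotopy_iff loops_def intro: path_homotopic_refl)
  then have "(SOME l. l \<in> loop_class X x0 g) \<in> loop_class X x0 g"
    by (rule someI[of "\<lambda>l. l \<in> loop_class X x0 g"])
  then have "path_homotopic X g (SOME l. l \<in> loop_class X x0 g)"
    using in_loop_class_iff[OF g] by blast
  from homologous_edge_homotopic[OF this] show ?thesis
    unfolding hurewicz_def homology_class_eq_iff by (simp add: homologous_rel_sym)
qed

lemma hurewicz_hom: "hurewicz \<in> hom \<Gamma> H1"
proof (rule homI)
  fix A assume "A \<in> carrier \<Gamma>"
  then obtain g where g: "g \<in> loops X x0" "A = loop_class X x0 g" by (auto simp: carrier_fundamental_group)
  have "homology_class (edge_chain g) \<in> carrier H1" unfolding carrier_H1 using cycle_edge[OF g(1)] by blast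
  then show "hurewicz A \<in> carrier H1" using hurewicz_loop_class g by simp
  fix B assume "B \<in> carrier \<Gamma>"
  then obtain h where h: "h \<in> loops X x0" "B = loop_class X x0 h" by (auto simp: carrier_fundamental_group)
  have "hurewicz (A \<otimes>\<^bsub>\<Gamma>\<^esub> B) = homology_class (edge_chain (g \<bowtie> h))"
    unfolding g(2) h(2) mult_loop_class[OF g(1) h(1)] by (rule hurewicz_loop_class[OF loops_concat[OF g(1) h(1)]])
  also have "\<dots> = homology_class (edge_chain g + edge_chain h)"
    unfolding homology_class_eq_iff homologous_rel_sym[of _ _ _ "edge_chain (g \<bowtie> h)"]
    using g h by (intro homologous_edge_concat) (auto simp: loops_def)
  also have "\<dots> = hurewicz A \<otimes>\<^bsub>H1\<^esub> hurewicz B"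
    unfolding g(2) h(2) using hurewicz_loop_class[OF g(1)] hurewicz_loop_class[OF h(1)] mult_homology_class by simp
  finally show "hurewicz (A \<otimes>\<^bsub>\<Gamma>\<^esub> B) = hurewicz A \<otimes>\<^bsub>H1\<^esub> hurewicz B" .
qed

text \<open>Replacing each 1-simplex of a chain by its frame loop changes the chain by a boundary and
  the cone over its boundary; for a cycle the latter vanishes.\<close>

definition cone :: "'a chain \<Rightarrow> 'a chain" where
  "cone = frag_extend (\<lambda>s. edge_chain (\<gamma> (s (\<lambda>i. if i = 0 then 1 else 0))))"

lemma cone_point_simplex: "cone (frag_of (point_simplex x)) = edge_chain (\<gamma> x)"
  by (simp add: cone_def point_simplex_def standard_simplex_0)

text \<open>By induction over the chain: the zero chain gives the constant loop, a simplex its frame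
  loop, and a difference the concatenation with the reversed loop. So a single loop suffices for a
  whole chain.\<close>

lemma chain_homologous_loop:
  assumes "singular_chain 1 X c"
  shows "\<exists>g\<in>loops X x0. homologous_rel 1 X {} (c - cone (chain_boundary 1 c)) (edge_chain g)"
  using assms unfolding singular_chain_def
proof (induction c rule: frag_induction)
  case zero
  have "homologous_rel 1 X {} 0 (edge_chain (\<lambda>t. x0))"
    using homologous_edge_const[OF base] homologous_rel_sym by blast
  then show ?case using loops_const[OF base] by (auto simp: cone_def)
next
  case (one \<sigma>)
  then have \<sigma>: "singular_simplex 1 X \<sigma>" by simp
  define d where "d = side \<sigma>"
  have d: "pathin X d" "edge d = \<sigma>" using pathin_side[OF \<sigma>] edge_side[OF \<sigma>] by (auto simp: d_def)
  have e: "d 0 \<in> topspace X" "d 1 \<in> topspace X"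
    using d(1) path_start_in_topspace path_finish_in_topspace by auto
  have f: "pathin X (\<gamma> (d 0))" "pathin X (\<gamma> (d 1))" "\<gamma> (d 0) 1 = d 0" "\<gamma> (d 1) 1 = d 1"
    using frame e by auto
  have "homologous_rel 1 X {} (edge_chain d + edge_chain (rev_path (\<gamma> (d 1)))) (edge_chain (d \<bowtie> rev_path (\<gamma> (d 1))))"
    using d f by (intro homologous_edge_concat pathin_rev_path) auto
  then have 1: "homologous_rel 1 X {} (edge_chain (d \<bowtie> rev_path (\<gamma> (d 1)))) (edge_chain d - edge_chain (\<gamma> (d 1)))"
    using homologous_rel_trans[OF homologous_rel_add[OF homologous_rel_refl[of 1 X "{}" "edge_chain d"]
          homologous_edge_rev[OF f(2)]] iffD1[OF homologous_rel_sym]] by simp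
  have 2: "homologous_rel 1 X {} (edge_chain (\<gamma> (d 0)) + edge_chain (d \<bowtie> rev_path (\<gamma> (d 1)))) (edge_chain (frame_loop d))"
    unfolding frame_loop_def using d f by (intro homologous_edge_concat pathin_loop_concat pathin_rev_path) auto
  have "homologous_rel 1 X {} (edge_chain (\<gamma> (d 0)) + (edge_chain d - edge_chain (\<gamma> (d 1)))) (edge_chain (frame_loop d))"
    by (rule homologous_rel_trans[OF 2]) (intro homologous_rel_add homologous_rel_refl, subst homologous_rel_sym, rule 1)
  moreover have "frag_of \<sigma> - cone (chain_boundary 1 (frag_of \<sigma>))
      = edge_chain (\<gamma> (d 0)) + (edge_chain d - edge_chain (\<gamma> (d 1)))"
  proof -
    have "cone (chain_boundary 1 (edge_chain d)) = edge_chain (\<gamma> (d 1)) - edge_chain (\<gamma> (d 0))"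
      unfolding chain_boundary_edge cone_point_simplex[symmetric] by (simp add: cone_def frag_extend_diff)
    then show ?thesis using d(2) by simp
  qed
  ultimately show ?case using frame_loop_in_loops[OF d(1)] by (intro bexI[of _ "frame_loop d"]) auto
next
  case (diff a b)
  then obtain g h where g: "g \<in> loops X x0" "homologous_rel 1 X {} (a - cone (chain_boundary 1 a)) (edge_chain g)"
    and h: "h \<in> loops X x0" "homologous_rel 1 X {} (b - cone (chain_boundary 1 b)) (edge_chain h)"
    by blast
  have "homologous_rel 1 X {} (edge_chain g + edge_chain (rev_path h)) (edge_chain (g \<bowtie> rev_path h))"
    using g h by (intro homologous_edge_concat pathin_rev_path) (auto simp: loops_def)
  note 1 = this
  have 2: "homologous_rel 1 X {} (edge_chain g - edge_chain h) (edge_chain g + edge_chain (rev_path h))"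
    using iffD1[OF homologous_rel_sym homologous_rel_add[OF homologous_rel_refl[of 1 X "{}" "edge_chain g"]
          homologous_edge_rev[of X h]]] h by (auto simp: loops_def)
  have 3: "homologous_rel 1 X {} (a - b - cone (chain_boundary 1 (a - b))) (edge_chain g - edge_chain h)"
    using homologous_rel_diff[OF g(2) h(2)]
    by (simp add: chain_boundary_diff cone_def frag_extend_diff algebra_simps)
  have "homologous_rel 1 X {} (a - b - cone (chain_boundary 1 (a - b))) (edge_chain (g \<bowtie> rev_path h))"
    by (rule homologous_rel_trans[OF 1 homologous_rel_trans[OF 2 3]])
  then show ?case using loops_concat[OF g(1) loops_rev[OF h(1)]] by blast
qed

lemma hurewicz_surj: "hurewicz ` carrier \<Gamma> = carrier H1"
proof
  show "hurewicz ` carrier \<Gamma> \<subseteq> carrier H1" using hurewicz_hom by (auto simp: hom_def)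
  show "carrier H1 \<subseteq> hurewicz ` carrier \<Gamma>"
  proof
    fix A assume "A \<in> carrier H1"
    then obtain c where c: "singular_chain 1 X c" "chain_boundary 1 c = 0" "A = homology_class c"
      unfolding carrier_H1 by (auto simp: singular_cycle)
    obtain g where g: "g \<in> loops X x0" "homologous_rel 1 X {} (c - cone (chain_boundary 1 c)) (edge_chain g)"
      using chain_homologous_loop[OF c(1)] by blast
    then have "A = homology_class (edge_chain g)"
      using c by (simp add: cone_def homology_class_eq_iff)
    also have "\<dots> = hurewicz (loop_class X x0 g)" using hurewicz_loop_class[OF g(1)] by simp
    finally show "A \<in> hurewicz ` carrier \<Gamma>" using loop_class_in_carrier[OF g(1)] by blast
  qed
qed

text \<open>Loops in the kernel are detected by a homomorphism \<open>\<psi>\<close> from 1-chains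
  to the abelianized group, sending a simplex to the class of its frame loop. It sends boundaries of
  2-simplices to the unit, because the two ways around a 2-simplex are homotopic; so a loop whose
  edge is a boundary has trivial class.\<close>

lemma hurewicz_kernel: "kernel \<Gamma> H1 hurewicz = derived \<Gamma> (carrier \<Gamma>)"
proof
  interpret h: group_hom \<Gamma> H1 hurewicz
    by (intro group_hom.intro group_hom_axioms.intro hurewicz_hom G.is_group) simp
  show "derived \<Gamma> (carrier \<Gamma>) \<subseteq> kernel \<Gamma> H1 hurewicz"
    by (rule derived_subset_kernel[OF h.group_hom_axioms abelian_homology_group])
  let ?D = "derived \<Gamma> (carrier \<Gamma>)" and ?A = "\<Gamma> Mod derived \<Gamma> (carrier \<Gamma>)"
  interpret D: normal ?D \<Gamma> by (rule G.derived_self_is_normal)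
  interpret A: comm_group ?A by (rule G.derived_quot_is_comm_group)
  define cl where "cl a = ?D #>\<^bsub>\<Gamma>\<^esub> a" for a
  have cl: "cl a \<in> carrier ?A" "cl (a \<otimes>\<^bsub>\<Gamma>\<^esub> b) = cl a \<otimes>\<^bsub>?A\<^esub> cl b" if "a \<in> carrier \<Gamma>" "b \<in> carrier \<Gamma>" for a b
    using that D.r_coset_hom_Mod unfolding hom_def cl_def by auto
  let ?f = "\<lambda>\<sigma>. cl (tr (side \<sigma>))"
  have f_closed: "?f ` singular_simplex_set 1 X \<subseteq> carrier ?A"
    using cl(1)[OF tr_in_carrier[OF pathin_side] tr_in_carrier[OF pathin_side]] by auto
  obtain \<psi> where \<psi>: "\<psi> \<in> hom (free_Abelian_group (singular_simplex_set 1 X)) ?A"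
    "\<And>\<sigma>. \<sigma> \<in> singular_simplex_set 1 X \<Longrightarrow> \<psi> (frag_of \<sigma>) = ?f \<sigma>"
    using A.free_Abelian_group_universal[OF f_closed] by blast
  interpret \<psi>: group_hom "free_Abelian_group (singular_simplex_set 1 X)" ?A \<psi>
    by (intro group_hom.intro group_hom_axioms.intro \<psi>(1) group_free_Abelian_group A.is_group)
  have \<psi>_add: "\<psi> (a + b) = \<psi> a \<otimes>\<^bsub>?A\<^esub> \<psi> b" if "singular_chain 1 X a" "singular_chain 1 X b" for a b
    using \<psi>.hom_mult[of a b] that by (simp add: singular_chain_def)
  have \<psi>_minus: "\<psi> (- a) = inv\<^bsub>?A\<^esub> \<psi> a" if "singular_chain 1 X a" for a
    using \<psi>.hom_inv[of a] that by (simp add: singular_chain_def)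
  have \<psi>_closed: "\<psi> a \<in> carrier ?A" if "singular_chain 1 X a" for a
    using \<psi>.hom_closed[of a] that by (simp add: singular_chain_def)
  have \<psi>_diff: "\<psi> (a - b) = \<psi> a \<otimes>\<^bsub>?A\<^esub> inv\<^bsub>?A\<^esub> \<psi> b" if "singular_chain 1 X a" "singular_chain 1 X b" for a b
    using \<psi>_add[of a "- b"] \<psi>_minus that by (simp add: singular_chain_minus)
  have bd: "\<psi> (chain_boundary 2 d) = \<one>\<^bsub>?A\<^esub>" if "singular_chain 2 X d" for d
  proof (rule free_Abelian_group_induct[of d "singular_simplex_set 2 X"])
    show "Poly_Mapping.keys d \<subseteq> singular_simplex_set 2 X" using that by (simp add: singular_chain_def)
    show "\<psi> (chain_boundary 2 0) = \<one>\<^bsub>?A\<^esub>" using \<psi>.hom_one by simp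
    fix a b assume ab: "Poly_Mapping.keys a \<subseteq> singular_simplex_set 2 X" "Poly_Mapping.keys b \<subseteq> singular_simplex_set 2 X"
      "\<psi> (chain_boundary 2 a) = \<one>\<^bsub>?A\<^esub>" "\<psi> (chain_boundary 2 b) = \<one>\<^bsub>?A\<^esub>"
    then have "singular_chain 1 X (chain_boundary 2 a)" "singular_chain 1 X (chain_boundary 2 b)"
      using singular_chain_boundary[of 2 X] by (auto simp: singular_chain_def simp flip: One_nat_def)
    then show "\<psi> (chain_boundary 2 (a - b)) = \<one>\<^bsub>?A\<^esub>"
      using ab by (simp only: chain_boundary_diff \<psi>_diff A.inv_one A.r_one A.one_closed)
  next
    fix \<sigma> assume "\<sigma> \<in> singular_simplex_set 2 X"
    then have \<sigma>: "singular_simplex 2 X \<sigma>" by simp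
    have fs: "singular_simplex 1 X (singular_face 2 k \<sigma>)" if "k \<le> 2" for k
      using singular_simplex_singular_face[OF \<sigma> _ that] by simp
    define s where "s k = tr (side (singular_face 2 k \<sigma>))" for k
    have p: "pathin X (side (singular_face 2 k \<sigma>))" if "k \<le> 2" for k using pathin_side[OF fs[OF that]] .
    have sc: "s k \<in> carrier \<Gamma>" if "k \<le> 2" for k unfolding s_def using tr_in_carrier[OF p[OF that]] .
    have join: "side (singular_face 2 2 \<sigma>) 1 = side (singular_face 2 0 \<sigma>) 0"
      using segment_point_in_simplex[of 0] segment_point_in_simplex[of 1]
      by (simp add: side_def singular_face_def) (rule arg_cong[where f=\<sigma>], auto simp: simplical_face_def fun_eq_iff)
    have "s 2 \<otimes>\<^bsub>\<Gamma>\<^esub> s 0 = s 1"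
      unfolding s_def using tr_cong[OF path_homotopic_sides[OF \<sigma>]] tr_concat[OF p p join] by simp
    then have s: "cl (s 1) = cl (s 2) \<otimes>\<^bsub>?A\<^esub> cl (s 0)" using cl(2)[of "s 2" "s 0"] sc by simp
    have c: "cl (s k) \<in> carrier ?A" if "k \<le> 2" for k using cl(1)[OF sc sc] that by blast
    have ps: "\<psi> (frag_of (singular_face 2 k \<sigma>)) = cl (s k)" if "k \<le> 2" for k
      using \<psi>(2) fs[OF that] by (simp add: s_def)
    have ch: "singular_chain 1 X (frag_of (singular_face 2 k \<sigma>))" if "k \<le> 2" for k
      using fs[OF that] by (simp add: singular_chain_of)
    have "chain_boundary 2 (frag_of \<sigma>) = frag_of (singular_face 2 0 \<sigma>) + frag_of (singular_face 2 2 \<sigma>) - frag_of (singular_face 2 1 \<sigma>)"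
      by (simp add: chain_boundary_of sum_atMost_1_2)
    then have "\<psi> (chain_boundary 2 (frag_of \<sigma>)) = cl (s 0) \<otimes>\<^bsub>?A\<^esub> cl (s 2) \<otimes>\<^bsub>?A\<^esub> inv\<^bsub>?A\<^esub> cl (s 1)"
      using ch ps by (simp add: \<psi>_diff \<psi>_add singular_chain_add)
    \<comment> \<open>The boundary yields the faces in the order 0, 2, while the path runs through
      face 2 and then face 0; commutativity of the quotient reconciles them.\<close>
    also have "cl (s 0) \<otimes>\<^bsub>?A\<^esub> cl (s 2) = cl (s 1)" unfolding s by (rule A.m_comm[OF c c]) auto
    also have "cl (s 1) \<otimes>\<^bsub>?A\<^esub> inv\<^bsub>?A\<^esub> cl (s 1) = \<one>\<^bsub>?A\<^esub>" by (rule A.r_inv[OF c]) simp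
    finally show "\<psi> (chain_boundary 2 (frag_of \<sigma>)) = \<one>\<^bsub>?A\<^esub>" .
  qed
  show "kernel \<Gamma> H1 hurewicz \<subseteq> ?D"
  proof
    fix a assume "a \<in> kernel \<Gamma> H1 hurewicz"
    then have a: "a \<in> carrier \<Gamma>" "hurewicz a = \<one>\<^bsub>H1\<^esub>" by (auto simp: kernel_def)
    obtain g where g: "g \<in> loops X x0" "a = loop_class X x0 g" using a(1) by (auto simp: carrier_fundamental_group)
    have gl: "pathin X g" using g by (simp add: loops_def)
    have "homology_class (edge_chain g) = singular_relboundary_set 1 X {}"
      using a(2) g hurewicz_loop_class[OF g(1)] one_H1 by simp
    then have "singular_relboundary 1 X {} (edge_chain g)"
      unfolding homology_class_def homologous_rel_set_eq_relboundary .
    then obtain d where d: "singular_chain 2 X d" "chain_boundary 2 d = edge_chain g"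
      unfolding singular_boundary by (auto simp: numeral_2_eq_2)
    have "\<one>\<^bsub>?A\<^esub> = \<psi> (edge_chain g)" using bd[OF d(1)] d(2) by simp
    also have "\<dots> = cl (tr (side (edge g)))" using \<psi>(2) singular_simplex_edge[OF gl] by simp
    also have "tr (side (edge g)) = tr g"
      by (rule tr_cong[OF path_homotopic_sym[OF path_homotopic_cong[OF gl]]]) (simp add: side_edge)
    also have "tr g = a" using tr_loop[OF g(1)] g(2) by simp
    finally have "?D #>\<^bsub>\<Gamma>\<^esub> a = ?D" by (simp add: cl_def FactGroup_def)
    then show "a \<in> ?D" using G.rcos_self[OF a(1) D.subgroup_axioms] by simp
  qed
qed

theorem abelianization_fundamental_group_iso: "abelianization \<Gamma> \<cong> homology_group 1 X"
proof -
  interpret h: group_hom \<Gamma> H1 hurewicz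
    by (intro group_hom.intro group_hom_axioms.intro hurewicz_hom G.is_group) simp
  show ?thesis
    unfolding abelianization_def using h.FactGroup_iso[OF hurewicz_surj] by (simp add: hurewicz_kernel)
qed

end

declare One_nat_def [simp]


section \<open>Counting coverings\<close>

text \<open>The map \<open>\<pi>\<close> from \<open>A\<close> through \<open>B\<close> to the
  abelianization of \<open>B\<close> is onto, and its kernel is the derived subgroup of
  \<open>A\<close>, since \<open>f\<close> carries derived subgroup to derived subgroup.\<close>

lemma abelianization_cong:
  assumes A: "group A" and B: "group B" and AB: "A \<cong> B"
  shows "abelianization A \<cong> abelianization B"
proof -
  interpret A: group A by (rule A)
  interpret B: group B by (rule B)
  obtain f where f: "f \<in> iso A B" using AB by (auto simp: is_iso_def)
  interpret f: group_hom A B f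
    using f by (intro group_hom.intro group_hom_axioms.intro A B) (auto simp: iso_def)
  let ?DA = "derived A (carrier A)" and ?DB = "derived B (carrier B)"
  interpret DB: normal ?DB B by (rule B.derived_self_is_normal)
  have bij: "inj_on f (carrier A)" "f ` carrier A = carrier B" using f by (auto simp: iso_def bij_betw_def)
  have DD: "?DB = f ` ?DA" using f.derived_img[of "carrier A"] bij(2) by simp
  define \<pi> where "\<pi> x = ?DB #>\<^bsub>B\<^esub> f x" for x
  have hom: "\<pi> \<in> hom A (B Mod ?DB)"
    using hom_compose[OF f.homh DB.r_coset_hom_Mod] by (simp add: \<pi>_def[abs_def] comp_def)
  interpret \<pi>: group_hom A "B Mod ?DB" \<pi>
    by (intro group_hom.intro group_hom_axioms.intro A hom DB.factorgroup_is_group)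
  have surj: "\<pi> ` carrier A = carrier (B Mod ?DB)"
  proof -
    have "\<pi> ` carrier A = (\<lambda>y. ?DB #>\<^bsub>B\<^esub> y) ` (f ` carrier A)"
      unfolding image_image \<pi>_def ..
    then show ?thesis unfolding bij(2) by (auto simp: FactGroup_def RCOSETS_def)
  qed
  have "kernel A (B Mod ?DB) \<pi> = {x \<in> carrier A. f x \<in> ?DB}"
    unfolding kernel_def \<pi>_def using B.coset_join1[OF _ _ DB.subgroup_axioms] B.coset_join2[OF _ DB.subgroup_axioms]
    by (auto simp: FactGroup_def)
  also have "\<dots> = ?DA"
    using bij(1) A.derived_in_carrier[of "carrier A"] unfolding DD by (auto simp: inj_on_def)
  finally show ?thesis
    using \<pi>.FactGroup_iso[OF surj] by (simp add: abelianization_def)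
qed

text \<open>Turns a number of equivalence classes into the number of values of a complete invariant;
  it is applied to \<open>stabs\<close>.\<close>

lemma card_quotient_kernel:
  "card (A // {(x, y). x \<in> A \<and> y \<in> A \<and> f x = f y}) = card (f ` A)"
proof -
  let ?g = "\<lambda>v. {x \<in> A. f x = v}"
  have "{(x, y). x \<in> A \<and> y \<in> A \<and> f x = f y} `` {x} = ?g (f x)" if "x \<in> A" for x
    using that by auto
  then have "A // {(x, y). x \<in> A \<and> y \<in> A \<and> f x = f y} = ?g ` (f ` A)"
    by (simp add: quotient_def image_image UNION_singleton_eq_range)
  moreover have "inj_on ?g (f ` A)"
  proof (rule inj_onI)
    fix v w assume "v \<in> f ` A" and eq: "?g v = ?g w"
    then obtain x where "x \<in> ?g v" by blast
    then have "x \<in> ?g w" unfolding eq .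
    then show "v = w" using \<open>x \<in> ?g v\<close> by simp
  qed
  ultimately show ?thesis by (simp add: card_image)
qed

text \<open>This makes a sum over representatives a sum over isomorphism types, in which every group
  of the family belongs to exactly one term.\<close>

lemma iso_representatives_unique:
  assumes A: "\<And>G. G \<in> A \<Longrightarrow> group G" and G: "G \<in> A"
  shows "\<exists>!H. H \<in> iso_representatives A \<and> G \<cong> H"
proof -
  let ?R = "{(G, H). G \<in> A \<and> H \<in> A \<and> G \<cong> H}"
  have equiv: "equiv A ?R"
  proof (rule equivI)
    show "sym ?R" using A by (auto simp: sym_def intro: group.iso_sym)
    show "trans ?R" by (auto simp: trans_def intro: iso_trans)
  qed (auto simp: refl_on_def iso_refl)
  have some: "(SOME G. G \<in> C) \<in> C" if "C \<in> A // ?R" for C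
    using in_quotient_imp_non_empty[OF equiv that] by (simp add: some_in_eq)
  have C: "?R `` {G} \<in> A // ?R" using G by (rule quotientI)
  define h where "h = (SOME H. H \<in> ?R `` {G})"
  have hG: "h \<in> ?R `` {G}" unfolding h_def by (rule some[OF C])
  show ?thesis
  proof (rule ex1I[of _ h])
    have "h \<in> iso_representatives A"
      unfolding iso_representatives_def h_def by (rule imageI[OF C])
    then show "h \<in> iso_representatives A \<and> G \<cong> h" using hG by simp
    fix H assume H: "H \<in> iso_representatives A \<and> G \<cong> H"
    then obtain D where D: "D \<in> A // ?R" "H = (SOME G. G \<in> D)" by (auto simp: iso_representatives_def)
    have HD: "H \<in> D" using some[OF D(1)] D(2) by simp
    then have HA: "H \<in> A" using in_quotient_imp_subset[OF equiv D(1)] by blast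
    then have "H \<in> ?R `` {G}" using G H by simp
    moreover have "(H, H) \<in> ?R" using HA by (simp add: iso_refl)
    ultimately have "D = ?R `` {G}" using quotient_eqI[OF equiv D(1) C HD] by blast
    then show "H = h" using D(2) by (simp only: h_def)
  qed
qed

lemma iso_representatives_subset:
  assumes A: "\<And>G. G \<in> A \<Longrightarrow> group G"
  shows "iso_representatives A \<subseteq> A"
proof
  let ?R = "{(G, H). G \<in> A \<and> H \<in> A \<and> G \<cong> H}"
  fix H assume "H \<in> iso_representatives A"
  then obtain G where G: "G \<in> A" "H = (SOME H. H \<in> ?R `` {G})"
    by (auto simp: iso_representatives_def quotient_def)
  have "G \<in> ?R `` {G}" using G(1) by (simp add: iso_refl)
  then have "H \<in> ?R `` {G}" unfolding G(2) by (rule someI)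
  then show "H \<in> A" by simp
qed

lemma card_epis_eq_sum_num_hom:
  assumes G: "group G" and l: "l \<ge> 1" and fin: "\<And>d. d dvd l \<Longrightarrow> finite (epis G d)"
  shows "int (card (epis G l)) =
    (\<Sum>d | d dvd l. moebius_function (l div d) * int (num_hom G (integer_mod_group d)))"
proof (rule moebius_inversion[OF _ l])
  fix d assume d: "d dvd l"
  have "d \<ge> 1" using d l by (metis dvd_pos_nat less_eq_Suc_le One_nat_def)
  then have "num_hom G (integer_mod_group d) = (\<Sum>c | c dvd d. card (epis G c))"
    using fin d by (intro num_hom_cyclic_eq_sum_epis[OF G]) (auto intro: dvd_trans)
  then show "int (num_hom G (integer_mod_group d)) = (\<Sum>c | c dvd d. int (card (epis G c)))" by simp
qed

section \<open>Coverings and subgroups over a fixed base point\<close>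

locale simple_base =
  fixes M :: "'a topology" and x0 :: 'a
  assumes loc: "locally_simple M" and con: "connected_space M" and base: "x0 \<in> topspace M"
begin

abbreviation "\<Gamma> \<equiv> fundamental_group M x0"

sublocale G: group \<Gamma> by (rule group_fundamental_group[OF base])

lemma lpc: "locally_path_connected_space M"
  by (rule locally_simple_imp_locally_path_connected[OF loc])

lemma pc: "path_connected_space M"
  using path_connected_eq_connected_space[OF lpc] con by simp

lemma connected_coveringsD:
  assumes "(X, p) \<in> connected_coverings n M"
  shows "covering_map X M p" "connected_space X" "path_connected_space X"
    "card {x \<in> topspace X. p x = x0} = n"
proof -
  show X: "covering_map X M p" "connected_space X" and "card {x \<in> topspace X. p x = x0} = n"
    using assms base by (auto simp: connected_coverings_def connected_covering_def)
  show "path_connected_space X"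
    using path_connected_eq_connected_space[OF covering_locally_path_connected[OF X(1) lpc]] X(2) by simp
qed

lemma base_fibre_nonempty:
  assumes "covering_map X M p" obtains x where "x \<in> topspace X" "p x = x0"
  using assms base unfolding covering_map_def by (metis imageE)

lemma stab_in_index_subgroups:
  assumes "(X, p) \<in> connected_coverings n M" "x \<in> topspace X" "p x = x0"
  shows "stab X p M x \<in> G.index_subgroups n"
  using stab_subgroup_index[OF connected_coveringsD(1,3)[OF assms(1)] assms(2)] assms(3)
    connected_coveringsD(4)[OF assms(1)]
  by (simp add: G.index_subgroups_def)

lemma covering_of_subgroup:
  assumes "F \<in> G.index_subgroups n" "n \<ge> 1"
  obtains X p x where "(X, p) \<in> connected_coverings n M" "x \<in> topspace X" "p x = x0" "stab X p M x = F"
proof -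
  have s: "subgroup F \<Gamma>" "card (rcosets\<^bsub>\<Gamma>\<^esub> F) = n"
    using assms(1) by (auto simp: G.index_subgroups_def)
  show thesis by (rule subgroup_covering_exists[OF base pc loc s assms(2)]) (rule that)
qed

lemma num_connected_coverings_eq:
  assumes n: "n \<ge> 1"
  shows "num_connected_coverings n M =
    card ((\<lambda>K. conjugate \<Gamma> K ` carrier \<Gamma>) ` G.index_subgroups n)"
proof -
  let ?s = "\<lambda>c. stabs (fst c) (snd c) M x0" and ?C = "connected_coverings n M"
  have "equivalent_coverings c c' \<longleftrightarrow> ?s c = ?s c'" if c: "c \<in> ?C" "c' \<in> ?C" for c c'
  proof -
    obtain X p Y q where "c = (X, p)" "c' = (Y, q)" by (cases c, cases c')
    then show ?thesis
      using c equivalent_coverings_iff_stabs[OF lpc base connected_coveringsD(1,2)[of X p n]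
          connected_coveringsD(1,2)[of Y q n]] by simp
  qed
  then have "{(c, c'). c \<in> ?C \<and> c' \<in> ?C \<and> equivalent_coverings c c'} =
      {(c, c'). c \<in> ?C \<and> c' \<in> ?C \<and> ?s c = ?s c'}"
    by auto
  then have "num_connected_coverings n M = card (?s ` ?C)"
    unfolding num_connected_coverings_def by (simp only: card_quotient_kernel)
  also have "?s ` ?C = (\<lambda>K. conjugate \<Gamma> K ` carrier \<Gamma>) ` G.index_subgroups n"
  proof (intro equalityI subsetI)
    fix S assume "S \<in> ?s ` ?C"
    then obtain X p where Xp: "(X, p) \<in> ?C" "S = stabs X p M x0" by force
    note X = connected_coveringsD[OF Xp(1)]
    obtain x where x: "x \<in> topspace X" "p x = x0" using base_fibre_nonempty[OF X(1)] .
    have "S = conjugate \<Gamma> (stab X p M x) ` carrier \<Gamma>"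
      using stabs_conjugacy_class[OF X(1,3) x(1)] x(2) Xp(2) by simp
    then show "S \<in> (\<lambda>K. conjugate \<Gamma> K ` carrier \<Gamma>) ` G.index_subgroups n"
      using stab_in_index_subgroups[OF Xp(1) x] by blast
  next
    fix S assume "S \<in> (\<lambda>K. conjugate \<Gamma> K ` carrier \<Gamma>) ` G.index_subgroups n"
    then obtain K where K: "K \<in> G.index_subgroups n" "S = conjugate \<Gamma> K ` carrier \<Gamma>" by blast
    obtain X p x where Xp: "(X, p) \<in> ?C" and x: "x \<in> topspace X" "p x = x0" "stab X p M x = K"
      using covering_of_subgroup[OF K(1) n] .
    note X = connected_coveringsD[OF Xp]
    have "S = stabs X p M x0"
      using stabs_conjugacy_class[OF X(1,3) x(1)] x(2,3) K(2) by simp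
    then show "S \<in> ?s ` ?C" using Xp by force
  qed
  finally show ?thesis .
qed

text \<open>Two isomorphisms are chained: the fundamental group of the covering with the stabilizer,
  and its abelianization with the homology of \<open>X\<close>. The latter needs a path frame in the
  covering itself, based at \<open>x\<close>.\<close>

lemma abelianization_stab_iso:
  assumes X: "covering_map X M p" "path_connected_space X" and x: "x \<in> topspace X" "p x = x0"
  shows "abelianization (\<Gamma>\<lparr>carrier := stab X p M x\<rparr>) \<cong> homology_group 1 X"
proof -
  obtain \<gamma> where "path_frame X x \<gamma>" using path_frame_exists[OF X(2) x(1)] .
  then interpret P: path_frame X x \<gamma> .
  let ?S = "\<Gamma>\<lparr>carrier := stab X p M x\<rparr>"
  have S: "group ?S"
    using G.subgroup_imp_group stab_subgroup_index(1)[OF X x(1)] x(2) by simp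
  have iso: "fundamental_group X x \<cong> ?S"
    using fundamental_group_covering_iso[OF X(1) x(1)] x(2) by simp
  have "abelianization ?S \<cong> abelianization (fundamental_group X x)"
    by (rule abelianization_cong[OF S P.G.is_group P.G.iso_sym[OF iso]])
  then show ?thesis using P.abelianization_fundamental_group_iso iso_trans by blast
qed

lemma group_homology_coverings:
  "H \<in> (\<lambda>(X, p). homology_group 1 X) ` connected_coverings m M \<Longrightarrow> group H"
  by auto

lemma covering_homology_group_iso_abelianization:
  assumes "H \<in> covering_homology_groups m M"
  shows "group H" "\<exists>F\<in>G.index_subgroups m. abelianization (\<Gamma>\<lparr>carrier := F\<rparr>) \<cong> H"
proof -
  have "H \<in> (\<lambda>(X, p). homology_group 1 X) ` connected_coverings m M"
    using assms iso_representatives_subset[of "(\<lambda>(X, p). homology_group 1 X) ` connected_coverings m M"]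
      group_homology_coverings unfolding covering_homology_groups_def by blast
  then obtain X p where Xp: "(X, p) \<in> connected_coverings m M" "H = homology_group 1 X" by auto
  show "group H" using Xp(2) by simp
  note X = connected_coveringsD[OF Xp(1)]
  obtain x where x: "x \<in> topspace X" "p x = x0" using base_fibre_nonempty[OF X(1)] .
  show "\<exists>F\<in>G.index_subgroups m. abelianization (\<Gamma>\<lparr>carrier := F\<rparr>) \<cong> H"
    using stab_in_index_subgroups[OF Xp(1) x] abelianization_stab_iso[OF X(1,3) x] Xp(2) by blast
qed

text \<open>The representative is that of the homology of the covering belonging to
  \<open>F\<close>. Uniqueness assigns every subgroup of index \<open>m\<close> to one term of the
  sum over homology groups.\<close>

lemma abelianization_unique_homology_group:
  assumes F: "F \<in> G.index_subgroups m" and m: "m \<ge> 1"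
  shows "\<exists>!H. H \<in> covering_homology_groups m M \<and> abelianization (\<Gamma>\<lparr>carrier := F\<rparr>) \<cong> H"
proof -
  let ?A = "(\<lambda>(X, p). homology_group 1 X) ` connected_coverings m M"
  obtain X p x where Xp: "(X, p) \<in> connected_coverings m M" and x: "x \<in> topspace X" "p x = x0" "stab X p M x = F"
    using covering_of_subgroup[OF F m] .
  note X = connected_coveringsD[OF Xp]
  have iso: "abelianization (\<Gamma>\<lparr>carrier := F\<rparr>) \<cong> homology_group 1 X"
    using abelianization_stab_iso[OF X(1,3) x(1,2)] x(3) by simp
  have grp: "group (abelianization (\<Gamma>\<lparr>carrier := F\<rparr>))"
    unfolding abelianization_def using F
    by (intro group.derived_quot_is_group G.subgroup_imp_group) (simp add: G.index_subgroups_def)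
  have "homology_group 1 X \<in> ?A" using Xp by force
  from iso_representatives_unique[OF group_homology_coverings this]
  have ex1: "\<exists>!H. H \<in> covering_homology_groups m M \<and> homology_group 1 X \<cong> H"
    by (simp add: covering_homology_groups_def)
  have "homology_group 1 X \<cong> H \<longleftrightarrow> abelianization (\<Gamma>\<lparr>carrier := F\<rparr>) \<cong> H" for H :: "('a \<times> nat) chain set monoid"
    by (rule iffI, rule iso_trans[OF iso], assumption, rule iso_trans[OF group.iso_sym[OF grp iso]])
  then show ?thesis using ex1 by simp
qed

text \<open>Distinct representatives need distinct subgroups, as each subgroup has one
  representative; so the representatives inject into the finite set of subgroups of index
  \<open>m\<close>.\<close>

lemma finite_covering_homology_groups:
  assumes fin: "finite (G.index_subgroups m)" and m: "m \<ge> 1"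
  shows "finite (covering_homology_groups m M)"
proof -
  have "\<forall>H\<in>covering_homology_groups m M.
      \<exists>F. F \<in> G.index_subgroups m \<and> abelianization (\<Gamma>\<lparr>carrier := F\<rparr>) \<cong> H"
    using covering_homology_group_iso_abelianization(2) by blast
  from bchoice[OF this] obtain F where F: "\<And>H. H \<in> covering_homology_groups m M \<Longrightarrow>
      F H \<in> G.index_subgroups m \<and> abelianization (\<Gamma>\<lparr>carrier := F H\<rparr>) \<cong> H"
    by blast
  have "inj_on F (covering_homology_groups m M)"
  proof (rule inj_onI)
    fix H H' assume H: "H \<in> covering_homology_groups m M" "H' \<in> covering_homology_groups m M" "F H = F H'"
    then have *: "F H \<in> G.index_subgroups m" "abelianization (\<Gamma>\<lparr>carrier := F H\<rparr>) \<cong> H"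
      "abelianization (\<Gamma>\<lparr>carrier := F H\<rparr>) \<cong> H'"
      using F[OF H(1)] F[OF H(2)] by auto
    obtain K where "\<And>L. L \<in> covering_homology_groups m M \<and>
        abelianization (\<Gamma>\<lparr>carrier := F H\<rparr>) \<cong> L \<Longrightarrow> L = K"
      using abelianization_unique_homology_group[OF *(1) m] by (elim ex1E) blast
    then show "H = H'" using H(1,2) *(2,3) by blast
  qed
  moreover have "F ` covering_homology_groups m M \<subseteq> G.index_subgroups m" using F by blast
  ultimately show ?thesis using fin finite_imageD finite_subset by blast
qed

text \<open>The subgroups of index \<open>m\<close> are grouped by the representative
  \<open>r F\<close> of their first homology. The number of epimorphisms depends on \<open>F\<close>
  through \<open>r F\<close> only, and the block belonging to \<open>H\<close> has
  \<open>num_subgroups_with_H1 \<Gamma> H m\<close> members.\<close>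

lemma sum_epis_eq_sum_homology_groups:
  assumes fg: "finitely_generated_group \<Gamma>" and m: "m \<ge> 1" and l: "l \<ge> 1"
  shows "(\<Sum>F\<in>G.index_subgroups m. int (card (epis (\<Gamma>\<lparr>carrier := F\<rparr>) l))) =
    (\<Sum>H\<in>covering_homology_groups m M. \<Sum>d | d dvd l.
       moebius_function (l div d) * int (num_hom H (integer_mod_group d)) * int (num_subgroups_with_H1 \<Gamma> H m))"
proof -
  let ?I = "G.index_subgroups m" and ?R = "covering_homology_groups m M"
  let ?ab = "\<lambda>F. abelianization (\<Gamma>\<lparr>carrier := F\<rparr>)"
  have fin: "finite ?I" by (rule G.finite_index_subgroups[OF fg m])
  define r where "r F = (THE H. H \<in> ?R \<and> ?ab F \<cong> H)" for F
  have r: "r F \<in> ?R \<and> ?ab F \<cong> r F" if "F \<in> ?I" for F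
    unfolding r_def by (rule theI'[OF abelianization_unique_homology_group[OF that m]])
  have r_iff: "r F = H \<longleftrightarrow> ?ab F \<cong> H" if "F \<in> ?I" "H \<in> ?R" for F H
    using r[OF that(1)] abelianization_unique_homology_group[OF that(1) m] that(2) by blast
  have t_eq: "int (card (epis (\<Gamma>\<lparr>carrier := F\<rparr>) l)) =
      (\<Sum>d | d dvd l. moebius_function (l div d) * int (num_hom (r F) (integer_mod_group d)))" if F: "F \<in> ?I" for F
  proof -
    have gF: "group (\<Gamma>\<lparr>carrier := F\<rparr>)"
      using G.subgroup_imp_group F by (simp add: G.index_subgroups_def)
    have "int (card (epis (\<Gamma>\<lparr>carrier := F\<rparr>) l)) =
        (\<Sum>d | d dvd l. moebius_function (l div d) * int (num_hom (\<Gamma>\<lparr>carrier := F\<rparr>) (integer_mod_group d)))"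
    proof (rule card_epis_eq_sum_num_hom[OF gF l])
      fix d assume "d dvd l"
      then have "d \<ge> 1" using l by (metis dvd_pos_nat less_eq_Suc_le One_nat_def)
      then show "finite (epis (\<Gamma>\<lparr>carrier := F\<rparr>) d)" by (rule G.finite_epis[OF fg F m])
    qed
    moreover have "num_hom (\<Gamma>\<lparr>carrier := F\<rparr>) (integer_mod_group d) = num_hom (r F) (integer_mod_group d)" for d
      using num_hom_abelianization[OF gF _ abelian_integer_mod_group, of "r F"] r[OF F]
        covering_homology_group_iso_abelianization(1)[of "r F" m] by simp
    ultimately show ?thesis by simp
  qed
  have "(\<Sum>F\<in>?I. int (card (epis (\<Gamma>\<lparr>carrier := F\<rparr>) l))) =
      (\<Sum>F\<in>?I. \<Sum>d | d dvd l. moebius_function (l div d) * int (num_hom (r F) (integer_mod_group d)))"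
    using t_eq by (intro sum.cong) auto
  also have "\<dots> = (\<Sum>H\<in>?R. \<Sum>F | F \<in> ?I \<and> r F = H.
      \<Sum>d | d dvd l. moebius_function (l div d) * int (num_hom (r F) (integer_mod_group d)))"
    by (rule sum.group[symmetric, OF fin finite_covering_homology_groups[OF fin m]]) (use r in blast)
  also have "\<dots> = (\<Sum>H\<in>?R. \<Sum>d | d dvd l.
       moebius_function (l div d) * int (num_hom H (integer_mod_group d)) * int (num_subgroups_with_H1 \<Gamma> H m))"
  proof (intro sum.cong refl)
    fix H assume H: "H \<in> ?R"
    have "{F \<in> ?I. r F = H} = {F. subgroup F \<Gamma> \<and> card (rcosets\<^bsub>\<Gamma>\<^esub> F) = m \<and> ?ab F \<cong> H}"
      using r_iff[OF _ H] by (auto simp: G.index_subgroups_def)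
    then have "card {F \<in> ?I. r F = H} = num_subgroups_with_H1 \<Gamma> H m"
      by (simp add: num_subgroups_with_H1_def)
    moreover have "(\<Sum>F | F \<in> ?I \<and> r F = H.
        \<Sum>d | d dvd l. moebius_function (l div d) * int (num_hom (r F) (integer_mod_group d))) =
      (\<Sum>F | F \<in> ?I \<and> r F = H.
        \<Sum>d | d dvd l. moebius_function (l div d) * int (num_hom H (integer_mod_group d)))"
      by (intro sum.cong) auto
    ultimately show "(\<Sum>F | F \<in> ?I \<and> r F = H.
        \<Sum>d | d dvd l. moebius_function (l div d) * int (num_hom (r F) (integer_mod_group d))) =
      (\<Sum>d | d dvd l.
       moebius_function (l div d) * int (num_hom H (integer_mod_group d)) * int (num_subgroups_with_H1 \<Gamma> H m))"
      by (simp add: sum_distrib_left mult.commute)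
  qed
  finally show ?thesis .
qed

end

theorem theorem7:
  fixes M :: "'a topology" and x0 :: 'a and dim n :: nat
  assumes "manifold dim M" and "connected_space M" and "x0 \<in> topspace M"
    and "finitely_generated_group (fundamental_group M x0)"
    and "n \<ge> 1"
  shows "real (num_connected_coverings n M) =
    1 / real n *
      (\<Sum>(l, m) \<in> {(l, m). l * m = n}.
         \<Sum>H \<in> covering_homology_groups m M.
           \<Sum>d | d dvd l.
             real_of_int (moebius_function (l div d)) * real (num_hom H (integer_mod_group d))
               * real (num_subgroups_with_H1 (fundamental_group M x0) H m))"
proof -
  interpret simple_base M x0
    using assms manifold_locally_simple by unfold_locales
  note fg = assms(4) and n = assms(5)
  let ?t = "\<lambda>l m. \<Sum>H \<in> covering_homology_groups m M. \<Sum>d | d dvd l.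
     moebius_function (l div d) * int (num_hom H (integer_mod_group d)) * int (num_subgroups_with_H1 \<Gamma> H m)"
  \<comment> \<open>Multiplied by \<open>n\<close>, the formula is an identity of integers, where
    the negative Moebius values can be summed; the division is carried out over the reals at the
    end.\<close>
  have "int (n * num_connected_coverings n M) =
      (\<Sum>(l, m) \<in> {(l, m). l * m = n}. \<Sum>F\<in>G.index_subgroups m. int (card (epis (\<Gamma>\<lparr>carrier := F\<rparr>) l)))"
    unfolding num_connected_coverings_eq[OF n] G.card_conjugacy_classes_index[OF fg n]
    by (simp add: case_prod_unfold)
  also have "\<dots> = (\<Sum>(l, m) \<in> {(l, m). l * m = n}. ?t l m)"
  proof (intro sum.cong refl, clarify)
    fix l m assume "n = l * m"
    then have "l \<ge> 1" "m \<ge> 1" using n by (cases l; cases m; auto)+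
    then show "(\<Sum>F\<in>G.index_subgroups m. int (card (epis (\<Gamma>\<lparr>carrier := F\<rparr>) l))) = ?t l m"
      using sum_epis_eq_sum_homology_groups[OF fg] by blast
  qed
  finally have "real_of_int (int (n * num_connected_coverings n M)) =
      real_of_int (\<Sum>(l, m) \<in> {(l, m). l * m = n}. ?t l m)"
    by (rule arg_cong)
  then have "real n * real (num_connected_coverings n M) =
      (\<Sum>(l, m) \<in> {(l, m). l * m = n}. \<Sum>H \<in> covering_homology_groups m M. \<Sum>d | d dvd l.
         real_of_int (moebius_function (l div d)) * real (num_hom H (integer_mod_group d))
           * real (num_subgroups_with_H1 \<Gamma> H m))"
    by (simp add: case_prod_unfold)
  then show ?thesis using n by (simp add: field_simps)
qed

end
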